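(* Let $m\ge 7$. If there is a balanced triangle design in $\mathbb{F}_2^m$, then there is a balanced triangle design in $\mathbb{F}_2^{m+6}$.
   Context: For a vector space $V$ over $\mathbb{F}_q$, a triangle is a set $\{\langle a,b\rangle,\langle b,c\rangle,\langle c,a\rangle\}$ of three $2$-dimensional subspaces, where $a,b,c\in V$ are linearly independent and $\langle\cdot\rangle$ denotes linear span over $\mathbb{F}_q$. A triangle design in $V$ is a set $\mathcal{T}$ of triangles in $V$ such that every $2$-dimensional subspace of $V$ is one of the three subspaces of exactly one triangle in $\mathcal{T}$. A triangle covers a nonzero vector $x$ if $x$ lies in at least one of its three $2$-dimensional subspaces. A triangle design is balanced if every nonzero vector of $V$ is covered by the same number of triangles of the design. *)

theory Defs
  imports "HOL.Vector_Spaces" "HOL-Library.Z2" "HOL-Library.Function_Algebras"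
begin

definition covers :: "'a set set \<Rightarrow> 'a \<Rightarrow> bool" where
  "covers T x \<longleftrightarrow> (\<exists>W\<in>T. x \<in> W)"

context vector_space
begin

text \<open>Linear independence is that of the family \<open>a, b, c\<close>, hence the distinctness condition:
  \<^const>\<open>independent\<close> speaks about the set and ignores repetitions.\<close>

definition triangle :: "'b set \<Rightarrow> 'b set set \<Rightarrow> bool" where
  "triangle V T \<longleftrightarrow>
     (\<exists>a\<in>V. \<exists>b\<in>V. \<exists>c\<in>V. distinct [a, b, c] \<and> independent {a, b, c} \<and>
        T = {span {a, b}, span {b, c}, span {c, a}})"

definition triangle_design :: "'b set \<Rightarrow> 'b set set set \<Rightarrow> bool" where
  "triangle_design V \<T> \<longleftrightarrow>
     (\<forall>T\<in>\<T>. triangle V T) \<and>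
     (\<forall>W. subspace W \<and> W \<subseteq> V \<and> dim W = 2 \<longrightarrow> (\<exists>!T. T \<in> \<T> \<and> W \<in> T))"

text \<open>Meant for finite \<open>V\<close> (finite-dimensional over a finite field), where \<^const>\<open>card\<close> counts
  properly.\<close>

definition balanced_triangle_design :: "'b set \<Rightarrow> 'b set set set \<Rightarrow> bool" where
  "balanced_triangle_design V \<T> \<longleftrightarrow>
     triangle_design V \<T> \<and>
     (\<exists>r. \<forall>x\<in>V. x \<noteq> 0 \<longrightarrow> card {T \<in> \<T>. covers T x} = r)"

end

text \<open>The space of \<open>n\<close>-tuples over a field is the subspace of all sequences that vanish from
  index \<open>n\<close> on, so that spaces of different dimensions live in one type.\<close>

definition seq_scale :: "'a::field \<Rightarrow> (nat \<Rightarrow> 'a) \<Rightarrow> nat \<Rightarrow> 'a" where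
  "seq_scale c x = (\<lambda>i. c * x i)"

global_interpretation seq: vector_space "seq_scale :: 'a::field \<Rightarrow> (nat \<Rightarrow> 'a) \<Rightarrow> nat \<Rightarrow> 'a"
  by unfold_locales (auto simp: seq_scale_def fun_eq_iff algebra_simps)

definition tuples :: "nat \<Rightarrow> (nat \<Rightarrow> 'a::field) set" where
  "tuples n = {x. \<forall>i\<ge>n. x i = 0}"

lemma subspace_tuples: "seq.subspace (tuples n)"
  by (auto simp: seq.subspace_def tuples_def seq_scale_def)

definition unit_seq :: "nat \<Rightarrow> nat \<Rightarrow> 'a::field" where
  "unit_seq j = (\<lambda>i. if i = j then 1 else 0)"

lemma tuples_Suc_decomp:
  "x \<in> tuples (Suc n) \<longleftrightarrow> (\<exists>k. x - seq_scale k (unit_seq n) \<in> tuples n)"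
proof
  assume "x \<in> tuples (Suc n)"
  then have "x - seq_scale (x n) (unit_seq n) \<in> tuples n"
    by (auto simp: tuples_def seq_scale_def unit_seq_def Suc_le_eq)
  then show "\<exists>k. x - seq_scale k (unit_seq n) \<in> tuples n" ..
qed (auto simp: tuples_def seq_scale_def unit_seq_def)

lemma tuples_basis:
  fixes n :: nat
  defines "B \<equiv> (\<lambda>n. unit_seq ` {..<n} :: (nat \<Rightarrow> 'a::field) set)"
  shows "seq.independent (B n) \<and> seq.span (B n) = tuples n \<and> card (B n) = n"
  unfolding B_def
proof (induction n)
  case 0
  have "tuples 0 = {0 :: nat \<Rightarrow> 'a}"
    by (simp add: tuples_def set_eq_iff fun_eq_iff)
  then show ?case by (simp add: seq.independent_empty)
next
  case (Suc n)
  then have ind: "seq.independent (unit_seq ` {..<n} :: (nat \<Rightarrow> 'a) set)"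
    and span: "seq.span (unit_seq ` {..<n} :: (nat \<Rightarrow> 'a) set) = tuples n"
    and card: "card (unit_seq ` {..<n} :: (nat \<Rightarrow> 'a) set) = n" by auto
  have notin: "(unit_seq n :: nat \<Rightarrow> 'a) \<notin> tuples n"
    by (auto simp: tuples_def unit_seq_def)
  then have "(unit_seq n :: nat \<Rightarrow> 'a) \<notin> unit_seq ` {..<n}"
    using seq.span_base[of "unit_seq n :: nat \<Rightarrow> 'a" "unit_seq ` {..<n}"] unfolding span by (rule contrapos_nn)
  moreover have "seq.span (insert (unit_seq n) (unit_seq ` {..<n})) = (tuples (Suc n) :: (nat \<Rightarrow> 'a) set)"
    by (simp only: seq.span_insert span set_eq_iff mem_Collect_eq tuples_Suc_decomp simp_thms)
  moreover have "seq.independent (insert (unit_seq n) (unit_seq ` {..<n} :: (nat \<Rightarrow> 'a) set))"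
    by (simp only: seq.independent_insert span notin ind simp_thms if_False if_True split: if_split)
  ultimately show ?case
    using card by (simp add: lessThan_Suc)
qed

lemma dim_tuples: "seq.dim (tuples n :: (nat \<Rightarrow> 'a::field) set) = n"
proof -
  define B where "B = (unit_seq ` {..<n} :: (nat \<Rightarrow> 'a) set)"
  have B: "seq.independent B \<and> seq.span B = tuples n \<and> card B = n"
    unfolding B_def by (rule tuples_basis)
  then have "seq.dim (seq.span B) = card B"
    by (intro seq.dim_span_eq_card_independent) (rule conjunct1)
  then show ?thesis
    using B by (simp only: simp_thms)
qed

end

theory Submission
  imports Defs
begin

text \<open>Double counting shows that a balanced triangle design in \<open>F\<^sub>2\<^sup>m\<close> forces \<open>m mod 6 = 1\<close>. Conversely
  such a design exists for every \<open>m = 6 k + 1\<close>, so the given design only serves to determine \<open>m\<close>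
  modulo \<open>6\<close>. Write \<open>F\<^sub>2\<^sup>m = X + \<langle>e\<rangle>\<close> where \<open>X\<close> has dimension \<open>6 k\<close> and is a vector space over the field
  \<open>K\<close> with \<open>64\<close> elements. The lines whose points have \<open>K\<close>-dependent \<open>X\<close>-components lie in the
  \<open>7\<close>-dimensional spaces \<open>K x + \<langle>e\<rangle>\<close>, any two of which share only \<open>e\<close>; each of these carries a design
  that is invariant under a Singer cycle of order \<open>127\<close>. The remaining lines of \<open>X\<close> lie in a unique
  \<open>K\<close>-plane each, and in a \<open>K\<close>-plane they are decomposed by triangles invariant under a Singer cycle of
  order \<open>4095\<close>, that is, by a family of base triangles whose differences tile the residues not divisible by
  \<open>65\<close>. Finally a triangle of \<open>X\<close> is lifted to four triangles of \<open>X + \<langle>e\<rangle>\<close> that cover the twelve lifts of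
  its lines. Balancedness is local: every part is such that through each point exactly one third of the lines
  have that point as a non-vertex of their triangle.\<close>

section \<open>Triangles as decompositions of sets of ordered pairs\<close>

text \<open>An arbitrary design has no symmetry along which six dimensions could be added, and a
  Singer cycle on the whole space would require new base triangles for every \<open>k\<close>.
  Splitting the lines by their K-span leaves two configurations whose size is independent of
  \<open>k\<close>, so two finite verifications serve all dimensions. A base triangle uses 18
  differences, six per side. In dimension 7 this fits: \<open>126 = 7 * 18\<close>. On a K-line
  alone it fails, as 62 is not a multiple of 18; hence \<open>e\<close> is attached to the
  K-dependent lines. In a K-plane the multiples of \<open>65 = 4095 / 63\<close> are the logarithms
  of the nonzero elements of \<open>K\<close>, and the other residues number
  \<open>4032 = 224 * 18\<close>. As to one third: each vertex of a triangle is on two of its sides,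
  each of the three further points on one. A point that is a non-vertex for a third of the
  \<open>L\<close> lines through it lies on \<open>L / 3 + (2 L / 3) / 2 = 2 L / 3\<close>
  triangles. Unlike a constant count, a proportion passes to disjoint unions, and one third is the
  value that survives the lift.\<close>

type_synonym vec = "nat \<Rightarrow> bit"

lemma vec_add_self [simp]: "(x::vec) + x = 0"
  by (simp add: fun_eq_iff)

lemma vec_add_self_left [simp]: "(x::vec) + (x + y) = y"
  by (simp add: add.assoc [symmetric])

lemma vec_add_eq_0 [simp]: "(x::vec) + y = 0 \<longleftrightarrow> x = y"
  by (metis vec_add_self vec_add_self_left add.right_neutral)

lemma vec_add_eq_iff: "(x::vec) + y = z \<longleftrightarrow> y = x + z"
  by auto

definition line :: "vec \<Rightarrow> vec \<Rightarrow> vec set" where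
  "line a b = {0, a, b, a + b}"

definition flags :: "vec \<Rightarrow> vec \<Rightarrow> (vec \<times> vec) set" where
  "flags a b = {(a, b), (a, a + b), (b, a), (b, a + b), (a + b, a), (a + b, b)}"

text \<open>On the side with vertices \<open>a\<close> and \<open>b\<close> the third point is the
  one that is not a vertex; these are the pairs that start there.\<close>

definition mid_flags :: "vec \<Rightarrow> vec \<Rightarrow> (vec \<times> vec) set" where
  "mid_flags a b = {(a + b, a), (a + b, b)}"

text \<open>Linear independence over the field with two elements: no nonempty sum of the three
  vectors vanishes.\<close>

fun nondeg :: "vec \<times> vec \<times> vec \<Rightarrow> bool" where
  "nondeg (a, b, c) \<longleftrightarrow> a \<noteq> 0 \<and> b \<noteq> 0 \<and> c \<noteq> 0 \<and> a \<noteq> b \<and> b \<noteq> c \<and> c \<noteq> a \<and> a + b \<noteq> c"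

fun triangle_of :: "vec \<times> vec \<times> vec \<Rightarrow> vec set set" where
  "triangle_of (a, b, c) = {line a b, line b c, line c a}"

fun pairs_of :: "vec \<times> vec \<times> vec \<Rightarrow> (vec \<times> vec) set" where
  "pairs_of (a, b, c) = flags a b \<union> flags b c \<union> flags c a"

fun mids_of :: "vec \<times> vec \<times> vec \<Rightarrow> (vec \<times> vec) set" where
  "mids_of (a, b, c) = mid_flags a b \<union> mid_flags b c \<union> mid_flags c a"

lemma nondeg_rotate: "nondeg (a, b, c) \<Longrightarrow> nondeg (b, c, a)"
  by (auto simp: vec_add_eq_iff add.commute)

lemma mids_subset_pairs: "mids_of t \<subseteq> pairs_of t"
  by (cases t) (auto simp: mid_flags_def flags_def)

text \<open>A line is represented by the six ordered pairs of its points. The last clause, on the points \<open>x\<close> that are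
  not vertices of the triangle containing the line through \<open>x\<close> and \<open>y\<close>, survives disjoint unions and implies
  balancedness.\<close>

definition decomposes :: "(vec \<times> vec \<times> vec) set \<Rightarrow> (vec \<times> vec) set \<Rightarrow> bool" where
  "decomposes Tr R \<longleftrightarrow> finite R \<and>
     (\<forall>t\<in>Tr. nondeg t \<and> pairs_of t \<subseteq> R) \<and>
     (\<forall>p\<in>R. \<exists>!t. t \<in> Tr \<and> p \<in> pairs_of t) \<and>
     (\<forall>x. 3 * card {y. \<exists>t\<in>Tr. (x, y) \<in> mids_of t} = card {y. (x, y) \<in> R})"

lemma line_in_flags:
  assumes "x \<noteq> 0" "y \<noteq> 0" "x \<noteq> y" "a \<noteq> 0" "b \<noteq> 0" "a \<noteq> b"
  shows "(x, y) \<in> flags a b \<longleftrightarrow> line x y = line a b"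
proof
  assume "(x, y) \<in> flags a b"
  then show "line x y = line a b"
    by (auto simp: flags_def line_def add.commute add.left_commute)
next
  assume "line x y = line a b"
  then have "x \<in> line a b" "y \<in> line a b" by (auto simp: line_def)
  with assms show "(x, y) \<in> flags a b"
    by (auto simp: flags_def line_def)
qed

lemma line_in_triangle_of:
  assumes "x \<noteq> 0" "y \<noteq> 0" "x \<noteq> y" "nondeg t"
  shows "line x y \<in> triangle_of t \<longleftrightarrow> (x, y) \<in> pairs_of t"
  using assms by (cases t) (auto simp: line_in_flags)

lemma pairs_of_nondeg:
  assumes "nondeg t" "(x, y) \<in> pairs_of t"
  shows "x \<noteq> 0 \<and> y \<noteq> 0 \<and> x \<noteq> y"
  using assms by (cases t) (auto simp: flags_def)

lemma flag_count_vertex: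
  assumes "nondeg (a, b, c)"
  shows "card {y. (a, y) \<in> pairs_of (a, b, c)} + card {y. (a, y) \<in> mids_of (a, b, c)} = 4"
proof -
  have "a \<noteq> 0" "b \<noteq> 0" "c \<noteq> 0" "a \<noteq> b" "b \<noteq> c" "c \<noteq> a" "a + b \<noteq> c" "b + c \<noteq> a" "c + a \<noteq> b"
    using assms by (auto simp: vec_add_eq_iff add.commute)
  then have "{y. (a, y) \<in> pairs_of (a, b, c)} = {b, a + b, c, c + a}"
    and "{y. (a, y) \<in> mids_of (a, b, c)} = {}" and "c + a \<noteq> a + b"
    by (auto simp: flags_def mid_flags_def add.commute)
  moreover have "card {b, a + b, c, c + a} = 4"
    using \<open>a \<noteq> 0\<close> \<open>b \<noteq> c\<close> \<open>a + b \<noteq> c\<close> \<open>c + a \<noteq> b\<close> \<open>c + a \<noteq> a + b\<close> by auto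
  ultimately show ?thesis by simp
qed

lemma flag_count_middle:
  assumes "nondeg (a, b, c)"
  shows "card {y. (a + b, y) \<in> pairs_of (a, b, c)} + card {y. (a + b, y) \<in> mids_of (a, b, c)} = 4"
proof -
  have *: "a \<noteq> 0" "b \<noteq> 0" "c \<noteq> 0" "a \<noteq> b" "b \<noteq> c" "c \<noteq> a" "a + b \<noteq> c" "b + c \<noteq> a" "c + a \<noteq> b"
    using assms by (auto simp: vec_add_eq_iff add.commute)
  moreover have "a + b \<noteq> b + c" "a + b \<noteq> c + a"
    using * by (auto simp: add.commute)
  ultimately have "{y. (a + b, y) \<in> pairs_of (a, b, c)} = {a, b}"
    and "{y. (a + b, y) \<in> mids_of (a, b, c)} = {a, b}"
    by (auto simp: flags_def mid_flags_def)
  then show ?thesis using * by simp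
qed

text \<open>A vertex has four pairs and no middle ones; any other covered point has two pairs, both
  middle. The total is thus the same for all covered points, which lets triangles through a point be
  counted by pairs.\<close>

lemma flag_count:
  assumes "nondeg t" "covers (triangle_of t) x" "x \<noteq> 0"
  shows "card {y. (x, y) \<in> pairs_of t} + card {y. (x, y) \<in> mids_of t} = 4"
proof -
  obtain a b c where t: "t = (a, b, c)" by (cases t)
  have nd: "nondeg (a, b, c)" "nondeg (b, c, a)" "nondeg (c, a, b)"
    using assms(1) nondeg_rotate t by blast+
  have rot: "pairs_of (b, c, a) = pairs_of t" "pairs_of (c, a, b) = pairs_of t"
    "mids_of (b, c, a) = mids_of t" "mids_of (c, a, b) = mids_of t"
    unfolding t by auto
  have "x \<in> {a, b, c, a + b, b + c, c + a}"
    using assms(2,3) by (auto simp: covers_def t line_def)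
  then show ?thesis
    using flag_count_vertex[OF nd(1)] flag_count_vertex[OF nd(2)] flag_count_vertex[OF nd(3)]
      flag_count_middle[OF nd(1)] flag_count_middle[OF nd(2)] flag_count_middle[OF nd(3)]
    unfolding rot t[symmetric] by blast
qed

lemma covers_iff_pairs:
  assumes "nondeg t" "x \<noteq> 0"
  shows "covers (triangle_of t) x \<longleftrightarrow> (\<exists>y. (x, y) \<in> pairs_of t)"
  using assms by (cases t) (auto simp: covers_def line_def flags_def)

text \<open>Summing \<open>flag_count\<close> gives four for each triangle through \<open>x\<close>.
  The middle pairs are a third of the pairs at \<open>x\<close>, so four thirds of the number of
  pairs equal four times the number of triangles.\<close>

lemma decomposes_card_covers:
  assumes g: "decomposes Tr R" and x: "x \<noteq> 0"
  shows "3 * card {T \<in> triangle_of ` Tr. covers T x} = card {y. (x, y) \<in> R}"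
proof -
  define A where "A = {t \<in> Tr. covers (triangle_of t) x}"
  define P where "P t = {y. (x, y) \<in> pairs_of t}" for t
  define M where "M t = {y. (x, y) \<in> mids_of t}" for t
  have nd: "nondeg t" if "t \<in> Tr" for t using g that by (auto simp: decomposes_def)
  have uniq: "t = t'" if "t \<in> Tr" "t' \<in> Tr" "p \<in> pairs_of t" "p \<in> pairs_of t'" for t t' p
    using g that unfolding decomposes_def by blast
  have fin: "finite R" using g by (simp add: decomposes_def)
  have Rx: "{y. (x, y) \<in> R} = (\<Union>t\<in>A. P t)"
  proof -
    have "(x, y) \<in> R \<longleftrightarrow> (\<exists>t\<in>Tr. (x, y) \<in> pairs_of t)" for y
      using g unfolding decomposes_def by blast
    moreover have "covers (triangle_of t) x" if "t \<in> Tr" "(x, y) \<in> pairs_of t" for t y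
      using covers_iff_pairs[OF nd x] that by blast
    ultimately show ?thesis unfolding A_def P_def by blast
  qed
  have Mx: "{y. \<exists>t\<in>Tr. (x, y) \<in> mids_of t} = (\<Union>t\<in>A. M t)"
  proof -
    have "covers (triangle_of t) x" if "t \<in> Tr" "(x, y) \<in> mids_of t" for t y
      using covers_iff_pairs[OF nd x] that mids_subset_pairs by blast
    then show ?thesis unfolding A_def M_def by blast
  qed
  have finR: "finite {y. (x, y) \<in> R}"
    using finite_imageI[OF fin, of snd] by (rule rev_finite_subset) force
  have disP: "\<And>s t. s \<in> A \<Longrightarrow> t \<in> A \<Longrightarrow> s \<noteq> t \<Longrightarrow> P s \<inter> P t = {}"
    using uniq unfolding A_def P_def by blast
  have MP: "M t \<subseteq> P t" for t using mids_subset_pairs unfolding M_def P_def by blast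
  have finP: "finite (P t)" if "t \<in> A" for t
    using finR that unfolding Rx by (meson UN_upper finite_subset)
  \<comment> \<open>Finiteness comes from \<open>R\<close>: the sets \<open>P t\<close> are
    nonempty, pairwise disjoint and contained in a finite set.\<close>
  have finA: "finite A"
  proof -
    have "P t \<noteq> {}" if "t \<in> A" for t
      using that covers_iff_pairs[OF nd x] unfolding A_def P_def by blast
    then have "inj_on P A" using disP by (intro inj_onI) (metis inf.idem)
    moreover have "finite (P ` A)"
      using finite_UnionD[of "P ` A"] finR by (simp add: Rx)
    ultimately show ?thesis using finite_imageD by blast
  qed
  have "card (\<Union>t\<in>A. P t) + card (\<Union>t\<in>A. M t) = (\<Sum>t\<in>A. card (P t)) + (\<Sum>t\<in>A. card (M t))"
  proof -
    have "card (\<Union>t\<in>A. P t) = (\<Sum>t\<in>A. card (P t))"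
      by (rule card_UN_disjoint) (use finA finP disP in blast)+
    moreover have "card (\<Union>t\<in>A. M t) = (\<Sum>t\<in>A. card (M t))"
    proof (rule card_UN_disjoint)
      show "\<forall>t\<in>A. finite (M t)" using finP MP finite_subset by blast
      show "\<forall>s\<in>A. \<forall>t\<in>A. s \<noteq> t \<longrightarrow> M s \<inter> M t = {}"
        using disP MP by blast
    qed (rule finA)
    ultimately show ?thesis by simp
  qed
  also have "\<dots> = (\<Sum>t\<in>A. 4)"
    unfolding sum.distrib[symmetric] P_def M_def
  proof (rule sum.cong[OF refl])
    fix t assume "t \<in> A"
    then have "t \<in> Tr" "covers (triangle_of t) x" by (auto simp only: A_def)
    then show "card {y. (x, y) \<in> pairs_of t} + card {y. (x, y) \<in> mids_of t} = 4"
      by (intro flag_count nd x)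
  qed
  finally have "card {y. (x, y) \<in> R} + card {y. \<exists>t\<in>Tr. (x, y) \<in> mids_of t} = 4 * card A"
    by (simp add: Rx Mx)
  moreover have "3 * card {y. \<exists>t\<in>Tr. (x, y) \<in> mids_of t} = card {y. (x, y) \<in> R}"
    using g by (simp add: decomposes_def)
  \<comment> \<open>A set of lines forgets the order of the vertices, but two triples of
    \<open>Tr\<close> through \<open>x\<close> with the same lines share a pair and hence
    agree.\<close>
  moreover have "card {T \<in> triangle_of ` Tr. covers T x} = card A"
  proof -
    have "inj_on triangle_of A"
    proof (rule inj_onI)
      fix t t' assume *: "t \<in> A" "t' \<in> A" "triangle_of t = triangle_of t'"
      obtain y where y: "(x, y) \<in> pairs_of t"
        using *(1) covers_iff_pairs[OF nd x, of t] by (auto simp only: A_def)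
      then have "(x, y) \<in> pairs_of t'"
      proof -
        have "t \<in> Tr" "t' \<in> Tr" using * by (simp_all only: A_def mem_Collect_eq)
        moreover have "x \<noteq> 0 \<and> y \<noteq> 0 \<and> x \<noteq> y" using pairs_of_nondeg[OF nd y] \<open>t \<in> Tr\<close> .
        ultimately show ?thesis using line_in_triangle_of[of x y t] line_in_triangle_of[of x y t'] nd y *(3) by simp
      qed
      then show "t = t'" using uniq[of t t'] y * by (auto simp only: A_def)
    qed
    moreover have "{T \<in> triangle_of ` Tr. covers T x} = triangle_of ` A" unfolding A_def by blast
    ultimately show ?thesis by (simp add: card_image)
  qed
  ultimately show ?thesis by linarith
qed

section \<open>Triangle designs expressed by triples of vectors\<close>

lemma seq_scale_bit [simp]: "seq_scale (0::bit) x = 0" "seq_scale (1::bit) x = x"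
  by (auto simp: seq_scale_def)

lemma ex_bit: "(\<exists>k::bit. P k) \<longleftrightarrow> P 0 \<or> P 1"
proof
  assume "\<exists>k. P k"
  then obtain k where "P k" ..
  then show "P 0 \<or> P 1" by (cases k) auto
qed auto

lemma seq_span_pair: "seq.span {a, b :: vec} = line a b"
proof -
  have "range (\<lambda>k. seq_scale k b) = {0, b}"
    by (auto simp only: set_eq_iff image_iff bex_UNIV ex_bit seq_scale_bit insert_iff empty_iff)
  then have 1: "seq.span {b} = {0, b}"
    by (simp only: seq.span_singleton)
  have "x \<in> seq.span {a, b} \<longleftrightarrow> x \<in> {0, b} \<or> x - a \<in> {0, b}" for x
    unfolding seq.span_insert[of a "{b}"] 1 mem_Collect_eq ex_bit seq_scale_bit by simp
  then show ?thesis
    unfolding set_eq_iff line_def by (simp add: diff_eq_eq add.commute) metis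
qed

lemma independent_pair: "a \<noteq> b \<Longrightarrow> seq.independent {a, b :: vec} \<longleftrightarrow> a \<noteq> 0 \<and> b \<noteq> 0"
proof -
  assume "a \<noteq> b"
  have "seq.span {b} = {0, b}"
    using seq_span_pair[of b b] by (simp add: line_def insert_commute)
  then show ?thesis using \<open>a \<noteq> b\<close>
    by (auto simp: seq.independent_insert)
qed

lemma independent_triple:
  "distinct [a, b, c] \<Longrightarrow> seq.independent {a, b, c :: vec} \<longleftrightarrow> nondeg (a, b, c)"
proof -
  assume d: "distinct [a, b, c]"
  then have "seq.independent {a, b, c} \<longleftrightarrow> a \<noteq> 0 \<and> b \<noteq> 0 \<and> c \<notin> line a b"
    using seq.independent_insert[of c "{a, b}"] independent_pair[of a b]
    by (auto simp: seq_span_pair insert_commute)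
  also have "\<dots> \<longleftrightarrow> nondeg (a, b, c)" using d by (auto simp: line_def)
  finally show ?thesis .
qed

lemma triangle_iff:
  "seq.triangle V T \<longleftrightarrow> (\<exists>t. nondeg t \<and> fst t \<in> V \<and> fst (snd t) \<in> V \<and> snd (snd t) \<in> V \<and> T = triangle_of t)"
proof
  assume "seq.triangle V T"
  then obtain a b c where "a \<in> V" "b \<in> V" "c \<in> V" "distinct [a, b, c]"
    "seq.independent {a, b, c}" "T = triangle_of (a, b, c)"
    unfolding seq.triangle_def seq_span_pair by auto
  then show "\<exists>t. nondeg t \<and> fst t \<in> V \<and> fst (snd t) \<in> V \<and> snd (snd t) \<in> V \<and> T = triangle_of t"
    using independent_triple by (metis fst_conv snd_conv)
next
  assume "\<exists>t. nondeg t \<and> fst t \<in> V \<and> fst (snd t) \<in> V \<and> snd (snd t) \<in> V \<and> T = triangle_of t"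
  then obtain a b c where *: "nondeg (a, b, c)" "a \<in> V" "b \<in> V" "c \<in> V" "T = triangle_of (a, b, c)"
    by (metis prod.collapse)
  then have d: "distinct [a, b, c]" by auto
  then have "seq.independent {a, b, c}" using * independent_triple by blast
  then show "seq.triangle V T"
    unfolding seq.triangle_def seq_span_pair using * d by auto
qed

lemma dim_2_iff:
  fixes W :: "vec set"
  shows "seq.subspace W \<and> seq.dim W = 2 \<longleftrightarrow> (\<exists>a b. a \<noteq> 0 \<and> b \<noteq> 0 \<and> a \<noteq> b \<and> W = line a b)"
proof
  assume W: "seq.subspace W \<and> seq.dim W = 2"
  obtain B where B: "B \<subseteq> W" "seq.independent B" "W \<subseteq> seq.span B" "card B = seq.dim W"
    using seq.basis_exists by blast
  then obtain a b where ab: "B = {a, b}" "a \<noteq> b" using W by (auto simp: card_2_iff)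
  moreover have "W = seq.span B" using B W by (simp add: seq.span_minimal subset_antisym)
  ultimately show "\<exists>a b. a \<noteq> 0 \<and> b \<noteq> 0 \<and> a \<noteq> b \<and> W = line a b"
    using B independent_pair seq_span_pair by metis
next
  assume "\<exists>a b. a \<noteq> 0 \<and> b \<noteq> 0 \<and> a \<noteq> b \<and> W = line a b"
  then obtain a b where ab: "a \<noteq> 0" "b \<noteq> 0" "a \<noteq> b" "W = line a b" by blast
  then have "seq.dim W = card {a, b}"
    using independent_pair seq_span_pair seq.dim_span_eq_card_independent by metis
  moreover have "seq.subspace W" using ab seq.subspace_span seq_span_pair by metis
  ultimately show "seq.subspace W \<and> seq.dim W = 2" using ab by simp
qed

definition distinct_pairs :: "vec set \<Rightarrow> (vec \<times> vec) set" where
  "distinct_pairs V = {(x, y). x \<in> V \<and> y \<in> V \<and> x \<noteq> 0 \<and> y \<noteq> 0 \<and> x \<noteq> y}"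

lemma balanced_of_decomposes:
  assumes sub: "seq.subspace V" and g: "decomposes Tr (distinct_pairs V)"
  shows "seq.balanced_triangle_design V (triangle_of ` Tr)"
proof -
  have nd: "nondeg t" if "t \<in> Tr" for t using g that by (auto simp: decomposes_def)
  have inV: "pairs_of t \<subseteq> distinct_pairs V" if "t \<in> Tr" for t using g that by (auto simp: decomposes_def)
  have "seq.triangle V (triangle_of t)" if "t \<in> Tr" for t
  proof -
    obtain a b c where t: "t = (a, b, c)" by (cases t)
    have "a \<in> V" "b \<in> V" "c \<in> V"
      using inV[OF that] unfolding t by (auto simp: flags_def distinct_pairs_def)
    then show ?thesis using nd[OF that] unfolding triangle_iff t by (intro exI[of _ "(a, b, c)"]) simp
  qed
  moreover have "\<exists>!T. T \<in> triangle_of ` Tr \<and> W \<in> T"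
    if W: "seq.subspace W" "W \<subseteq> V" "seq.dim W = 2" for W
  proof -
    have "\<exists>a b. a \<noteq> 0 \<and> b \<noteq> 0 \<and> a \<noteq> b \<and> W = line a b"
      using dim_2_iff[THEN iffD1] W by simp
    then obtain a b where ab: "a \<noteq> 0" "b \<noteq> 0" "a \<noteq> b" "W = line a b" by blast
    then have "(a, b) \<in> distinct_pairs V" using W by (auto simp: line_def distinct_pairs_def)
    then have "\<exists>!t. t \<in> Tr \<and> (a, b) \<in> pairs_of t" using g unfolding decomposes_def by blast
    moreover have "line a b \<in> triangle_of t \<longleftrightarrow> (a, b) \<in> pairs_of t" if "t \<in> Tr" for t
      using line_in_triangle_of[OF ab(1-3) nd[OF that]] .
    ultimately show ?thesis unfolding ab(4) by blast
  qed
  \<comment> \<open>A nonzero point is paired with every vector of \<open>V\<close> except zero and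
    itself; \<open>decomposes_card_covers\<close> divides their number by three.\<close>
  moreover have "card {T \<in> triangle_of ` Tr. covers T x} = (card V - 2) div 3" if x: "x \<in> V" "x \<noteq> 0" for x
  proof -
    have "{y. (x, y) \<in> distinct_pairs V} = V - {0, x}" using x by (auto simp: distinct_pairs_def)
    moreover have "0 \<in> V" using sub by (simp add: seq.subspace_0)
    ultimately have "card {y. (x, y) \<in> distinct_pairs V} = card V - 2"
      using x by (simp add: card_Diff_subset)
    then show ?thesis using decomposes_card_covers[OF g x(2)] by linarith
  qed
  ultimately show ?thesis
    unfolding seq.balanced_triangle_design_def seq.triangle_design_def
    by (intro conjI exI[of _ "(card V - 2) div 3"]) simp_all
qed

text \<open>Pairs and middle pairs at a point both add up over disjoint relations, so the proportion
  one third passes to the union even if the parts meet the point in different numbers of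
  lines.\<close>

lemma decomposes_Union:
  assumes fin: "finite I"
    and g: "\<And>i. i \<in> I \<Longrightarrow> decomposes (Tr i) (R i)"
    and dis: "\<And>i j. i \<in> I \<Longrightarrow> j \<in> I \<Longrightarrow> i \<noteq> j \<Longrightarrow> R i \<inter> R j = {}"
  shows "decomposes (\<Union>i\<in>I. Tr i) (\<Union>i\<in>I. R i)"
proof -
  have sub: "nondeg t" "pairs_of t \<subseteq> R i" if "t \<in> Tr i" "i \<in> I" for t i
    using g that unfolding decomposes_def by blast+
  have finR: "finite (R i)" if "i \<in> I" for i using g that by (simp add: decomposes_def)
  have ex1: "\<exists>!t. t \<in> (\<Union>i\<in>I. Tr i) \<and> p \<in> pairs_of t" if p: "p \<in> (\<Union>i\<in>I. R i)" for p
  proof -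
    obtain i where i: "i \<in> I" "p \<in> R i" using p by blast
    have "t \<in> Tr i" if "t \<in> Tr j" "j \<in> I" "p \<in> pairs_of t" for t j
      using sub(2)[OF that(1,2)] that dis[of i j] i by blast
    moreover have "\<exists>!t. t \<in> Tr i \<and> p \<in> pairs_of t" using g[OF i(1)] i(2) unfolding decomposes_def by blast
    ultimately show ?thesis using i(1) by blast
  qed
  have leaf_count: "3 * card {y. \<exists>t\<in>\<Union>i\<in>I. Tr i. (x, y) \<in> mids_of t} = card {y. (x, y) \<in> (\<Union>i\<in>I. R i)}" for x
  proof -
    define P where "P i = {y. (x, y) \<in> R i}" for i
    define M where "M i = {y. \<exists>t\<in>Tr i. (x, y) \<in> mids_of t}" for i
    have MP: "M i \<subseteq> P i" if "i \<in> I" for i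
      using sub(2)[OF _ that] mids_subset_pairs unfolding M_def P_def by blast
    have finP: "finite (P i)" if "i \<in> I" for i
      unfolding P_def using finite_imageI[OF finR[OF that], of snd] by (rule rev_finite_subset) force
    have disP: "P i \<inter> P j = {}" if "i \<in> I" "j \<in> I" "i \<noteq> j" for i j
      using dis[OF that] unfolding P_def by blast
    have "card (\<Union>i\<in>I. P i) = (\<Sum>i\<in>I. card (P i))"
      by (rule card_UN_disjoint) (use fin finP disP in blast)+
    also have "\<dots> = (\<Sum>i\<in>I. 3 * card (M i))"
      by (rule sum.cong[OF refl]) (use g in \<open>simp add: decomposes_def P_def M_def\<close>)
    also have "\<dots> = 3 * card (\<Union>i\<in>I. M i)"
    proof -
      have "card (\<Union>i\<in>I. M i) = (\<Sum>i\<in>I. card (M i))"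
      proof (rule card_UN_disjoint)
        show "\<forall>i\<in>I. finite (M i)" using finP MP finite_subset by blast
        show "\<forall>i\<in>I. \<forall>j\<in>I. i \<noteq> j \<longrightarrow> M i \<inter> M j = {}" using disP MP by blast
      qed (rule fin)
      then show ?thesis by (simp add: sum_distrib_left)
    qed
    also have "(\<Union>i\<in>I. M i) = {y. \<exists>t\<in>\<Union>i\<in>I. Tr i. (x, y) \<in> mids_of t}" by (auto simp only: M_def)
    also have "(\<Union>i\<in>I. P i) = {y. (x, y) \<in> (\<Union>i\<in>I. R i)}" by (auto simp only: P_def)
    finally show ?thesis by simp
  qed
  show ?thesis
    unfolding decomposes_def
  proof (intro conjI)
    show "finite (\<Union>i\<in>I. R i)" using fin finR by blast
    show "\<forall>t\<in>\<Union>i\<in>I. Tr i. nondeg t \<and> pairs_of t \<subseteq> (\<Union>i\<in>I. R i)"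
    proof
      fix t assume "t \<in> (\<Union>i\<in>I. Tr i)"
      then obtain i where "i \<in> I" "t \<in> Tr i" by blast
      then show "nondeg t \<and> pairs_of t \<subseteq> (\<Union>i\<in>I. R i)" using sub[of t i] by blast
    qed
    show "\<forall>p\<in>\<Union>i\<in>I. R i. \<exists>!t. t \<in> (\<Union>i\<in>I. Tr i) \<and> p \<in> pairs_of t" by (intro ballI ex1)
  qed (use leaf_count in blast)
qed

lemma flags_sym: "(x, y) \<in> flags a b \<Longrightarrow> (y, x) \<in> flags a b"
  by (auto simp: flags_def)

lemma pairs_of_sym: "(x, y) \<in> pairs_of t \<longleftrightarrow> (y, x) \<in> pairs_of t"
  by (cases t) (use flags_sym in \<open>simp only: pairs_of.simps Un_iff; blast\<close>)

section \<open>Lifting a decomposition to one more dimension\<close>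

definition lift_point :: "vec \<Rightarrow> bool \<Rightarrow> vec \<Rightarrow> vec" where
  "lift_point e \<epsilon> x = (if \<epsilon> then x + e else x)"

lemma lift_point_add: "lift_point e \<epsilon> x + lift_point e \<delta> y = lift_point e (\<epsilon> \<noteq> \<delta>) (x + y)"
  by (auto simp: lift_point_def add_ac)

definition lift_rel :: "vec \<Rightarrow> (vec \<times> vec) set \<Rightarrow> (vec \<times> vec) set" where
  "lift_rel e R = {(lift_point e \<epsilon> x, lift_point e \<delta> y) | \<epsilon> \<delta> x y. (x, y) \<in> R}"

text \<open>Of the four lifts of the line \<open>{a, b, a + b}\<close> the first triangle contains the one through \<open>a + e\<close> and
  \<open>b + e\<close>; the other three form the triangle with vertices \<open>a\<close>, \<open>b\<close>, \<open>a + b + e\<close>. This choice makes the lift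
  of a balanced decomposition balanced.\<close>

fun lift_tris :: "vec \<Rightarrow> vec \<times> vec \<times> vec \<Rightarrow> (vec \<times> vec \<times> vec) set" where
  "lift_tris e (a, b, c) =
    {(lift_point e True a, lift_point e True b, lift_point e True c), (lift_point e False a, lift_point e False b, lift_point e True (a + b)),
     (lift_point e False b, lift_point e False c, lift_point e True (b + c)), (lift_point e False c, lift_point e False a, lift_point e True (c + a))}"

context
  fixes X :: "vec set" and e :: vec
  assumes X_add: "\<And>x y. x \<in> X \<Longrightarrow> y \<in> X \<Longrightarrow> x + y \<in> X" and e: "e \<notin> X"
begin

lemma lift_point_eq_iff: "x \<in> X \<Longrightarrow> y \<in> X \<Longrightarrow> lift_point e \<epsilon> x = lift_point e \<delta> y \<longleftrightarrow> x = y \<and> \<epsilon> = \<delta>"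
proof -
  assume X: "x \<in> X" "y \<in> X"
  have "x + e \<noteq> y" "y + e \<noteq> x"
    using X_add[OF X] X_add[OF X(2,1)] e vec_add_self_left by metis+
  then show ?thesis by (auto simp: lift_point_def)
qed

lemma inj_on_lift_point:
  assumes "S \<subseteq> X"
  shows "inj_on (\<lambda>(\<delta>, y). lift_point e \<delta> y) (UNIV \<times> S)" and "inj_on (\<lambda>y. lift_point e (f y) y) S"
proof -
  have eq: "lift_point e \<epsilon> x = lift_point e \<delta> y \<Longrightarrow> x = y \<and> \<epsilon> = \<delta>" if "x \<in> S" "y \<in> S" for x y \<epsilon> \<delta>
    using lift_point_eq_iff[of x y] that assms by blast
  show "inj_on (\<lambda>(\<delta>, y). lift_point e \<delta> y) (UNIV \<times> S)"
  proof (rule inj_onI)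
    fix p q assume "p \<in> UNIV \<times> S" "q \<in> UNIV \<times> S" "(\<lambda>(\<delta>, y). lift_point e \<delta> y) p = (\<lambda>(\<delta>, y). lift_point e \<delta> y) q"
    then show "p = q" using eq by (cases p; cases q) auto
  qed
  show "inj_on (\<lambda>y. lift_point e (f y) y) S" using eq by (intro inj_onI) blast
qed

text \<open>A pair of levels selects one of the four lifts of the side through \<open>a\<close> and
  \<open>b\<close>. If exactly the vertices carry \<open>e\<close>, it is a side of the first
  triangle; the other three lifts are the sides of the second one, with middles
  \<open>a + b\<close>, \<open>a + e\<close> and \<open>b + e\<close>.\<close>

lemma lift_flags:
  assumes nd: "nondeg (a, b, c)" and X: "a \<in> X" "b \<in> X" "c \<in> X" and xy: "(x, y) \<in> flags a b"
  shows "(lift_point e \<epsilon> x, lift_point e \<delta> y) \<in> pairs_of (lift_point e True a, lift_point e True b, lift_point e True c) \<longleftrightarrow>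
      \<epsilon> = (x \<noteq> a + b) \<and> \<delta> = (y \<noteq> a + b)" (is ?P1)
    and "(lift_point e \<epsilon> x, lift_point e \<delta> y) \<in> pairs_of (lift_point e False a, lift_point e False b, lift_point e True (a + b)) \<longleftrightarrow>
      \<not> (\<epsilon> = (x \<noteq> a + b) \<and> \<delta> = (y \<noteq> a + b))" (is ?P2)
    and "(lift_point e \<epsilon> x, lift_point e \<delta> y) \<notin> pairs_of (lift_point e False b, lift_point e False c, lift_point e True (b + c))" (is ?P3)
    and "(lift_point e \<epsilon> x, lift_point e \<delta> y) \<notin> pairs_of (lift_point e False c, lift_point e False a, lift_point e True (c + a))" (is ?P4)
    and "(lift_point e \<epsilon> x, lift_point e \<delta> y) \<in> mids_of (lift_point e True a, lift_point e True b, lift_point e True c) \<longleftrightarrow>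
      x = a + b \<and> \<not> \<epsilon> \<and> \<delta>" (is ?M1)
    and "(lift_point e \<epsilon> x, lift_point e \<delta> y) \<in> mids_of (lift_point e False a, lift_point e False b, lift_point e True (a + b)) \<longleftrightarrow>
      (x = a + b \<and> \<not> \<epsilon> \<and> \<not> \<delta> \<or> x \<noteq> a + b \<and> \<epsilon> \<and> \<delta> = (y = a + b))" (is ?M2)
    and "(x, y) \<in> mids_of (a, b, c) \<longleftrightarrow> x = a + b" (is ?M3)
    and "(y, x) \<in> mids_of (a, b, c) \<longleftrightarrow> y = a + b" (is ?M4)
proof -
  have ne: "a \<noteq> 0" "b \<noteq> 0" "c \<noteq> 0" "a \<noteq> b" "b \<noteq> c" "c \<noteq> a" "a + b \<noteq> c" "b + c \<noteq> a" "c + a \<noteq> b"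
    "a + b \<noteq> b + c" "a + b \<noteq> c + a" "b + c \<noteq> c + a"
    using nd by (auto simp: vec_add_eq_iff add.commute add.left_commute)
  note ne' = ne ne[symmetric]
  have sum: "a + (a + b) = b" "b + (a + b) = a" "b + (b + c) = c" "c + (b + c) = b"
     "c + (c + a) = a" "a + (c + a) = c" "a + b + a = b" "a + b + b = a" "b + c + b = c" "b + c + c = b"
     "c + a + c = a" "c + a + a = c"
    by (simp_all add: add.commute add.left_commute)
  have XX: "a + b \<in> X" "b + c \<in> X" "c + a \<in> X" using X X_add by auto
  have cases: "x = a \<and> y = b \<or> x = a \<and> y = a + b \<or> x = b \<and> y = a \<or> x = b \<and> y = a + b
      \<or> x = a + b \<and> y = a \<or> x = a + b \<and> y = b"
    using xy by (auto simp: flags_def)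
  show ?P1 ?P2 ?P3 ?P4 ?M1 ?M2 ?M3 ?M4
    using cases
    by (elim disjE conjE; simp add: flags_def mid_flags_def lift_point_add lift_point_eq_iff X XX ne' sum; auto)+
qed

lemma lift_tris_nondeg:
  assumes nd: "nondeg (a, b, c)" and X: "a \<in> X" "b \<in> X" "c \<in> X" and t: "t \<in> lift_tris e (a, b, c)"
  shows "nondeg t" and "pairs_of t \<subseteq> lift_rel e (pairs_of (a, b, c))"
proof -
  have XX: "a + b \<in> X" "b + c \<in> X" "c + a \<in> X" using X X_add by auto
  have emb0: "lift_point e \<epsilon> x = 0 \<longleftrightarrow> x = 0 \<and> \<not> \<epsilon>" if "x \<in> X" for x \<epsilon>
    using e that by (auto simp: lift_point_def)
  have ne: "a \<noteq> 0" "b \<noteq> 0" "c \<noteq> 0" "a \<noteq> b" "b \<noteq> c" "c \<noteq> a" "a + b \<noteq> c"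
    using nd by auto
  show "nondeg t"
    using t by (auto simp: lift_point_eq_iff emb0 lift_point_add X XX ne ne[symmetric])
  have sum: "a + (a + b) = b" "b + (a + b) = a" "b + (b + c) = c" "c + (b + c) = b"
     "c + (c + a) = a" "a + (c + a) = c" "a + b + a = b" "a + b + b = a" "b + c + b = c" "b + c + c = b"
     "c + a + c = a" "c + a + a = c"
    by (simp_all add: add.commute add.left_commute)
  have lift: "(lift_point e \<epsilon> x, lift_point e \<delta> y) \<in> lift_rel e R \<longleftrightarrow> True" if "(x, y) \<in> R" for \<epsilon> \<delta> x y R
    using that by (auto simp: lift_rel_def)
  have "flags (lift_point e \<epsilon> x) (lift_point e \<delta> y) \<subseteq> lift_rel e (flags x y)" for \<epsilon> x \<delta> y
    unfolding flags_def lift_point_add by (simp add: lift)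
  then have "flags (lift_point e \<epsilon> x) (lift_point e \<delta> y) \<subseteq> lift_rel e (pairs_of (a, b, c))"
    if "flags x y \<subseteq> pairs_of (a, b, c)" for \<epsilon> x \<delta> y
    using that unfolding lift_rel_def by blast
  moreover have "flags a b \<subseteq> pairs_of (a, b, c)" "flags b c \<subseteq> pairs_of (a, b, c)"
    "flags c a \<subseteq> pairs_of (a, b, c)" by auto
  moreover have "flags b (a + b) = flags a b" "flags (a + b) a = flags a b"
    "flags c (b + c) = flags b c" "flags (b + c) b = flags b c"
    "flags a (c + a) = flags c a" "flags (c + a) c = flags c a"
    unfolding flags_def sum by auto
  ultimately have L: "flags (lift_point e \<epsilon> x) (lift_point e \<delta> y) \<subseteq> lift_rel e (pairs_of (a, b, c))"
    if "(x, y) \<in> {(a, b), (b, c), (c, a), (b, a + b), (a + b, a), (c, b + c), (b + c, b), (a, c + a), (c + a, c)}"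
    for \<epsilon> \<delta> x y
    using that unfolding insert_iff empty_iff prod.inject by (metis (no_types))
  have t': "t = (lift_point e True a, lift_point e True b, lift_point e True c) \<or> t = (lift_point e False a, lift_point e False b, lift_point e True (a + b))
    \<or> t = (lift_point e False b, lift_point e False c, lift_point e True (b + c)) \<or> t = (lift_point e False c, lift_point e False a, lift_point e True (c + a))"
    using t by simp
  define S where "S = lift_rel e (pairs_of (a, b, c))"
  show "pairs_of t \<subseteq> lift_rel e (pairs_of (a, b, c))"
    using t' unfolding S_def[symmetric]
    by (elim disjE; simp only: pairs_of.simps Un_subset_iff; intro conjI L[folded S_def]; simp)
qed

lemma lift_pairs:
  assumes nd: "nondeg t" and X: "fst t \<in> X" "fst (snd t) \<in> X" "snd (snd t) \<in> X"
    and xy: "(x, y) \<in> pairs_of t"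
  shows "\<exists>!t'. t' \<in> lift_tris e t \<and> (lift_point e \<epsilon> x, lift_point e \<delta> y) \<in> pairs_of t'"
    and "(\<exists>t'\<in>lift_tris e t. (lift_point e \<epsilon> x, lift_point e \<delta> y) \<in> mids_of t') \<longleftrightarrow>
      (if (x, y) \<in> mids_of t then \<not> \<epsilon> else \<epsilon> \<and> \<delta> = ((y, x) \<in> mids_of t))"
proof -
  obtain a b c where t: "t = (a, b, c)" by (cases t)
  have X': "a \<in> X" "b \<in> X" "c \<in> X" using X t by auto
  define P where "P = (\<lambda>t'. (lift_point e \<epsilon> x, lift_point e \<delta> y) \<in> pairs_of t')"
  define M where "M = (\<lambda>t'. (lift_point e \<epsilon> x, lift_point e \<delta> y) \<in> mids_of t')"
  define m where "m = ((x, y) \<in> mids_of t)"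
  define m' where "m' = ((y, x) \<in> mids_of t)"
  define A where "A a b c = (lift_point e True a, lift_point e True b, lift_point e True c)" for a b c
  define B where "B a b = (lift_point e False a, lift_point e False b, lift_point e True (a + b))" for a b
  have rot: "P (A b c a) = P (A a b c)" "P (A c a b) = P (A a b c)"
    "M (A b c a) = M (A a b c)" "M (A c a b) = M (A a b c)"
    unfolding P_def M_def A_def by auto
  have MP: "M t' \<Longrightarrow> P t'" for t'
    using mids_subset_pairs unfolding M_def P_def by blast
  have nd': "nondeg (a, b, c)" "nondeg (b, c, a)" "nondeg (c, a, b)"
    using nd nondeg_rotate unfolding t by blast+
  \<comment> \<open>The outcome when \<open>b1\<close> is the lifted triangle attached to the side
    that contains the pair. Rotating the triple only permutes the arguments of \<open>C\<close>, so
    a single side has to be computed.\<close>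
  define C where "C b1 b2 b3 \<longleftrightarrow> P (A a b c) \<noteq> P b1 \<and> \<not> P b2 \<and> \<not> P b3 \<and>
     ((M (A a b c) \<or> M b1) \<longleftrightarrow> (if m then \<not> \<epsilon> else \<epsilon> \<and> \<delta> = m'))" for b1 b2 b3
  have mt: "m = ((x, y) \<in> mids_of (a', b', c'))" "m' = ((y, x) \<in> mids_of (a', b', c'))"
    if "(a', b', c') \<in> {(a, b, c), (b, c, a), (c, a, b)}" for a' b' c'
    using that unfolding m_def m'_def t by auto
  have cyc: "P (A a' b' c') \<noteq> P (B a' b') \<and> \<not> P (B b' c') \<and> \<not> P (B c' a') \<and>
     ((M (A a' b' c') \<or> M (B a' b')) \<longleftrightarrow> (if m then \<not> \<epsilon> else \<epsilon> \<and> \<delta> = m'))"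
    if "nondeg (a', b', c')" "a' \<in> X" "b' \<in> X" "c' \<in> X" "(x, y) \<in> flags a' b'"
      "(a', b', c') \<in> {(a, b, c), (b, c, a), (c, a, b)}" for a' b' c'
    using lift_flags(1-6)[where \<epsilon> = \<epsilon> and \<delta> = \<delta>, OF that(1-5)] lift_flags(7,8)[OF that(1-5)]
    unfolding mt[OF that(6)] P_def M_def A_def B_def by argo
  have "(x, y) \<in> flags a b \<or> (x, y) \<in> flags b c \<or> (x, y) \<in> flags c a"
    using xy unfolding t by auto
  then have C: "C (B a b) (B b c) (B c a) \<or> C (B b c) (B c a) (B a b) \<or> C (B c a) (B a b) (B b c)"
  proof (elim disjE)
    assume "(x, y) \<in> flags a b"
    then show ?thesis using cyc[OF nd'(1) X'] unfolding C_def by simp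
  next
    assume "(x, y) \<in> flags b c"
    then show ?thesis using cyc[OF nd'(2) X'(2,3,1)] unfolding C_def rot by simp
  next
    assume "(x, y) \<in> flags c a"
    then show ?thesis using cyc[OF nd'(3) X'(3,1,2)] unfolding C_def rot by simp
  qed
  have lt: "t' \<in> lift_tris e t \<longleftrightarrow> t' = A a b c \<or> t' = B a b \<or> t' = B b c \<or> t' = B c a" for t'
    unfolding t A_def B_def by simp
  show "\<exists>!t'. t' \<in> lift_tris e t \<and> (lift_point e \<epsilon> x, lift_point e \<delta> y) \<in> pairs_of t'"
  proof -
    have "\<exists>!t'. (t' = A a b c \<or> t' = B a b \<or> t' = B b c \<or> t' = B c a) \<and> P t'"
      using C unfolding C_def by metis
    then show ?thesis unfolding lt P_def .
  qed
  have "(\<exists>t'\<in>lift_tris e t. M t') \<longleftrightarrow> M (A a b c) \<or> M (B a b) \<or> M (B b c) \<or> M (B c a)"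
    unfolding Bex_def lt by blast
  also have "\<dots> \<longleftrightarrow> (if m then \<not> \<epsilon> else \<epsilon> \<and> \<delta> = m')"
    using C MP unfolding C_def by metis
  finally show "(\<exists>t'\<in>lift_tris e t. (lift_point e \<epsilon> x, lift_point e \<delta> y) \<in> mids_of t') \<longleftrightarrow>
      (if (x, y) \<in> mids_of t then \<not> \<epsilon> else \<epsilon> \<and> \<delta> = ((y, x) \<in> mids_of t))"
    unfolding M_def m_def m'_def .
qed

text \<open>At a point without \<open>e\<close> the middle pairs are both lifts of the old middle
  pairs, two thirds of \<open>card P\<close> out of \<open>2 * card P\<close>. At a point with
  \<open>e\<close> exactly one lift of each old vertex pair becomes middle, again two thirds of
  \<open>card P\<close>. So one third is kept on both levels.\<close>

lemma decomposes_lift: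
  assumes g: "decomposes Tr R" and RX: "R \<subseteq> X \<times> X"
  shows "decomposes (\<Union>t\<in>Tr. lift_tris e t) (lift_rel e R)"
proof -
  have nd: "nondeg t" "pairs_of t \<subseteq> R" if "t \<in> Tr" for t
    using g that unfolding decomposes_def by blast+
  have vX: "fst t \<in> X" "fst (snd t) \<in> X" "snd (snd t) \<in> X" if "t \<in> Tr" for t
  proof -
    have "pairs_of t \<subseteq> X \<times> X" using nd(2)[OF that] RX by blast
    then show "fst t \<in> X" "fst (snd t) \<in> X" "snd (snd t) \<in> X"
      by (cases t; auto simp: flags_def)+
  qed
  have lt: "nondeg t'" "pairs_of t' \<subseteq> lift_rel e (pairs_of t)" if "t \<in> Tr" "t' \<in> lift_tris e t" for t t'
    using lift_tris_nondeg[of "fst t" "fst (snd t)" "snd (snd t)" t'] nd(1)[OF that(1)] vX[OF that(1)] that(2)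
    by simp_all
  have mem: "(lift_point e \<epsilon> x, lift_point e \<delta> y) \<in> lift_rel e S \<longleftrightarrow> (x, y) \<in> S"
    if "S \<subseteq> X \<times> X" "x \<in> X" "y \<in> X" for S x y \<epsilon> \<delta>
  proof
    assume "(lift_point e \<epsilon> x, lift_point e \<delta> y) \<in> lift_rel e S"
    then obtain \<epsilon>' \<delta>' x' y' where *: "(x', y') \<in> S" "lift_point e \<epsilon> x = lift_point e \<epsilon>' x'" "lift_point e \<delta> y = lift_point e \<delta>' y'"
      unfolding lift_rel_def by auto
    then have "x' \<in> X" "y' \<in> X" using that(1) by blast+
    then show "(x, y) \<in> S" using * lift_point_eq_iff[of x x' \<epsilon> \<epsilon>'] lift_point_eq_iff[of y y' \<delta> \<delta>'] that(2,3) by simp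
  qed (auto simp: lift_rel_def)
  have pX: "pairs_of t \<subseteq> X \<times> X" if "t \<in> Tr" for t using nd(2)[OF that] RX by blast
  have tri_of: "(x, y) \<in> pairs_of t"
    if "t \<in> Tr" "t' \<in> lift_tris e t" "(lift_point e \<epsilon> x, lift_point e \<delta> y) \<in> pairs_of t'" "x \<in> X" "y \<in> X" for t t' x y \<epsilon> \<delta>
    using lt(2)[OF that(1,2)] that(3) mem[OF pX[OF that(1)] that(4,5)] by blast
  have finR: "finite R" using g by (simp add: decomposes_def)
  have "lift_rel e R = (\<lambda>(\<epsilon>, \<delta>, x, y). (lift_point e \<epsilon> x, lift_point e \<delta> y)) ` (UNIV \<times> UNIV \<times> R)"
    unfolding lift_rel_def by force
  then have fin: "finite (lift_rel e R)" using finR by simp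
  have ex1: "\<exists>!t'. t' \<in> (\<Union>t\<in>Tr. lift_tris e t) \<and> p \<in> pairs_of t'" if p: "p \<in> lift_rel e R" for p
  proof -
    obtain \<epsilon> \<delta> x y where xy: "(x, y) \<in> R" "p = (lift_point e \<epsilon> x, lift_point e \<delta> y)"
      using p unfolding lift_rel_def by blast
    have X: "x \<in> X" "y \<in> X" using xy RX by blast+
    have "\<exists>!t. t \<in> Tr \<and> (x, y) \<in> pairs_of t" using g xy(1) unfolding decomposes_def by blast
    then obtain t where t: "t \<in> Tr" "(x, y) \<in> pairs_of t"
      and u: "\<And>s. s \<in> Tr \<Longrightarrow> (x, y) \<in> pairs_of s \<Longrightarrow> s = t" by blast
    have "\<exists>!t'. t' \<in> lift_tris e t \<and> p \<in> pairs_of t'"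
      unfolding xy(2) by (rule lift_pairs(1)[OF nd(1)[OF t(1)] vX[OF t(1)] t(2)])
    moreover have "s = t" if "s \<in> Tr" "t' \<in> lift_tris e s" "p \<in> pairs_of t'" for s t'
      using tri_of[OF that(1,2) that(3)[unfolded xy(2)] X] u that(1) by blast
    ultimately show ?thesis using t(1) by blast
  qed
  have leaf_count: "3 * card {y. \<exists>t'\<in>\<Union>t\<in>Tr. lift_tris e t. (z, y) \<in> mids_of t'} = card {y. (z, y) \<in> lift_rel e R}" for z
  proof (cases "\<exists>x\<in>X. \<exists>\<epsilon>. z = lift_point e \<epsilon> x")
    case False
    have "{y. (z, y) \<in> lift_rel e R} = {}" using False RX unfolding lift_rel_def by blast
    moreover have "{y. \<exists>t'\<in>\<Union>t\<in>Tr. lift_tris e t. (z, y) \<in> mids_of t'} \<subseteq> {y. (z, y) \<in> lift_rel e R}"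
    proof -
      have "mids_of t' \<subseteq> lift_rel e R" if "t \<in> Tr" "t' \<in> lift_tris e t" for t t'
        using lt(2)[OF that] mids_subset_pairs[of t'] nd(2)[OF that(1)] unfolding lift_rel_def by blast
      then show ?thesis by blast
    qed
    ultimately show ?thesis by simp
  next
    case True
    then obtain x \<epsilon> where x: "x \<in> X" "z = lift_point e \<epsilon> x" by blast
    define P where "P = {y. (x, y) \<in> R}"
    define M where "M = {y. \<exists>t\<in>Tr. (x, y) \<in> mids_of t}"
    \<comment> \<open>At a point with \<open>e\<close> the partner in a middle pair carries
      \<open>e\<close> exactly when it was the middle of the old side; \<open>M'\<close> collects
      these partners.\<close>
    define M' where "M' = {y. \<exists>t\<in>Tr. (y, x) \<in> mids_of t}"
    have MR: "mids_of t \<subseteq> R" if "t \<in> Tr" for t using nd(2)[OF that] mids_subset_pairs by blast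
    have MP: "M \<subseteq> P" unfolding M_def P_def using MR by blast
    have PX: "P \<subseteq> X" using RX unfolding P_def by blast
    have finP: "finite P"
      unfolding P_def using finite_imageI[OF finR, of snd] by (rule rev_finite_subset) force
    have card3: "3 * card M = card P" using g unfolding decomposes_def M_def P_def by blast
    have R': "{y. (z, y) \<in> lift_rel e R} = (\<lambda>(\<delta>, y). lift_point e \<delta> y) ` (UNIV \<times> P)"
    proof -
      have "w \<in> (\<lambda>(\<delta>, y). lift_point e \<delta> y) ` (UNIV \<times> P)" if w: "(z, w) \<in> lift_rel e R" for w
      proof -
        obtain \<epsilon>' \<delta> x' y where *: "(x', y) \<in> R" "z = lift_point e \<epsilon>' x'" "w = lift_point e \<delta> y"
          using w unfolding lift_rel_def by blast
        then have "x' = x" using lift_point_eq_iff x RX by (metis mem_Sigma_iff subset_eq)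
        then show ?thesis using * by (force simp: P_def)
      qed
      moreover have "(z, w) \<in> lift_rel e R" if "w \<in> (\<lambda>(\<delta>, y). lift_point e \<delta> y) ` (UNIV \<times> P)" for w
        using that unfolding x(2) P_def lift_rel_def by auto
      ultimately show ?thesis by blast
    qed
    have cardR': "card {y. (z, y) \<in> lift_rel e R} = 2 * card P"
    proof -
      show ?thesis unfolding R' by (simp add: card_image inj_on_lift_point(1)[OF PX] card_cartesian_product)
    qed
    have mid: "(\<exists>t'\<in>\<Union>t\<in>Tr. lift_tris e t. (z, lift_point e \<delta> y) \<in> mids_of t') \<longleftrightarrow>
        (if y \<in> M then \<not> \<epsilon> else \<epsilon> \<and> \<delta> = (y \<in> M'))" if y: "y \<in> P" for y \<delta>
    proof -
      have yX: "y \<in> X" using y PX by blast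
      have "\<exists>!t. t \<in> Tr \<and> (x, y) \<in> pairs_of t" using g y unfolding decomposes_def P_def by blast
      then obtain t where t: "t \<in> Tr" "(x, y) \<in> pairs_of t"
        and u: "\<And>s. s \<in> Tr \<Longrightarrow> (x, y) \<in> pairs_of s \<Longrightarrow> s = t" by blast
      note sym = pairs_of_sym[of y x]
      have "y \<in> M \<longleftrightarrow> (x, y) \<in> mids_of t"
        unfolding M_def using t u mids_subset_pairs by blast
      moreover have "y \<in> M' \<longleftrightarrow> (y, x) \<in> mids_of t"
        unfolding M'_def using t u mids_subset_pairs sym by blast
      moreover have "(\<exists>t'\<in>\<Union>t\<in>Tr. lift_tris e t. (z, lift_point e \<delta> y) \<in> mids_of t') \<longleftrightarrow>
         (\<exists>t'\<in>lift_tris e t. (z, lift_point e \<delta> y) \<in> mids_of t')"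
        using tri_of[OF _ _ _ x(1) yX] u t(1) mids_subset_pairs unfolding x(2) by blast
      ultimately show ?thesis
        using lift_pairs(2)[OF nd(1)[OF t(1)] vX[OF t(1)] t(2)] unfolding x(2) by simp
    qed
    define Q where "Q w \<longleftrightarrow> (\<exists>t'\<in>\<Union>t\<in>Tr. lift_tris e t. (z, w) \<in> mids_of t')" for w
    have sub: "\<exists>\<delta>. \<exists>y\<in>P. w = lift_point e \<delta> y" if "Q w" for w
    proof -
      obtain t t' where t: "t \<in> Tr" "t' \<in> lift_tris e t" "(z, w) \<in> mids_of t'"
        using \<open>Q w\<close> unfolding Q_def by blast
      then have "(z, w) \<in> lift_rel e R"
        using lt(2)[OF t(1,2)] mids_subset_pairs[of t'] nd(2)[OF t(1)] unfolding lift_rel_def by blast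
      then have "w \<in> (\<lambda>(\<delta>, y). lift_point e \<delta> y) ` (UNIV \<times> P)" using R' by blast
      then show ?thesis by auto
    qed
    note mid = mid[folded Q_def]
    have "3 * card {w. Q w} = 2 * card P"
    proof (cases \<epsilon>)
      case False
      have "{w. Q w} = (\<lambda>(\<delta>, y). lift_point e \<delta> y) ` (UNIV \<times> M)"
      proof (intro set_eqI iffI)
        fix w assume "w \<in> {w. Q w}"
        then have w: "Q w" by simp
        then obtain \<delta> y where y: "y \<in> P" "w = lift_point e \<delta> y" using sub by blast
        then have "y \<in> M" using w mid[OF y(1)] False by (metis (full_types))
        then show "w \<in> (\<lambda>(\<delta>, y). lift_point e \<delta> y) ` (UNIV \<times> M)"
          using y by (intro image_eqI[of _ _ "(\<delta>, y)"]) auto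
      next
        fix w assume "w \<in> (\<lambda>(\<delta>, y). lift_point e \<delta> y) ` (UNIV \<times> M)"
        then obtain \<delta> y where y: "y \<in> M" "w = lift_point e \<delta> y" by auto
        then have "Q w" using mid[of y \<delta>] MP False by auto
        then show "w \<in> {w. Q w}" by simp
      qed
      moreover have "inj_on (\<lambda>(\<delta>, y). lift_point e \<delta> y) (UNIV \<times> M)"
        by (rule inj_on_lift_point) (use MP PX in blast)
      ultimately have "card {w. Q w} = 2 * card M"
        by (simp add: card_image card_cartesian_product)
      then show ?thesis using card3 by linarith
    next
      case True
      have "{w. Q w} = (\<lambda>y. lift_point e (y \<in> M') y) ` (P - M)"
      proof (intro set_eqI iffI)
        fix w assume "w \<in> {w. Q w}"
        then have w: "Q w" by simp
        then obtain \<delta> y where y: "y \<in> P" "w = lift_point e \<delta> y" using sub by blast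
        then have "y \<notin> M \<and> \<delta> = (y \<in> M')" using w mid[OF y(1)] True by (metis (full_types))
        then show "w \<in> (\<lambda>y. lift_point e (y \<in> M') y) ` (P - M)" using y by blast
      next
        fix w assume "w \<in> (\<lambda>y. lift_point e (y \<in> M') y) ` (P - M)"
        then obtain y where y: "y \<in> P" "y \<notin> M" "w = lift_point e (y \<in> M') y" by auto
        then have "Q w" using mid[of y "y \<in> M'"] True by auto
        then show "w \<in> {w. Q w}" by simp
      qed
      moreover have "inj_on (\<lambda>y. lift_point e (y \<in> M') y) (P - M)"
        by (rule inj_on_lift_point) (use PX in blast)
      ultimately have "card {w. Q w} = card P - card M"
        using MP finP by (simp add: card_image card_Diff_subset finite_subset)
      then show ?thesis using card3 by linarith
    qed
    then show ?thesis unfolding Q_def cardR' .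
  qed
  show ?thesis
    unfolding decomposes_def
  proof (intro conjI)
    show "\<forall>t'\<in>\<Union>t\<in>Tr. lift_tris e t. nondeg t' \<and> pairs_of t' \<subseteq> lift_rel e R"
    proof -
      have "pairs_of t' \<subseteq> lift_rel e R" if "t \<in> Tr" "t' \<in> lift_tris e t" for t t'
        using lt(2)[OF that] nd(2)[OF that(1)] unfolding lift_rel_def by blast
      then show ?thesis using lt(1) by blast
    qed
    show "\<forall>p\<in>lift_rel e R. \<exists>!t'. t' \<in> (\<Union>t\<in>Tr. lift_tris e t) \<and> p \<in> pairs_of t'"
      by (intro ballI ex1)
  qed (use fin leaf_count in blast)+
qed

end

section \<open>Cyclic decompositions from difference families\<close>

text \<open>For a Singer cycle \<open>s\<close>, the tuple \<open>(p, q, p', q', r')\<close> stands for the triangle \<open>s 0, s p, s q\<close>, where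
  \<open>p'\<close>, \<open>q'\<close>, \<open>r'\<close> are the Zech logarithms of \<open>p\<close>, \<open>q\<close>, \<open>q - p\<close>.\<close>

type_synonym base = "int \<times> int \<times> int \<times> int \<times> int"

definition line_flags :: "int \<Rightarrow> int \<Rightarrow> int \<Rightarrow> (int \<times> int) list" where
  "line_flags a b c = [(a, b), (a, c), (b, a), (b, c), (c, a), (c, b)]"

fun positions :: "base \<Rightarrow> (int \<times> int) list" where
  "positions (p, q, p', q', r') = line_flags 0 p p' @ line_flags p q (p + r') @ line_flags q 0 q'"

fun mid_positions :: "base \<Rightarrow> (int \<times> int) list" where
  "mid_positions (p, q, p', q', r') =
    [(p', 0), (p', p), (p + r', p), (p + r', q), (q', q), (q', 0)]"

text \<open>A list rather than a set, so that its distinctness expresses that no difference is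
  repeated within or between base triangles.\<close>

definition differences :: "int \<Rightarrow> base list \<Rightarrow> int list" where
  "differences N B = concat (map (\<lambda>\<tau>. map (\<lambda>(i, j). (j - i) mod N) (positions \<tau>)) B)"

lemma set_mid_positions: "set (mid_positions \<tau>) \<subseteq> set (positions \<tau>)"
  by (cases \<tau>) (auto simp: line_flags_def)

fun shifted :: "(int \<Rightarrow> vec) \<Rightarrow> int \<Rightarrow> base \<Rightarrow> vec \<times> vec \<times> vec" where
  "shifted s n (p, q, _) = (s n, s (n + p), s (n + q))"

text \<open>Quantifying over the shift \<open>n\<close> replaces multiplication by powers of the
  generator, so that only addition of vectors is involved.\<close>

fun zech :: "(int \<Rightarrow> vec) \<Rightarrow> base \<Rightarrow> bool" where
  "zech s (p, q, p', q', r') \<longleftrightarrow>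
    (\<forall>n. s n + s (n + p) = s (n + p') \<and> s n + s (n + q) = s (n + q') \<and>
         s (n + p) + s (n + q) = s (n + p + r'))"

lemma shifted_pairs:
  assumes "zech s \<tau>"
  shows "pairs_of (shifted s n \<tau>) = (\<lambda>(i, j). (s (n + i), s (n + j))) ` set (positions \<tau>)"
    and "mids_of (shifted s n \<tau>) = (\<lambda>(i, j). (s (n + i), s (n + j))) ` set (mid_positions \<tau>)"
proof -
  obtain p q p' q' r' where \<tau>: "\<tau> = (p, q, p', q', r')" by (cases \<tau>)
  have z: "s n + s (n + p) = s (n + p')" "s n + s (n + q) = s (n + q')"
    "s (n + p) + s (n + q) = s (n + (p + r'))" "s (n + q) + s n = s (n + q')"
    using assms unfolding \<tau> by (auto simp: add.commute add.left_commute)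
  show "pairs_of (shifted s n \<tau>) = (\<lambda>(i, j). (s (n + i), s (n + j))) ` set (positions \<tau>)"
    unfolding \<tau> by (auto simp: flags_def line_flags_def z)
  show "mids_of (shifted s n \<tau>) = (\<lambda>(i, j). (s (n + i), s (n + j))) ` set (mid_positions \<tau>)"
    unfolding \<tau> by (auto simp: mid_flags_def z)
qed

text \<open>A difference occurs only once, so a pair determines its base triangle and its position
  there, and then the shift modulo \<open>N\<close>. Along an orbit each point takes every position;
  6 middle pairs among 18 pairs per base triangle give one third.\<close>

lemma decomposes_singer:
  fixes s :: "int \<Rightarrow> vec" and N :: int and B :: "base list"
  assumes N: "N > 0" and eq: "\<And>i j. s i = s j \<longleftrightarrow> i mod N = j mod N"
    and nz: "\<And>i. s i \<noteq> 0" and z: "\<And>\<tau>. \<tau> \<in> set B \<Longrightarrow> zech s \<tau>"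
    and dist: "distinct (differences N B)" and nz0: "0 \<notin> set (differences N B)"
  shows "decomposes {shifted s n \<tau> | n \<tau>. \<tau> \<in> set B} {(s i, s j) | i j. (j - i) mod N \<in> set (differences N B)}"
    (is "decomposes ?Tr ?R")
proof -
  define f where "f = (\<lambda>(\<tau> :: base, i :: int, j). (j - i) mod N)"
  define L where "L = concat (map (\<lambda>\<tau>. map (Pair \<tau>) (positions \<tau>)) B)"
  have diffs: "differences N B = map f L"
    unfolding differences_def L_def map_concat f_def by (simp add: comp_def case_prod_unfold)
  have inj: "inj_on f (set L)" and dL: "distinct L"
    using dist unfolding diffs distinct_map by auto
  have setL: "(\<tau>, ij) \<in> set L \<longleftrightarrow> \<tau> \<in> set B \<and> ij \<in> set (positions \<tau>)" for \<tau> ij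
    unfolding L_def by auto
  have uniq: "\<tau> = \<tau>' \<and> i = i' \<and> j = j'"
    if "\<tau> \<in> set B" "\<tau>' \<in> set B" "(i, j) \<in> set (positions \<tau>)" "(i', j') \<in> set (positions \<tau>')"
      "(j - i) mod N = (j' - i') mod N" for \<tau> \<tau>' i j i' j'
    using inj_onD[OF inj, of "(\<tau>, i, j)" "(\<tau>', i', j')"] that unfolding setL f_def by auto
  have D_iff: "d \<in> set (differences N B) \<longleftrightarrow>
      (\<exists>\<tau>\<in>set B. \<exists>(i, j)\<in>set (positions \<tau>). d = (j - i) mod N)" for d
    unfolding differences_def by auto
  have D_I: "(j - i) mod N \<in> set (differences N B)" if "\<tau> \<in> set B" "(i, j) \<in> set (positions \<tau>)" for \<tau> i j
    unfolding D_iff by (rule bexI[OF _ that(1)], rule bexI[OF _ that(2)]) simp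
  have shift_mod: "(n + j - (n + i)) mod N = (j - i) mod N" for n i j :: int by simp
  have mod_shift: "(j - i) mod N = (j' - i') mod N" if "i mod N = i' mod N" "j mod N = j' mod N"
    for i j i' j' :: int
    using that by (metis mod_diff_eq)
  have pairs: "pairs_of (shifted s n \<tau>) = (\<lambda>(i, j). (s (n + i), s (n + j))) ` set (positions \<tau>)"
    "mids_of (shifted s n \<tau>) = (\<lambda>(i, j). (s (n + i), s (n + j))) ` set (mid_positions \<tau>)"
    if "\<tau> \<in> set B" for n \<tau>
    using shifted_pairs[OF z[OF that]] by auto
  have nondeg: "nondeg (shifted s n \<tau>)" if \<tau>: "\<tau> \<in> set B" for n \<tau>
  proof -
    obtain p q p' q' r' where t: "\<tau> = (p, q, p', q', r')" by (cases \<tau>)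
    have neq: "(j - i) mod N \<noteq> 0" if "(i, j) \<in> set (positions \<tau>)" for i j
      using nz0 D_I[OF \<tau> that] by auto
    have ne: "s (n + i) \<noteq> s (n + j)" if ij: "(i, j) \<in> set (positions \<tau>)" for i j
    proof
      assume "s (n + i) = s (n + j)"
      then have "(n + j - (n + i)) mod N = 0" unfolding eq by (simp add: mod_eq_dvd_iff dvd_diff_commute)
      then show False using neq[OF ij] by simp
    qed
    have "s n + s (n + p) = s (n + p')" using z[OF \<tau>] unfolding t by auto
    \<comment> \<open>The third vertex is off the opposite side: otherwise the positions
      \<open>(0, p')\<close> and \<open>(0, q)\<close> would have the same difference.\<close>
    moreover have "s (n + p') \<noteq> s (n + q)"
    proof
      assume "s (n + p') = s (n + q)"
      then have "(n + p' - n) mod N = (n + q - n) mod N" unfolding eq by (rule mod_shift[OF refl])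
      then have "(p' - 0) mod N = (q - 0) mod N" by simp
      moreover have "(0, p') \<in> set (positions \<tau>)" "(0, q) \<in> set (positions \<tau>)"
        unfolding t by (auto simp: line_flags_def)
      ultimately have "p' = q" using uniq[OF \<tau> \<tau>] by blast
      moreover have "distinct (positions \<tau>)"
        using dL \<tau> unfolding L_def by (auto simp: distinct_concat_iff distinct_map)
      ultimately show False unfolding t by (auto simp: line_flags_def)
    qed
    ultimately show ?thesis
      using ne[of 0 p] ne[of p q] ne[of q 0] nz unfolding t by (auto simp: line_flags_def)
  qed
  have R_mem: "(s i, s j) \<in> ?R \<longleftrightarrow> (j - i) mod N \<in> set (differences N B)" for i j
    using mod_shift unfolding mem_Collect_eq prod.inject eq by metis
  have in_R: "pairs_of (shifted s n \<tau>) \<subseteq> ?R" if \<tau>: "\<tau> \<in> set B" for n \<tau>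
  proof
    fix xy assume "xy \<in> pairs_of (shifted s n \<tau>)"
    then obtain i j where ij: "(i, j) \<in> set (positions \<tau>)" "xy = (s (n + i), s (n + j))"
      unfolding pairs[OF \<tau>] by auto
    then have "(j - i) mod N \<in> set (differences N B)" using D_I[OF \<tau>] by simp
    then show "xy \<in> ?R" unfolding ij(2) R_mem by simp
  qed
  have fin: "finite ?R"
  proof -
    have "s i \<in> s ` {0..<N}" for i
    proof -
      have "s i = s (i mod N)" unfolding eq by simp
      then show ?thesis using N by (intro image_eqI[of _ _ "i mod N"]) auto
    qed
    then have "?R \<subseteq> s ` {0..<N} \<times> s ` {0..<N}" by blast
    then show ?thesis by (rule finite_subset) simp
  qed
  have ex1: "\<exists>!t. t \<in> ?Tr \<and> xy \<in> pairs_of t" if xy: "xy \<in> ?R" for xy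
  proof -
    obtain i j where ij: "xy = (s i, s j)" "(j - i) mod N \<in> set (differences N B)" using xy by blast
    obtain \<tau> a b where ab: "\<tau> \<in> set B" "(a, b) \<in> set (positions \<tau>)" "(j - i) mod N = (b - a) mod N"
      using ij(2) unfolding D_iff by auto
    \<comment> \<open>The shift must carry position \<open>a\<close> to \<open>i\<close>; equality
      of differences then carries \<open>b\<close> to \<open>j\<close>.\<close>
    have "(i - a + b) mod N = j mod N"
    proof -
      have "(i + (b - a)) mod N = (i + (j - i)) mod N" using ab(3) by (metis mod_add_right_eq)
      then show ?thesis by (simp add: algebra_simps)
    qed
    then have "s (i - a + b) = s j" unfolding eq .
    then have mem: "xy \<in> pairs_of (shifted s (i - a) \<tau>)"
      unfolding pairs[OF ab(1)] ij(1) using ab(2) by (intro image_eqI[of _ _ "(a, b)"]) auto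
    have eq_t: "t = shifted s (i - a) \<tau>" if t: "t \<in> ?Tr" "xy \<in> pairs_of t" for t
    proof -
      obtain n \<tau>' where n: "t = shifted s n \<tau>'" "\<tau>' \<in> set B" using t(1) by blast
      obtain a' b' where ab': "(a', b') \<in> set (positions \<tau>')" "s i = s (n + a')" "s j = s (n + b')"
        using t(2) unfolding n(1) pairs[OF n(2)] ij(1) by auto
      then have "(j - i) mod N = (n + b' - (n + a')) mod N" unfolding eq by (intro mod_shift)
      then have "(b' - a') mod N = (b - a) mod N"
        unfolding shift_mod ab(3) by (rule sym)
      then have "\<tau>' = \<tau> \<and> a' = a \<and> b' = b"
        by (rule uniq[OF n(2) ab(1) ab'(1) ab(2)])
      moreover have "(n + d) mod N = (i - a + d) mod N" for d
      proof -
        have "i mod N = (n + a) mod N" using ab'(2) calculation unfolding eq by simp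
        then have "(i + (d - a)) mod N = (n + a + (d - a)) mod N" by (metis mod_add_left_eq)
        then show ?thesis by (simp add: algebra_simps)
      qed
      then have "s (n + d) = s (i - a + d)" for d unfolding eq .
      from this[of 0] this have "shifted s n \<tau> = shifted s (i - a) \<tau>" by (cases \<tau>) auto
      ultimately show ?thesis using n(1) by simp
    qed
    have Tr: "shifted s (i - a) \<tau> \<in> ?Tr" using ab(1) by blast
    show ?thesis
      by (rule ex1I[of _ "shifted s (i - a) \<tau>"], rule conjI[OF Tr mem], elim conjE, rule eq_t)
  qed
  have midsR: "(x, y) \<in> ?R" if t: "t \<in> ?Tr" "(x, y) \<in> mids_of t" for t x y
  proof -
    obtain n \<tau> where "t = shifted s n \<tau>" "\<tau> \<in> set B" using t(1) by blast
    then show ?thesis using in_R mids_subset_pairs t(2) by (meson subsetD)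
  qed
  have leaf_count: "3 * card {y. \<exists>t\<in>?Tr. (x, y) \<in> mids_of t} = card {y. (x, y) \<in> ?R}" for x
  proof (cases "x \<in> range s")
    case False
    have R0: "{y. (x, y) \<in> ?R} = {}" using False by auto
    have "{y. \<exists>t\<in>?Tr. (x, y) \<in> mids_of t} \<subseteq> {y. (x, y) \<in> ?R}"
      using midsR by blast
    then have "{y. \<exists>t\<in>?Tr. (x, y) \<in> mids_of t} = {}" unfolding R0 by (rule subset_empty[THEN iffD1])
    then show ?thesis unfolding R0 by (simp only: card.empty mult_0_right)
  next
    case True
    then obtain k where k: "x = s k" by blast
    \<comment> \<open>The partners of \<open>s k\<close> are enumerated by positions instead of
      indices, which reduces both cardinalities to counting positions.\<close>
    define g where "g = (\<lambda>(\<tau> :: base, i, j). s (k + (j - i)))"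
    define A where "A = (SIGMA \<tau>:set B. set (positions \<tau>))"
    define M where "M = (SIGMA \<tau>:set B. set (mid_positions \<tau>))"
    have AL: "A = set L" unfolding A_def using setL by auto
    have MA: "M \<subseteq> A" unfolding M_def A_def using set_mid_positions by blast
    have injg: "inj_on g A"
    proof (rule inj_onI)
      fix u v assume uv: "u \<in> A" "v \<in> A" "g u = g v"
      obtain \<tau> i j \<tau>' i' j' where u: "u = (\<tau>, i, j)" "v = (\<tau>', i', j')" by (cases u; cases v) auto
      have "s (k + (j - i)) = s (k + (j' - i'))" using uv(3) unfolding u g_def by simp
      then have "(k + (j - i) - k) mod N = (k + (j' - i') - k) mod N"
        unfolding eq by (rule mod_shift[OF refl])
      then show "u = v" using uv(1,2) inj_onD[OF inj, of u v] unfolding AL u f_def by simp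
    qed
    have "{y. (x, y) \<in> ?R} = g ` A"
    proof (intro set_eqI iffI)
      fix y assume "y \<in> {y. (x, y) \<in> ?R}"
      then obtain j where j: "y = s j" "(j - k) mod N \<in> set (differences N B)"
        using R_mem unfolding k by blast
      then obtain \<tau> a b where ab: "\<tau> \<in> set B" "(a, b) \<in> set (positions \<tau>)" "(j - k) mod N = (b - a) mod N"
        unfolding D_iff by auto
      have "(k + (b - a)) mod N = (k + (j - k)) mod N" using ab(3) by (metis mod_add_right_eq)
      then have "y = s (k + (b - a))" unfolding j(1) eq by simp
      then show "y \<in> g ` A" using ab unfolding A_def g_def by (intro image_eqI[of _ _ "(\<tau>, a, b)"]) auto
    next
      fix y assume "y \<in> g ` A"
      then obtain \<tau> a b where ab: "\<tau> \<in> set B" "(a, b) \<in> set (positions \<tau>)" "y = s (k + (b - a))"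
        unfolding A_def g_def by auto
      then have "(k + (b - a) - k) mod N \<in> set (differences N B)" using D_I[of \<tau> a b] by simp
      then show "y \<in> {y. (x, y) \<in> ?R}" unfolding ab(3) k mem_Collect_eq[of _ "\<lambda>y. (s k, y) \<in> ?R"] R_mem .
    qed
    moreover have "{y. \<exists>t\<in>?Tr. (x, y) \<in> mids_of t} = g ` M"
    proof (intro set_eqI iffI)
      fix y assume "y \<in> {y. \<exists>t\<in>?Tr. (x, y) \<in> mids_of t}"
      then obtain n \<tau> where n: "\<tau> \<in> set B" "(x, y) \<in> mids_of (shifted s n \<tau>)" by blast
      then obtain a b where ab: "(a, b) \<in> set (mid_positions \<tau>)" "s k = s (n + a)" "y = s (n + b)"
        unfolding pairs[OF n(1)] k by auto
      then have "(k + (b - a)) mod N = (n + a + (b - a)) mod N" unfolding eq by (metis mod_add_left_eq)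
      then have "y = s (k + (b - a))" unfolding ab(3) eq by simp
      then show "y \<in> g ` M" using ab n(1) unfolding M_def g_def by (intro image_eqI[of _ _ "(\<tau>, a, b)"]) auto
    next
      fix y assume "y \<in> g ` M"
      then obtain \<tau> a b where ab: "\<tau> \<in> set B" "(a, b) \<in> set (mid_positions \<tau>)" "y = s (k + (b - a))"
        unfolding M_def g_def by auto
      have "(x, y) \<in> mids_of (shifted s (k - a) \<tau>)"
        unfolding pairs[OF ab(1)] k ab(3) using ab(2)
        by (intro image_eqI[of _ _ "(a, b)"]) (auto simp: algebra_simps)
      then show "y \<in> {y. \<exists>t\<in>?Tr. (x, y) \<in> mids_of t}" using ab(1) by blast
    qed
    moreover have "card A = 3 * card M"
    proof -
      have "card (set (positions \<tau>)) = 3 * card (set (mid_positions \<tau>))" if "\<tau> \<in> set B" for \<tau>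
      proof -
        have d: "distinct (positions \<tau>)"
          using dL that unfolding L_def by (auto simp: distinct_concat_iff distinct_map)
        then have "distinct (mid_positions \<tau>)" by (cases \<tau>) (simp add: line_flags_def)
        moreover have "length (positions \<tau>) = 18" "length (mid_positions \<tau>) = 6"
          by (cases \<tau>; simp add: line_flags_def)+
        ultimately show ?thesis using d by (simp add: distinct_card)
      qed
      then show ?thesis unfolding A_def M_def by (simp add: card_SigmaI sum_distrib_left)
    qed
    ultimately show ?thesis
      using injg inj_on_subset[OF injg MA] by (simp only: card_image)
  qed
  show ?thesis
    unfolding decomposes_def
  proof (intro conjI)
    show "\<forall>t\<in>?Tr. nondeg t \<and> pairs_of t \<subseteq> ?R" using nondeg in_R by blast
    show "\<forall>p\<in>?R. \<exists>!t. t \<in> ?Tr \<and> p \<in> pairs_of t" by (intro ballI ex1)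
  qed (use fin leaf_count in blast)+
qed

section \<open>A difference family modulo 4095\<close>

text \<open>Found by computer search. The family is invariant under multiplication by \<open>8\<close> (a power of the Frobenius
  automorphism); the flag tells whether the orbit of the base triangle has length \<open>4\<close> or \<open>2\<close>.\<close>

definition seeds :: "(bool \<times> base) list" where
  "seeds =
  [(False, 4032, 521, 4031, 3361, 2164),
   (False, 1863, 477, 3961, 3709, 1842),
   (False, 3427, 1134, 89, 3362, 3403),
   (False, 4060, 1855, 1676, 794, 3155),
   (False, 2583, 999, 4054, 2940, 3885),
   (False, 1358, 441, 3814, 1163, 1574),
   (False, 3843, 1629, 3839, 3212, 818),
   (False, 3024, 992, 2942, 2958, 942),
   (False, 3969, 1323, 3967, 3684, 627),
   (False, 3465, 1115, 335, 399, 966),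
   (False, 3149, 881, 3175, 2545, 361),
   (False, 3978, 702, 3035, 1775, 3822),
   (False, 2142, 486, 3931, 1605, 345),
   (False, 2520, 1195, 3860, 1813, 1372),
   (True, 4088, 861, 1227, 288, 1659),
   (True, 2069, 893, 2025, 1384, 1078),
   (True, 813, 362, 4067, 621, 2918),
   (True, 3285, 539, 94, 3507, 2739),
   (True, 1641, 632, 1627, 1520, 3261),
   (True, 3729, 1636, 4086, 3762, 549),
   (True, 2543, 519, 5, 866, 1845),
   (True, 3104, 282, 3114, 2170, 3020),
   (True, 4078, 537, 4017, 3106, 1805),
   (True, 4061, 1448, 3939, 2484, 55),
   (True, 3352, 338, 4025, 3825, 3205),
   (True, 3553, 1468, 3484, 2510, 600),
   (True, 3377, 1653, 3406, 2218, 1480),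
   (True, 1546, 154, 1519, 3693, 3542),
   (True, 732, 67, 714, 3046, 2955),
   (True, 1799, 825, 106, 2012, 669),
   (True, 3517, 1366, 4010, 100, 2325),
   (True, 3828, 1339, 3993, 1223, 2862),
   (True, 2445, 986, 2374, 1156, 363),
   (True, 2087, 993, 95, 2884, 2387),
   (True, 3834, 795, 3, 653, 1044),
   (True, 4045, 239, 633, 3692, 2294),
   (True, 2909, 1150, 2825, 2476, 466),
   (True, 1781, 804, 4076, 1112, 3536),
   (True, 3772, 927, 145, 3675, 2345),
   (True, 3502, 1559, 3460, 1768, 1268),
   (True, 3493, 814, 3652, 1162, 645),
   (True, 2471, 1144, 4035, 3877, 1786),
   (True, 4002, 694, 3312, 3057, 1589),
   (True, 1730, 532, 1751, 864, 968),
   (True, 2133, 424, 2113, 3101, 1729),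
   (True, 4033, 1698, 3706, 1355, 2379),
   (True, 4058, 872, 3144, 1353, 1879),
   (True, 1914, 212, 4044, 3598, 736),
   (True, 2453, 997, 46, 3890, 1188),
   (True, 4064, 1757, 1853, 4008, 2221),
   (True, 4065, 1957, 3283, 3136, 2424),
   (True, 3947, 1497, 291, 2702, 2235),
   (True, 3643, 840, 4048, 2694, 1872),
   (True, 4082, 206, 460, 1861, 2714),
   (True, 522, 86, 528, 4005, 2288),
   (True, 844, 58, 821, 1436, 2276),
   (True, 3827, 1383, 3726, 2698, 1927),
   (True, 1892, 564, 52, 245, 639),
   (True, 2565, 318, 11, 1204, 358),
   (True, 3171, 373, 3350, 785, 1720),
   (True, 391, 169, 406, 3960, 3715),
   (True, 2039, 103, 4056, 2978, 3858),
   (True, 3382, 149, 107, 919, 1602)]"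

text \<open>Residues modulo \<open>4095\<close> are written with twelve binary digits, most significant first. Then multiplication
  by \<open>8\<close> is a rotation and negation is complementation, so that no division has to be evaluated.\<close>

fun digits :: "int list \<Rightarrow> int \<Rightarrow> bool list" where
  "digits [] x = []"
| "digits (w # ws) x = (if w \<le> x then True # digits ws (x - w) else False # digits ws x)"

text \<open>Also accepts the negative numbers \<open>d' - d\<close> that arise as differences of
  reduced residues; adding the modulus once brings them into range.\<close>

definition bits :: "int \<Rightarrow> bool list" where
  "bits x = digits [2048, 1024, 512, 256, 128, 64, 32, 16, 8, 4, 2, 1] (if x < 0 then x + 4095 else x)"

text \<open>Three of the six differences of a line; their negatives are supplied by complementation
  in \<open>expand\<close>.\<close>

definition line_bits :: "int \<Rightarrow> int \<Rightarrow> bool list list" where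
  "line_bits d d' = [bits d, bits d', bits (d' - d)]"

fun seed_bits :: "base \<Rightarrow> bool list list" where
  "seed_bits (p, q, p', q', r') = line_bits p p' @ line_bits q q' @ line_bits (if q < p then q - p + 4095 else q - p) r'"

fun rot3 :: "bool list \<Rightarrow> bool list" where
  "rot3 (a # b # c # xs) = xs @ [a, b, c]"
| "rot3 xs = xs"

definition expand :: "bool \<times> base \<Rightarrow> bool list list" where
  "expand x =
    (let B = seed_bits (snd x); B2 = B @ map rot3 B;
       B4 = (if fst x then B2 @ map rot3 (map rot3 B2) else B2)
     in B4 @ map (map Not) B4)"

text \<open>A state holds the coefficients of \<open>\<alpha> + \<beta> h\<close>, where \<open>\<alpha>\<close> and \<open>\<beta>\<close> are polynomials of degree less than \<open>6\<close>
  in \<open>\<gamma>\<close>, with \<open>\<gamma>\<^sup>6 = \<gamma>\<^sup>5 + 1\<close> and \<open>h\<^sup>2 = h + \<gamma>\<close>. The element \<open>h\<close> has order \<open>4095\<close>, and \<open>h\<close> to the power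
  \<open>65\<close> is \<open>\<gamma>\<close>.\<close>

type_synonym state = "bool \<times> bool \<times> bool \<times> bool \<times> bool \<times> bool \<times> bool \<times> bool \<times> bool \<times> bool \<times> bool \<times> bool"

fun xor :: "bool \<Rightarrow> bool \<Rightarrow> bool" where
  "xor True b = (\<not> b)" | "xor False b = b"

text \<open>Multiplication by \<open>h\<close>: \<open>(\<alpha> + \<beta> h) h = \<beta> \<gamma> +
  (\<alpha> + \<beta>) h\<close>.\<close>

fun step :: "state \<Rightarrow> state" where
  "step (a0, a1, a2, a3, a4, a5, b0, b1, b2, b3, b4, b5) = (b5, b0, b1, b2, b3, xor b4 b5,
     xor a0 b0, xor a1 b1, xor a2 b2, xor a3 b3, xor a4 b4, xor a5 b5)"

text \<open>Squaring is additive in characteristic two, so only \<open>\<gamma>\<^sup>6\<close>,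
  \<open>\<gamma>\<^sup>8\<close> and \<open>\<gamma>\<^sup>1\<^sup>0\<close> have to be reduced;
  \<open>x\<close> and \<open>y\<close> are the sums that this produces.\<close>

fun square6 :: "bool \<Rightarrow> bool \<Rightarrow> bool \<Rightarrow> bool \<Rightarrow> bool \<Rightarrow> bool
    \<Rightarrow> bool \<times> bool \<times> bool \<times> bool \<times> bool \<times> bool" where
  "square6 a0 a1 a2 a3 a4 a5 =
    (let x = xor a4 a5; y = xor a3 x in (xor a0 y, x, xor a1 x, a5, xor a2 a5, y))"

text \<open>Combines the two squared components: \<open>(\<alpha> + \<beta> h)\<^sup>2 =
  (\<alpha>\<^sup>2 + \<gamma> \<beta>\<^sup>2) + \<beta>\<^sup>2 h\<close>.\<close>

fun add_gamma_mult :: "bool \<times> bool \<times> bool \<times> bool \<times> bool \<times> bool \<Rightarrow> bool \<times> bool \<times> bool \<times> bool \<times> bool \<times> bool \<Rightarrow> state" where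
  "add_gamma_mult (a0, a1, a2, a3, a4, a5) (b0, b1, b2, b3, b4, b5) =
   (xor a0 b5, xor a1 b0, xor a2 b1, xor a3 b2, xor a4 b3, xor a5 (xor b4 b5), b0, b1, b2, b3, b4, b5)"

fun square :: "state \<Rightarrow> state" where
  "square (a0, a1, a2, a3, a4, a5, b0, b1, b2, b3, b4, b5) =
    add_gamma_mult (square6 a0 a1 a2 a3 a4 a5) (square6 b0 b1 b2 b3 b4 b5)"

definition one_state :: state where "one_state = (True, False, False, False, False, False, False, False, False, False, False, False)"

text \<open>Square-and-multiply along the binary digits of the exponent, leading digit
  first.\<close>

fun power_state :: "bool list \<Rightarrow> state \<Rightarrow> state" where
  "power_state [] s = s"
| "power_state (b # bs) s = power_state bs (if b then step (square s) else square s)"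

fun plus_one :: "state \<Rightarrow> state" where
  "plus_one (a0, xs) = (\<not> a0, xs)"

definition zech_pair :: "int \<Rightarrow> int \<Rightarrow> bool" where
  "zech_pair d d' = (plus_one (power_state (bits d) one_state) = power_state (bits d') one_state)"

fun seed_zech :: "base \<Rightarrow> bool" where
  "seed_zech (p, q, p', q', r') = (zech_pair p p' \<and> zech_pair q q' \<and> zech_pair (if q < p then q - p + 4095 else q - p) r')"

text \<open>Inserting the words into a trie one by one keeps the terms small enough for the simplifier. An insertion
  never creates a word other than the inserted one, so the number of leaves bounds the number of distinct words
  from below.\<close>

datatype trie = Empty | Leaf | Node trie trie

fun insert_word :: "bool list \<Rightarrow> trie \<Rightarrow> trie" where
  "insert_word [] t = Leaf"
| "insert_word (b # bs) (Node l r) = (if b then Node (insert_word bs l) r else Node l (insert_word bs r))"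
| "insert_word (b # bs) Empty = (if b then Node (insert_word bs Empty) Empty else Node Empty (insert_word bs Empty))"
| "insert_word (b # bs) Leaf = Leaf"

fun insert_words :: "bool list list \<Rightarrow> trie \<Rightarrow> trie" where
  "insert_words [] t = t" | "insert_words (x # xs) t = insert_words xs (insert_word x t)"

fun insert_seeds :: "(bool \<times> base) list \<Rightarrow> trie \<Rightarrow> trie" where
  "insert_seeds [] t = t" | "insert_seeds (x # xs) t = insert_seeds xs (insert_words (expand x) t)"

fun leaf_count :: "trie \<Rightarrow> int" where
 "leaf_count Empty = 0" | "leaf_count Leaf = 1" | "leaf_count (Node l r) = leaf_count l + leaf_count r"

text \<open>The value equals the total number \<open>18 * 224\<close> of differences, so no two of
  them coincide.\<close>

lemma leaf_count_seeds: "leaf_count (insert_seeds seeds Empty) = 4032"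
  by code_simp

lemma zech_seeds: "list_all (\<lambda>x. seed_zech (snd x)) seeds"
  by code_simp

lemma power_state_65: "power_state (bits 65) one_state =
    (False, True, False, False, False, False, False, False, False, False, False, False)"
  by code_simp

fun in_range :: "base \<Rightarrow> bool" where
  "in_range (p, q, p', q', r') \<longleftrightarrow> list_all (\<lambda>d. 0 \<le> d \<and> d < 4095) [p, q, p', q', r']"

lemma range_seeds: "list_all (\<lambda>x. in_range (snd x)) seeds"
  by code_simp

text \<open>Long division by conditional subtraction. What is used of it is that subtracting
  multiples of 65 preserves divisibility by 65.\<close>

fun greedy_remainder :: "int list \<Rightarrow> int \<Rightarrow> int" where
  "greedy_remainder [] x = x"
| "greedy_remainder (w # ws) x = greedy_remainder ws (if w \<le> x then x - w else x)"

definition not_mult_65 :: "int \<Rightarrow> bool" where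
  "not_mult_65 x \<longleftrightarrow>
    (let y = greedy_remainder [4160, 2080, 1040, 520, 260, 130, 65] (if x < 0 then - x else x) in 0 < y \<and> y < 65)"

fun seed_65 :: "base \<Rightarrow> bool" where
  "seed_65 (p, q, p', q', r') \<longleftrightarrow>
    list_all not_mult_65 [p, p', p' - p, q, q', q' - q, q - p, r', r' - (q - p)]"

lemma seeds_65: "list_all (\<lambda>x. seed_65 (snd x)) seeds"
  by code_simp

lemma greedy_remainder_dvd: "\<forall>w\<in>set ws. 65 dvd w \<Longrightarrow> 65 dvd x \<Longrightarrow> 65 dvd greedy_remainder ws x"
  by (induction ws x rule: greedy_remainder.induct) auto

lemma not_mult_65: "not_mult_65 x \<Longrightarrow> \<not> 65 dvd x"
proof
  assume x: "not_mult_65 x" "65 dvd x"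
  have "65 dvd greedy_remainder [4160, 2080, 1040, 520, 260, 130, 65] (if x < 0 then - x else x)"
    by (rule greedy_remainder_dvd) (use x(2) in auto)
  then show False using x(1) zdvd_not_zless unfolding not_mult_65_def Let_def by blast
qed

fun leaves :: "trie \<Rightarrow> bool list set" where
  "leaves Empty = {}"
| "leaves Leaf = {[]}"
| "leaves (Node l r) = Cons True ` leaves l \<union> Cons False ` leaves r"

lemma finite_leaves: "finite (leaves t)"
  by (induction t) auto

lemma leaf_count_leaves: "leaf_count t = int (card (leaves t))"
proof (induction t)
  case (Node l r)
  have "card (leaves (Node l r)) = card (Cons True ` leaves l) + card (Cons False ` leaves r)"
    unfolding leaves.simps by (rule card_Un_disjoint) (auto simp: finite_leaves)
  also have "\<dots> = card (leaves l) + card (leaves r)"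
    by (simp add: card_image)
  finally show ?case using Node by simp
qed auto

lemma leaves_insert_word: "leaves (insert_word bs t) \<subseteq> insert bs (leaves t)"
  by (induction bs t rule: insert_word.induct) auto

lemma leaves_insert_words: "leaves (insert_words xs t) \<subseteq> set xs \<union> leaves t"
proof (induction xs arbitrary: t)
  case (Cons x xs)
  show ?case using Cons[of "insert_word x t"] leaves_insert_word[of x t] by auto
qed simp

lemma leaves_insert_seeds: "leaves (insert_seeds xs t) \<subseteq> (\<Union>x\<in>set xs. set (expand x)) \<union> leaves t"
proof (induction xs arbitrary: t)
  case (Cons x xs)
  show ?case using Cons[of "insert_words (expand x) t"] leaves_insert_words[of "expand x" t] by auto
qed simp

section \<open>Binary words as residues modulo 4095\<close>

fun bits_value :: "bool list \<Rightarrow> nat" where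
  "bits_value [] = 0"
| "bits_value (b # bs) = (if b then 2 ^ length bs else 0) + bits_value bs"

lemma bits_value_append: "bits_value (xs @ ys) = bits_value xs * 2 ^ length ys + bits_value ys"
  by (induction xs) (auto simp: power_add algebra_simps)

lemma bits_value_less: "bits_value bs < 2 ^ length bs"
  by (induction bs) auto

lemma bits_value_Not: "int (bits_value (map Not bs)) = 2 ^ length bs - 1 - int (bits_value bs)"
  by (induction bs) auto

lemma bits_value_inj: "length xs = length ys \<Longrightarrow> bits_value xs = bits_value ys \<Longrightarrow> xs = ys"
proof (induction xs ys rule: list_induct2)
  case (Cons x xs y ys)
  then show ?case using bits_value_less[of xs] bits_value_less[of ys] by (auto split: if_splits)
qed simp

fun weights :: "nat \<Rightarrow> int list" where
  "weights 0 = []"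
| "weights (Suc n) = 2 ^ n # weights n"

lemma length_digits: "length (digits ws x) = length ws"
  by (induction ws x rule: digits.induct) auto

lemma bits_value_digits: "0 \<le> x \<Longrightarrow> x < 2 ^ n \<Longrightarrow> int (bits_value (digits (weights n) x)) = x"
proof (induction n arbitrary: x)
  case (Suc n)
  have "length (weights n) = n" by (induction n) auto
  then have l: "length (digits (weights n) y) = n" for y by (simp add: length_digits)
  show ?case using Suc.IH[of x] Suc.IH[of "x - 2 ^ n"] Suc.prems by (simp add: l)
qed simp

lemma weights_12: "[2048, 1024, 512, 256, 128, 64, 32, 16, 8, 4, 2, 1] = weights 12"
  by (simp add: eval_nat_numeral)

lemma length_bits: "length (bits d) = 12"
  unfolding bits_def by (simp add: length_digits del: digits.simps)

lemma bits_value_bits: "- 4095 < d \<Longrightarrow> d < 4095 \<Longrightarrow> int (bits_value (bits d)) = (if d < 0 then d + 4095 else d)"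
  unfolding bits_def weights_12 using bits_value_digits[of d 12] bits_value_digits[of "d + 4095" 12] by simp

lemma length_rot3: "length (rot3 bs) = length bs"
  by (cases bs rule: rot3.cases) auto

text \<open>Multiplication by 8 pushes the three leading digits to weights from 4096 on; as 4096 is
  1 modulo 4095, they re-enter at the bottom.\<close>

lemma bits_value_rot3:
  assumes "length bs = 12"
  shows "int (bits_value (rot3 bs)) mod 4095 = 8 * int (bits_value bs) mod 4095"
proof -
  obtain a b c xs where bs: "bs = a # b # c # xs" using assms by (cases bs rule: rot3.cases) auto
  have xs: "length xs = 9" using assms bs by simp
  have r: "bits_value (rot3 bs) = bits_value xs * 8 + bits_value [a, b, c]" unfolding bs by (simp add: bits_value_append)
  have "bits_value bs = bits_value ([a, b, c] @ xs)" unfolding bs by simp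
  also have "\<dots> = bits_value [a, b, c] * 512 + bits_value xs" unfolding bits_value_append xs by simp
  finally have "8 * int (bits_value bs) = int (bits_value (rot3 bs)) + 4095 * int (bits_value [a, b, c])"
    unfolding r by simp
  then show ?thesis by (simp only: mod_mult_self2)
qed

text \<open>The multiples are left unreduced, since sequences and differences are only read modulo
  the period.\<close>

fun scale :: "int \<Rightarrow> base \<Rightarrow> base" where
  "scale c (p, q, p', q', r') = (c * p, c * q, c * p', c * q', c * r')"

definition copies :: "bool \<times> base \<Rightarrow> base list" where
  "copies x = map (\<lambda>k. scale (8 ^ k) (snd x)) [0..<(if fst x then 4 else 2)]"

definition blocks :: "base list" where
  "blocks = concat (map copies seeds)"

definition residue :: "bool list \<Rightarrow> int" where
  "residue bs = int (bits_value bs) mod 4095"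

lemma residue_rot3:
  assumes "length bs = 12" "residue bs = d mod 4095"
  shows "residue (rot3 bs) = (8 * d) mod 4095"
  using bits_value_rot3[OF assms(1)] assms(2) unfolding residue_def by (metis mod_mult_right_eq)

lemma residue_Not:
  assumes "length bs = 12" "residue bs = d mod 4095"
  shows "residue (map Not bs) = (- d) mod 4095"
proof -
  have "int (bits_value (map Not bs)) = 4095 * 1 - int (bits_value bs)" using bits_value_Not[of bs] assms(1) by simp
  then have "residue (map Not bs) = (- int (bits_value bs)) mod 4095" unfolding residue_def by simp
  then show ?thesis using assms(2) unfolding residue_def by (metis mod_minus_eq)
qed

lemma residue_bits: "- 4095 < d \<Longrightarrow> d < 4095 \<Longrightarrow> residue (bits d) = d mod 4095"
proof -
  assume d: "- 4095 < d" "d < 4095"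
  have "(if d < 0 then d + 4095 else d) mod 4095 = d mod 4095" by simp
  then show ?thesis unfolding residue_def bits_value_bits[OF d] .
qed

definition position_diffs :: "base \<Rightarrow> int set" where
  "position_diffs \<tau> = (\<lambda>(i, j). j - i) ` set (positions \<tau>)"

lemma set_differences: "set (differences N B) = (\<Union>\<tau>\<in>set B. (\<lambda>d. d mod N) ` position_diffs \<tau>)"
  unfolding differences_def position_diffs_def by (simp add: image_image case_prod_unfold)

lemma position_diffs_eq: "position_diffs (p, q, p', q', r') =
  {p, p', p' - p, q, q', q' - q, q - p, r', r' - (q - p), - p, - p', p - p', - q, - q', q - q', p - q, - r', q - p - r'}"
  unfolding position_diffs_def by (auto simp: line_flags_def)

lemma uminus_position_diffs: "d \<in> position_diffs \<tau> \<Longrightarrow> - d \<in> position_diffs \<tau>"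
  by (cases \<tau>) (auto simp: position_diffs_eq)

lemma position_diffs_scale: "position_diffs (scale c \<tau>) = (*) c ` position_diffs \<tau>"
  by (cases \<tau>) (auto simp: position_diffs_eq algebra_simps)

lemma residue_seed_bits:
  assumes "in_range \<tau>" "b \<in> set (seed_bits \<tau>)"
  shows "length b = 12 \<and> (\<exists>d\<in>position_diffs \<tau>. residue b = d mod 4095)"
proof -
  obtain p q p' q' r' where \<tau>: "\<tau> = (p, q, p', q', r')" by (cases \<tau>)
  define r where "r = (if q < p then q - p + 4095 else q - p)"
  have rng: "0 \<le> p" "p < 4095" "0 \<le> q" "q < 4095" "0 \<le> p'" "p' < 4095" "0 \<le> q'" "q' < 4095"
    "0 \<le> r'" "r' < 4095" using assms(1) unfolding \<tau> by auto
  have r: "0 \<le> r" "r < 4095" using rng by (auto simp: r_def)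
  have rmod: "r mod 4095 = (q - p) mod 4095" "(r' - r) mod 4095 = (r' - (q - p)) mod 4095"
  proof -
    have "r = (q - p) + 4095 * (if q < p then 1 else 0)" unfolding r_def by simp
    then show "r mod 4095 = (q - p) mod 4095" by (simp only: mod_mult_self2)
    then show "(r' - r) mod 4095 = (r' - (q - p)) mod 4095" by (metis mod_diff_right_eq)
  qed
  have "b \<in> bits ` {p, p', p' - p, q, q', q' - q, r, r', r' - r}"
    using assms(2) unfolding \<tau> by (auto simp: line_bits_def r_def)
  then obtain d where d: "b = bits d" "d \<in> {p, p', p' - p, q, q', q' - q, r, r', r' - r}" by blast
  have "- 4095 < d" "d < 4095" using d(2) rng r by auto
  then have res: "residue b = d mod 4095" unfolding d(1) by (rule residue_bits)
  have "\<exists>d'\<in>position_diffs \<tau>. d mod 4095 = d' mod 4095"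
    using d(2) rmod unfolding \<tau> position_diffs_eq by auto
  then show ?thesis using res d(1) length_bits by auto
qed

lemma residue_expand:
  assumes x: "in_range (snd x)" and b: "b \<in> set (expand x)"
  shows "residue b \<in> set (differences 4095 (copies x))" and "length b = 12"
proof -
  define n :: nat where "n = (if fst x then 4 else 2)"
  define \<tau> where "\<tau> = snd x"
  \<comment> \<open>Stage \<open>k\<close> holds words for differences multiplied by
    \<open>8 ^ k\<close>. A rotation raises the stage by one; complementation preserves it because
    \<open>position_diffs\<close> is closed under negation.\<close>
  define A where "A k = {b. length b = 12 \<and> (\<exists>d\<in>position_diffs \<tau>. residue b = (8 ^ k * d) mod 4095)}" for k :: nat
  have rot: "rot3 b \<in> A (Suc k)" if bA: "b \<in> A k" for b k
  proof -
    obtain d where "length b = 12" "d \<in> position_diffs \<tau>" "residue b = (8 ^ k * d) mod 4095"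
      using bA unfolding A_def by blast
    then show ?thesis
      using residue_rot3[of b] length_rot3[of b] unfolding A_def mem_Collect_eq power_Suc mult.assoc by metis
  qed
  have neg: "map Not b \<in> A k" if bA: "b \<in> A k" for b k
  proof -
    obtain d where "length b = 12" "d \<in> position_diffs \<tau>" "residue b = (8 ^ k * d) mod 4095"
      using bA unfolding A_def by blast
    then show ?thesis
      using residue_Not[of b] uminus_position_diffs length_map
      unfolding A_def mem_Collect_eq by (metis mult_minus_right)
  qed
  have B: "b \<in> A 0" if "b \<in> set (seed_bits \<tau>)" for b
    using residue_seed_bits[OF x that[unfolded \<tau>_def]] unfolding A_def \<tau>_def by simp
  have rots: "rot3 b \<in> A 1" "rot3 (rot3 b) \<in> A 2" "rot3 (rot3 (rot3 b)) \<in> A 3" if "b \<in> set (seed_bits \<tau>)" for b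
    using rot[of b 0] rot[of "rot3 b" 1] rot[of "rot3 (rot3 b)" 2] B[OF that]
    by (simp_all add: numeral_2_eq_2 numeral_3_eq_3)
  have "b \<in> (\<Union>k<n. A k)"
  proof -
    define B2 where "B2 = seed_bits \<tau> @ map rot3 (seed_bits \<tau>)"
    define C where "C = (if fst x then B2 @ map rot3 (map rot3 B2) else B2)"
    have "expand x = C @ map (map Not) C"
      unfolding expand_def C_def B2_def \<tau>_def Let_def ..
    then obtain c where c: "c \<in> set C" "b = c \<or> b = map Not c" using b by auto
    have "\<exists>k<n. c \<in> A k"
    proof (cases "fst x")
      case True
      have n: "n = 4" using True unfolding n_def by simp
      obtain a where a: "a \<in> set (seed_bits \<tau>)" "c = a \<or> c = rot3 a \<or> c = rot3 (rot3 a) \<or> c = rot3 (rot3 (rot3 a))"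
        using c(1) True unfolding C_def B2_def by auto
      have "0 < n" "1 < n" "2 < n" "3 < n" unfolding n by simp_all
      then show ?thesis using a(2) B[OF a(1)] rots[OF a(1)] by metis
    next
      case False
      have n: "n = 2" using False unfolding n_def by simp
      obtain a where a: "a \<in> set (seed_bits \<tau>)" "c = a \<or> c = rot3 a"
        using c(1) False unfolding C_def B2_def by auto
      have "0 < n" "1 < n" unfolding n by simp_all
      then show ?thesis using a(2) B[OF a(1)] rots[OF a(1)] by metis
    qed
    then show ?thesis using c(2) neg by auto
  qed
  then obtain k where k: "k < n" "b \<in> A k" by blast
  then obtain d where d: "d \<in> position_diffs \<tau>" "residue b = (8 ^ k * d) mod 4095"
    unfolding A_def by blast
  show "length b = 12" using k(2) unfolding A_def by simp
  have "scale (8 ^ k) \<tau> \<in> set (copies x)" using k(1) unfolding copies_def \<tau>_def n_def by auto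
  moreover have "residue b \<in> (\<lambda>d. d mod 4095) ` position_diffs (scale (8 ^ k) \<tau>)"
    unfolding position_diffs_scale d(2) using d(1) by blast
  ultimately show "residue b \<in> set (differences 4095 (copies x))"
    unfolding set_differences by blast
qed

section \<open>The differences tile the residues not divisible by 65\<close>

lemma length_differences: "length (differences N B) = 18 * length B"
  unfolding differences_def by (induction B) (auto simp: line_flags_def)

lemma dvd_65_cancel: "65 dvd 8 ^ k * (d :: int) \<Longrightarrow> 65 dvd d"
proof (induction k)
  case (Suc k)
  have "65 dvd y" if "65 dvd 8 * y" for y :: int using that by presburger
  then show ?case using Suc by (simp only: power_Suc mult.assoc)
qed simp

text \<open>Because 8 is invertible modulo 65 and 65 divides 4095, neither the copies nor the
  reduction affect divisibility, and checking the seeds suffices.\<close>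

lemma differences_blocks_65:
  assumes "d \<in> set (differences 4095 blocks)"
  shows "\<not> 65 dvd d"
proof -
  obtain x \<tau> d' where x: "x \<in> set seeds" "\<tau> \<in> set (copies x)" "d' \<in> position_diffs \<tau>" "d = d' mod 4095"
    using assms unfolding set_differences blocks_def by auto
  obtain k where k: "\<tau> = scale (8 ^ k) (snd x)" using x(2) unfolding copies_def by auto
  obtain \<delta> where \<delta>: "\<delta> \<in> position_diffs (snd x)" "d' = 8 ^ k * \<delta>"
    using x(3) unfolding k position_diffs_scale by blast
  have "\<not> 65 dvd \<delta>"
  proof -
    obtain p q p' q' r' where \<tau>: "snd x = (p, q, p', q', r')" by (cases "snd x")
    have "seed_65 (snd x)" using seeds_65 x(1) unfolding list_all_iff by blast
    then have "\<forall>e\<in>{p, p', p' - p, q, q', q' - q, q - p, r', r' - (q - p)}. \<not> 65 dvd e"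
      unfolding \<tau> by (simp add: not_mult_65)
    moreover have "\<delta> \<in> {p, p', p' - p, q, q', q' - q, q - p, r', r' - (q - p)} \<or>
        - \<delta> \<in> {p, p', p' - p, q, q', q' - q, q - p, r', r' - (q - p)}"
      using \<delta>(1) unfolding \<tau> position_diffs_eq by auto
    ultimately show ?thesis using dvd_minus_iff by blast
  qed
  then have "\<not> 65 dvd d'" unfolding \<delta>(2) using dvd_65_cancel by blast
  moreover have "65 dvd (4095 :: int)" by simp
  ultimately show ?thesis unfolding x(4) by (simp add: dvd_mod_iff)
qed

lemma length_blocks: "length blocks = 224"
proof -
  have "length (copies x) = (if fst x then 4 else 2)" for x unfolding copies_def by simp
  then have "length blocks = sum_list (map (\<lambda>x. if fst x then 4 else 2) seeds)"
    unfolding blocks_def by (simp add: length_concat comp_def)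
  then show ?thesis unfolding seeds_def by simp
qed

text \<open>Two tight counts. At least 4032 words have different residues, all among the 4032 listed
  differences, so the list has no repetition. The residues not divisible by 65 number
  \<open>4095 - 63 = 4032\<close> as well, so inclusion becomes equality.\<close>

lemma blocks_differences:
  shows "distinct (differences 4095 blocks)"
    and "set (differences 4095 blocks) = {d. 0 \<le> d \<and> d < 4095 \<and> \<not> 65 dvd d}"
proof -
  define S where "S = (\<Union>x\<in>set seeds. set (expand x))"
  have S: "residue b \<in> set (differences 4095 blocks)" "length b = 12" if "b \<in> S" for b
  proof -
    obtain x where x: "x \<in> set seeds" "b \<in> set (expand x)" using \<open>b \<in> S\<close> unfolding S_def by blast
    have "in_range (snd x)" using range_seeds x(1) unfolding list_all_iff by blast
    note * = residue_expand[OF this x(2)]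
    have "set (copies x) \<subseteq> set blocks" using x(1) unfolding blocks_def by auto
    then show "residue b \<in> set (differences 4095 blocks)" using *(1) unfolding set_differences by blast
    show "length b = 12" by (rule *(2))
  qed
  have "inj_on residue S"
  proof (rule inj_onI)
    fix b c assume bc: "b \<in> S" "c \<in> S" "residue b = residue c"
    \<comment> \<open>Among words of length twelve only the one with value 4095 is not a reduced
      residue. It would represent zero, a multiple of 65.\<close>
    have small: "int (bits_value b) < 4095" if "b \<in> S" for b
    proof (rule ccontr)
      assume "\<not> int (bits_value b) < 4095"
      then have "bits_value b = 4095" using bits_value_less[of b] S(2)[OF that] by simp
      then have "residue b = 0" unfolding residue_def by simp
      then show False using differences_blocks_65[OF S(1)[OF that]] by simp
    qed
    have "bits_value b = bits_value c" using bc(3) small[OF bc(1)] small[OF bc(2)] unfolding residue_def by simp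
    then show "b = c" using bits_value_inj S(2) bc by simp
  qed
  moreover have finS: "finite S" unfolding S_def by simp
  moreover have "4032 \<le> card S"
  proof -
    have "leaves (insert_seeds seeds Empty) \<subseteq> S" using leaves_insert_seeds[of seeds Empty] unfolding S_def by simp
    then have "card (leaves (insert_seeds seeds Empty)) \<le> card S" by (rule card_mono[OF finS])
    then show ?thesis using leaf_count_seeds unfolding leaf_count_leaves by simp
  qed
  moreover have "card (residue ` S) \<le> card (set (differences 4095 blocks))"
    by (rule card_mono) (use S(1) in auto)
  ultimately have le: "4032 \<le> card (set (differences 4095 blocks))" by (simp add: card_image)
  have len: "length (differences 4095 blocks) = 4032"
    unfolding length_differences length_blocks by simp
  then show dist: "distinct (differences 4095 blocks)"
    using le card_length[of "differences 4095 blocks"] by (intro card_distinct) simp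
  define D :: "int set" where "D = {d. 0 \<le> d \<and> d < 4095 \<and> \<not> 65 dvd d}"
  have "D = {0..<4095} - (*) 65 ` {0..<63}"
    unfolding D_def by (auto simp: dvd_def)
  then have "card D = 4032" by (simp add: card_Diff_subset card_image inj_on_def image_subset_iff)
  moreover have "set (differences 4095 blocks) \<subseteq> D"
  proof
    fix d assume d: "d \<in> set (differences 4095 blocks)"
    then have "0 \<le> d \<and> d < 4095" unfolding set_differences by auto
    then show "d \<in> D" using differences_blocks_65[OF d] unfolding D_def by simp
  qed
  moreover have "finite D" unfolding D_def by (rule finite_subset[of _ "{0..<4095}"]) auto
  ultimately show "set (differences 4095 blocks) = D"
    by (intro card_subset_eq) (simp_all add: distinct_card[OF dist] len)
qed

section \<open>The action of the field with 64 elements\<close>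

text \<open>Multiplication by a root of the primitive polynomial \<open>t\<^sup>6 + t\<^sup>5 + 1\<close> on each block of six coordinates.\<close>

definition gamma :: "vec \<Rightarrow> vec" where
  "gamma x = (\<lambda>i. if i mod 6 = 0 then x (i + 5) else if i mod 6 = 5 then x (i - 1) + x i else x (i - 1))"

lemma gamma_add [simp]: "gamma (x + y) = gamma x + gamma y"
  by (auto simp: gamma_def fun_eq_iff)

lemma gamma_0 [simp]: "gamma 0 = 0"
  by (auto simp: gamma_def fun_eq_iff)

definition coord :: "vec \<Rightarrow> nat \<Rightarrow> nat \<Rightarrow> bit" where
  "coord x j r = x (6 * j + r)"

lemma coord_gamma:
  "coord (gamma x) j 0 = coord x j 5" "coord (gamma x) j 1 = coord x j 0"
  "coord (gamma x) j 2 = coord x j 1" "coord (gamma x) j 3 = coord x j 2"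
  "coord (gamma x) j 4 = coord x j 3" "coord (gamma x) j 5 = coord x j 4 + coord x j 5"
proof -
  have "(6 * j + r) mod 6 = r" if "r < 6" for r :: nat using that by simp
  then have *: "coord (gamma x) j r = (if r = 0 then x (6 * j + r + 5) else if r = 5
      then x (6 * j + r - 1) + x (6 * j + r) else x (6 * j + r - 1))" if "r < 6" for r
    using that unfolding coord_def gamma_def by simp
  show "coord (gamma x) j 0 = coord x j 5" "coord (gamma x) j 1 = coord x j 0"
    "coord (gamma x) j 2 = coord x j 1" "coord (gamma x) j 3 = coord x j 2"
    "coord (gamma x) j 4 = coord x j 3" "coord (gamma x) j 5 = coord x j 4 + coord x j 5"
    using *[of 0] *[of 1] *[of 2] *[of 3] *[of 4] *[of 5]
    by (simp_all only: coord_def; simp add: numeral_eq_Suc)+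
qed

lemma gamma_6 [simp]:
  "gamma (gamma (gamma (gamma (gamma (gamma x))))) = gamma (gamma (gamma (gamma (gamma x)))) + x"
proof
  fix i :: nat
  define j where "j = i div 6"
  define r where "r = i mod 6"
  have "r < 6" unfolding r_def by simp
  then have r: "r = 0 \<or> r = 1 \<or> r = 2 \<or> r = 3 \<or> r = 4 \<or> r = 5" by linarith
  have i: "i = 6 * j + r" unfolding j_def r_def by simp
  have add: "coord (x + y) j r = coord x j r + coord y j r" for x y by (simp add: coord_def)
  have "coord (gamma (gamma (gamma (gamma (gamma (gamma x)))))) j r =
      coord (gamma (gamma (gamma (gamma (gamma x))))) j r + coord x j r"
    using r by (elim disjE; simp only: coord_gamma add.commute)
  then show "gamma (gamma (gamma (gamma (gamma (gamma x))))) i = (gamma (gamma (gamma (gamma (gamma x)))) + x) i"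
    unfolding add[symmetric] unfolding coord_def i .
qed

lemma gamma_tuples: "x \<in> tuples (6 * k) \<Longrightarrow> gamma x \<in> tuples (6 * k)"
  unfolding tuples_def
proof (intro CollectI allI impI)
  fix i assume x: "x \<in> {x. \<forall>i\<ge>6 * k. x i = 0}" and i: "6 * k \<le> i"
  have "i mod 6 \<noteq> 0 \<Longrightarrow> 6 * k \<le> i - 1"
  proof -
    assume "i mod 6 \<noteq> 0"
    then have "i \<noteq> 6 * k" by (metis mod_mult_self1_is_0)
    then show ?thesis using i by simp
  qed
  then show "gamma x i = 0" using x i unfolding gamma_def by auto
qed

section \<open>States acting on sequences of vectors\<close>

definition select :: "bool \<Rightarrow> vec \<Rightarrow> vec" where
  "select b x = (if b then x else 0)"

lemma select_simps [simp]: "select True x = x" "select False x = 0" "select b 0 = 0"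
  by (auto simp: select_def)

lemma select_add: "select b (x + y) = select b x + select b y"
  by (auto simp: select_def)

lemma select_xor: "select (xor a b) x = select a x + select b x"
  by (cases a; cases b) auto

lemma gamma_select: "gamma (select b x) = select b (gamma x)"
  by (auto simp: select_def)

lemma xor_iff: "xor a b \<longleftrightarrow> a \<noteq> b"
  by (cases a) auto

lemma xor_ac: "xor (xor a b) c = xor a (xor b c)" "xor a b = xor b a" "xor a (xor b c) = xor b (xor a c)"
  "xor a (xor a b) = b" "xor a a = False" "xor False a = a" "xor a False = a"
  by (auto simp: xor_iff)

text \<open>The element \<open>\<alpha> + \<beta> h\<close> acts on a sequence,
  \<open>\<gamma>\<close> through \<open>gamma\<close> and \<open>h\<close> through the shift of the
  index.\<close>

fun eval_state :: "(nat \<Rightarrow> vec) \<Rightarrow> state \<Rightarrow> nat \<Rightarrow> vec" where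
  "eval_state v (a0, a1, a2, a3, a4, a5, b0, b1, b2, b3, b4, b5) n =
     select a0 (v n) + select a1 (gamma (v n)) + select a2 (gamma (gamma (v n))) +
     select a3 (gamma (gamma (gamma (v n)))) + select a4 (gamma (gamma (gamma (gamma (v n))))) +
     select a5 (gamma (gamma (gamma (gamma (gamma (v n)))))) +
     select b0 (v (Suc n)) + select b1 (gamma (v (Suc n))) + select b2 (gamma (gamma (v (Suc n)))) +
     select b3 (gamma (gamma (gamma (v (Suc n))))) + select b4 (gamma (gamma (gamma (gamma (v (Suc n)))))) +
     select b5 (gamma (gamma (gamma (gamma (gamma (v (Suc n)))))))"

text \<open>The identity \<open>(h z)\<^sup>2 = h\<^sup>2 z\<^sup>2\<close>, checked on coordinates.
  Through it square-and-multiply reduces to iterates of \<open>step\<close>, without a ring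
  structure on states.\<close>

lemma square_step: "square (step st) = step (step (square st))"
proof -
  obtain a0 a1 a2 a3 a4 a5 b0 b1 b2 b3 b4 b5 where "st = (a0, a1, a2, a3, a4, a5, b0, b1, b2, b3, b4, b5)"
    by (cases st) auto
  then show ?thesis by (simp add: xor_ac Let_def)
qed

lemma square_power: "square ((step ^^ n) one_state) = (step ^^ (2 * n)) one_state"
  by (induction n) (simp_all add: square_step, simp add: one_state_def xor_iff)

lemma power_state_eq: "power_state bs ((step ^^ n) one_state) = (step ^^ (2 ^ length bs * n + bits_value bs)) one_state"
proof (induction bs arbitrary: n)
  case (Cons b bs)
  have "power_state (b # bs) ((step ^^ n) one_state) = power_state bs ((step ^^ (2 * n + (if b then 1 else 0))) one_state)"
    by (simp add: square_power)
  also have "\<dots> = (step ^^ (2 ^ length bs * (2 * n + (if b then 1 else 0)) + bits_value bs)) one_state"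
    by (rule Cons.IH)
  also have "2 ^ length bs * (2 * n + (if b then 1 else 0)) + bits_value bs = 2 ^ length (b # bs) * n + bits_value (b # bs)"
    by (simp add: algebra_simps)
  finally show ?case .
qed simp

lemma power_state_bits:
  assumes "0 \<le> d" "d < 4095"
  shows "power_state (bits d) one_state = (step ^^ nat d) one_state"
proof -
  have "bits_value (bits d) = nat d" using bits_value_bits[of d] assms by simp
  then show ?thesis using power_state_eq[of "bits d" 0] by simp
qed

text \<open>The recurrence is \<open>h\<^sup>2 = h + \<gamma>\<close> with the index shift in the
  role of \<open>h\<close>.\<close>

locale singer_sequence =
  fixes v :: "nat \<Rightarrow> vec"
  assumes rec: "v (Suc (Suc n)) = v (Suc n) + gamma (v n)"
begin

lemma eval_state_step: "eval_state v (step st) n = eval_state v st (Suc n)"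
proof -
  obtain a0 a1 a2 a3 a4 a5 b0 b1 b2 b3 b4 b5 where "st = (a0, a1, a2, a3, a4, a5, b0, b1, b2, b3, b4, b5)"
    by (cases st) auto
  then show ?thesis
    by (simp add: select_xor select_add rec add.assoc add.commute add.left_commute)
qed

lemma eval_state_power: "eval_state v ((step ^^ i) one_state) n = v (n + i)"
proof (induction i arbitrary: n)
  case 0
  show ?case by (simp add: one_state_def)
next
  case (Suc i)
  show ?case using Suc[of "Suc n"] by (simp add: eval_state_step)
qed

lemma eval_state_plus_one: "eval_state v (plus_one st) n = v n + eval_state v st n"
proof -
  obtain a0 a1 a2 a3 a4 a5 b0 b1 b2 b3 b4 b5 where "st = (a0, a1, a2, a3, a4, a5, b0, b1, b2, b3, b4, b5)"
    by (cases st) auto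
  then show ?thesis by (cases a0) (simp_all add: add.assoc)
qed

lemma v_65: "v (n + 65) = gamma (v n)"
proof -
  have "v (n + 65) = eval_state v (power_state (bits 65) one_state) n"
    unfolding power_state_bits[of 65, simplified] eval_state_power ..
  then show ?thesis unfolding power_state_65 by simp
qed

text \<open>An identity computed once between states holds along every sequence with the recurrence,
  hence in all K-planes simultaneously.\<close>

lemma v_zech:
  assumes "zech_pair d d'" "0 \<le> d" "d < 4095" "0 \<le> d'" "d' < 4095"
  shows "v n + v (n + nat d) = v (n + nat d')"
proof -
  have "eval_state v (plus_one (power_state (bits d) one_state)) n = eval_state v (power_state (bits d') one_state) n"
    using assms(1) unfolding zech_pair_def by simp
  then show ?thesis unfolding eval_state_plus_one power_state_bits[OF assms(2,3)] power_state_bits[OF assms(4,5)] eval_state_power .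
qed

end

section \<open>Lines over the field with 64 elements\<close>

type_synonym six = "bool \<times> bool \<times> bool \<times> bool \<times> bool \<times> bool"

fun eval6 :: "vec \<Rightarrow> six \<Rightarrow> vec" where
  "eval6 x (a0, a1, a2, a3, a4, a5) = select a0 x + select a1 (gamma x) + select a2 (gamma (gamma x)) +
     select a3 (gamma (gamma (gamma x))) + select a4 (gamma (gamma (gamma (gamma x)))) +
     select a5 (gamma (gamma (gamma (gamma (gamma x)))))"

fun step6 :: "six \<Rightarrow> six" where
  "step6 (a0, a1, a2, a3, a4, a5) = (a5, a0, a1, a2, a3, xor a4 a5)"

definition one6 :: six where "one6 = (True, False, False, False, False, False)"
definition zero6 :: six where "zero6 = (False, False, False, False, False, False)"

fun add6 :: "six \<Rightarrow> six \<Rightarrow> six" where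
  "add6 (a0, a1, a2, a3, a4, a5) (b0, b1, b2, b3, b4, b5) =
    (xor a0 b0, xor a1 b1, xor a2 b2, xor a3 b3, xor a4 b4, xor a5 b5)"

text \<open>Only the length of the list matters; it bounds the orbit in a form that unfolds under
  evaluation.\<close>

fun orbit :: "('a \<Rightarrow> 'a) \<Rightarrow> 'b list \<Rightarrow> 'a \<Rightarrow> 'a list" where
  "orbit f [] s = []"
| "orbit f (x # xs) s = s # orbit f xs (f s)"

lemma set_orbit: "set (orbit f xs s) = (\<lambda>i. (f ^^ i) s) ` {..<length xs}"
proof (induction xs arbitrary: s)
  case (Cons x xs)
  have "(\<lambda>i. (f ^^ i) s) ` {..<Suc n} = insert s ((\<lambda>i. (f ^^ i) (f s)) ` {..<n})" for n
    unfolding lessThan_Suc_eq_insert_0 by (simp add: image_image funpow_swap1)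
  then show ?case using Cons by simp
qed simp

lemma foldl_funpow: "foldl (\<lambda>s _. f s) s xs = (f ^^ length xs) s"
  by (induction xs arbitrary: s) (simp_all add: funpow_swap1)

lemma step6_period: "(step6 ^^ 63) one6 = one6"
proof -
  have "foldl (\<lambda>s _. step6 s) one6 [1..63] = one6" by code_simp
  then show ?thesis unfolding foldl_funpow by simp
qed

text \<open>Primitivity of \<open>t\<^sup>6 + t\<^sup>5 + 1\<close>, verified by running through the
  63 powers. It reconciles two views of a K-line: coefficients show closure under addition, powers
  of \<open>gamma\<close> show closure under multiplication.\<close>

lemma step6_orbit: "c = zero6 \<or> (\<exists>i<63. c = (step6 ^^ i) one6)"
proof -
  have "\<forall>a0 a1 a2 a3 a4 a5. list_ex ((=) (a0, a1, a2, a3, a4, a5)) (zero6 # orbit step6 [1..63] one6)"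
    by code_simp
  then have "\<forall>a0 a1 a2 a3 a4 a5. (a0, a1, a2, a3, a4, a5) \<in> set (zero6 # orbit step6 [1..63] one6)"
    unfolding list_ex_iff by metis
  then have "c \<in> set (zero6 # orbit step6 [1..63] one6)" by (cases c) blast
  then show ?thesis by (auto simp: set_orbit)
qed

lemma eval6_step: "eval6 x (step6 c) = gamma (eval6 x c)"
proof -
  obtain a0 a1 a2 a3 a4 a5 where "c = (a0, a1, a2, a3, a4, a5)" by (cases c) auto
  then show ?thesis by (simp add: select_xor select_add gamma_select add.assoc add.commute add.left_commute)
qed

lemma eval6_power: "eval6 x ((step6 ^^ i) one6) = (gamma ^^ i) x"
  by (induction i) (simp_all add: eval6_step, simp add: one6_def)

lemma eval6_add: "eval6 x (add6 c d) = eval6 x c + eval6 x d"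
proof -
  obtain a0 a1 a2 a3 a4 a5 b0 b1 b2 b3 b4 b5
    where "c = (a0, a1, a2, a3, a4, a5)" "d = (b0, b1, b2, b3, b4, b5)" by (cases c; cases d) auto
  then show ?thesis by (simp add: select_xor add.assoc add.commute add.left_commute)
qed

lemma add6_zero: "add6 c d = zero6 \<longleftrightarrow> c = d"
  by (cases c; cases d) (auto simp: zero6_def xor_iff)

lemma gamma_63: "(gamma ^^ 63) x = x"
  using eval6_power[of x 63] eval6_power[of x 0] unfolding step6_period by simp

lemma funpow_gamma_add: "(gamma ^^ i) (x + y) = (gamma ^^ i) x + (gamma ^^ i) y"
  by (induction i) (simp_all only: funpow.simps id_apply comp_apply gamma_add)

lemma funpow_gamma_0: "(gamma ^^ i) 0 = 0"
  by (induction i) (simp_all only: funpow.simps id_apply comp_apply gamma_0)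

lemma funpow_gamma_mod: "(gamma ^^ i) x = (gamma ^^ (i mod 63)) x"
  using funpow_mod_eq[where f = gamma and n = 63 and x = x and m = i] gamma_63 by metis

lemma funpow_gamma_inj: "(gamma ^^ i) x = 0 \<longleftrightarrow> x = 0"
proof
  assume "(gamma ^^ i) x = 0"
  then have "(gamma ^^ (i mod 63)) x = 0" using funpow_gamma_mod by metis
  then have "(gamma ^^ (63 - i mod 63)) ((gamma ^^ (i mod 63)) x) = 0" using funpow_gamma_0 by metis
  moreover have "63 - i mod 63 + i mod 63 = 63" using mod_less_divisor[of 63 i] by linarith
  ultimately show "x = 0" using gamma_63[of x] by (metis comp_apply funpow_add)
qed (simp add: funpow_gamma_0)

definition K_line :: "vec \<Rightarrow> vec set" where
  "K_line x = range (eval6 x)"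

lemma K_line_eq: "K_line x = insert 0 (range (\<lambda>i. (gamma ^^ i) x))"
proof (intro set_eqI iffI)
  fix z assume "z \<in> K_line x"
  then obtain c where "z = eval6 x c" unfolding K_line_def by blast
  moreover have "eval6 x zero6 = 0" by (simp add: zero6_def)
  ultimately show "z \<in> insert 0 (range (\<lambda>i. (gamma ^^ i) x))"
    using step6_orbit[of c] eval6_power[of x] by auto
next
  fix z assume "z \<in> insert 0 (range (\<lambda>i. (gamma ^^ i) x))"
  moreover have "0 = eval6 x zero6" by (simp add: zero6_def)
  ultimately show "z \<in> K_line x"
    unfolding K_line_def using eval6_power[of x, symmetric] by auto
qed

lemma K_line_0: "0 \<in> K_line x" and K_line_self: "x \<in> K_line x"
  unfolding K_line_eq using funpow_0 by (auto intro: rev_image_eqI[of 0])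

lemma K_line_add: "a \<in> K_line x \<Longrightarrow> b \<in> K_line x \<Longrightarrow> a + b \<in> K_line x"
proof -
  assume "a \<in> K_line x" "b \<in> K_line x"
  then obtain c d where "a = eval6 x c" "b = eval6 x d" unfolding K_line_def by blast
  then have "a + b = eval6 x (add6 c d)" by (simp only: eval6_add)
  then show ?thesis unfolding K_line_def by blast
qed

lemma K_line_funpow:
  assumes "a \<in> K_line x"
  shows "(gamma ^^ i) a \<in> K_line x"
proof (cases "a = 0")
  case True
  then show ?thesis using K_line_0 funpow_gamma_0 by simp
next
  case False
  then obtain j where "a = (gamma ^^ j) x" using assms unfolding K_line_eq by blast
  then have "(gamma ^^ i) a = (gamma ^^ (i + j)) x" by (simp add: funpow_add)
  then show ?thesis unfolding K_line_eq by blast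
qed

lemma K_line_subset: "a \<in> K_line x \<Longrightarrow> K_line a \<subseteq> K_line x"
  using K_line_funpow[of a x] K_line_0[of x] by (auto simp: K_line_eq[of a])

text \<open>If two coefficient vectors gave the same element, their nonzero sum would be a power of
  \<open>gamma\<close> that kills \<open>x\<close>, but \<open>gamma\<close> is invertible.\<close>

lemma card_K_line:
  assumes "x \<noteq> 0"
  shows "card (K_line x) = 64"
proof -
  have "inj (eval6 x)"
  proof (rule injI)
    fix c d assume "eval6 x c = eval6 x d"
    then have "eval6 x (add6 c d) = 0" by (simp add: eval6_add)
    then have "add6 c d = zero6"
      using step6_orbit[of "add6 c d"] eval6_power[of x] funpow_gamma_inj assms by metis
    then show "c = d" by (simp add: add6_zero)
  qed
  then have "card (K_line x) = card (UNIV :: six set)" unfolding K_line_def by (simp only: card_image)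
  also have "\<dots> = 64" by (simp add: UNIV_Times_UNIV[symmetric] card_cartesian_product del: UNIV_Times_UNIV)
  finally show ?thesis .
qed

lemma finite_K_line: "finite (K_line x)"
  unfolding K_line_def by simp

text \<open>Inclusion together with equal cardinality takes the place of inverses in
  \<open>K\<close>.\<close>

lemma K_line_cong:
  assumes "a \<in> K_line x" "a \<noteq> 0"
  shows "K_line a = K_line x"
proof -
  have "x \<noteq> 0"
  proof
    assume "x = 0"
    then have "K_line x = {0}" unfolding K_line_eq by (auto simp: funpow_gamma_0)
    then show False using assms by simp
  qed
  then show ?thesis
    using card_subset_eq[OF finite_K_line K_line_subset[OF assms(1)]] card_K_line assms(2) by simp
qed

text \<open>Pigeonhole: a sequence with at most \<open>N\<close> values that reaches all
  \<open>N\<close> nonzero elements of \<open>A\<close> reaches each once per period and never takes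
  the value zero. Full order of the cycle thus follows from covering.\<close>

lemma singer_cover:
  fixes s :: "int \<Rightarrow> vec"
  assumes N: "N > 0" and per: "\<And>i. s i = s (i mod N)"
    and A: "finite A" "int (card A) = N + 1" "0 \<in> A" "A \<subseteq> insert 0 (range s)"
  shows "s i = s j \<longleftrightarrow> i mod N = j mod N" and "s i \<noteq> 0" and "range s = A - {0}"
proof -
  have rng: "range s = s ` {0..<N}"
  proof -
    have "s i \<in> s ` {0..<N}" for i using per[of i] N by (intro image_eqI[of _ _ "i mod N"]) auto
    then show ?thesis by blast
  qed
  have card: "card (A - {0}) = nat N" using A by simp
  have le: "card (s ` {0..<N}) \<le> nat N" using card_image_le[of "{0..<N}" s] by simp
  have "A - {0} \<subseteq> s ` {0..<N}" using A(4) rng by blast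
  then have eq: "A - {0} = s ` {0..<N}" using card le by (intro card_seteq) auto
  then show "range s = A - {0}" using rng by simp
  then show "s i \<noteq> 0" by auto
  have "inj_on s {0..<N}" using card eq by (intro eq_card_imp_inj_on) auto
  then have "s (i mod N) = s (j mod N) \<longleftrightarrow> i mod N = j mod N" using N by (auto simp: inj_on_def)
  then show "s i = s j \<longleftrightarrow> i mod N = j mod N" using per by metis
qed

lemma zech_closed:
  assumes "zech s \<tau>" "(a, b) \<in> set (positions \<tau>)"
  shows "s (m + a) + s (m + b) \<in> range s"
proof -
  obtain p q p' q' r' where \<tau>: "\<tau> = (p, q, p', q', r')" by (cases \<tau>)
  have z: "s m + s (m + p) = s (m + p')" "s m + s (m + q) = s (m + q')" "s (m + p) + s (m + q) = s (m + (p + r'))"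
    using assms(1) unfolding \<tau> by (auto simp: add.assoc)
  have third: "y + x \<in> range s \<and> x + z \<in> range s \<and> z + x \<in> range s \<and> y + z \<in> range s \<and> z + y \<in> range s \<and> x + y \<in> range s"
    if "x + y = z" "x \<in> range s" "y \<in> range s" "z \<in> range s" for x y z :: vec
  proof -
    have "x + z = y" "y + z = x" "y + x = z" "z + x = y" "z + y = x"
      using that(1) by (auto simp: add.commute add.left_commute)
    then show ?thesis using that by simp
  qed
  show ?thesis
    using assms(2) third[OF z(1)] third[OF z(2)] third[OF z(3)] unfolding \<tau> by (auto simp: line_flags_def)
qed

text \<open>The base triangles themselves prove closure under addition: \<open>s i\<close> and
  \<open>s j\<close> lie on a side of a shifted triangle, and the third point of that side is again
  a term of the sequence.\<close>

lemma range_closed_add: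
  assumes "N > 0" "\<And>i. s i = s (i mod N)" "\<And>\<tau>. \<tau> \<in> set B \<Longrightarrow> zech s \<tau>" "(j - i) mod N \<in> set (differences N B)"
  shows "s i + s j \<in> range s"
proof -
  obtain \<tau> a b where t: "\<tau> \<in> set B" "(a, b) \<in> set (positions \<tau>)" "(j - i) mod N = (b - a) mod N"
    using assms(4) unfolding differences_def by auto
  have "(i - a + b) mod N = j mod N"
  proof -
    have "(i + (b - a)) mod N = (i + (j - i)) mod N" using t(3) by (metis mod_add_right_eq)
    then show ?thesis by (simp add: algebra_simps)
  qed
  then have "s (i - a + b) = s j" using assms(2) by metis
  moreover have "s (i - a + a) = s i" by simp
  ultimately show ?thesis using zech_closed[OF assms(3)[OF t(1)] t(2), of "i - a"] by simp
qed

text \<open>Frobenius, \<open>(1 + z)\<^sup>2 = 1 + z\<^sup>2\<close>, in terms of the sequence: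
  adding the identities at \<open>n\<close> and \<open>n + d\<close> cancels
  \<open>s (n + d)\<close>, and the two right-hand sides combine by the identity at
  \<open>n + d'\<close>.\<close>

lemma zech_double: "zech s \<tau> \<Longrightarrow> zech s (scale 2 \<tau>)"
proof -
  assume z: "zech s \<tau>"
  obtain p q p' q' r' where \<tau>: "\<tau> = (p, q, p', q', r')" by (cases \<tau>)
  have double: "\<forall>n. s n + s (n + 2 * d) = s (n + 2 * d')" if d: "\<forall>n. s n + s (n + d) = s (n + d')" for d d'
  proof
    fix n
    have n: "n + 2 * d = n + d + d" "n + 2 * d' = n + d' + d'" "n + d + d' = n + d' + d" by simp_all
    have "s n + s (n + 2 * d) = (s n + s (n + d)) + (s (n + d) + s (n + d + d))"
      unfolding n(1) by (simp only: add.assoc vec_add_self_left)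
    also have "\<dots> = s (n + d') + s (n + d' + d)"
      using d n(3) by presburger
    also have "\<dots> = s (n + 2 * d')" using d n(2) by presburger
    finally show "s n + s (n + 2 * d) = s (n + 2 * d')" .
  qed
  have "\<forall>n. s n + s (n + (q - p)) = s (n + r')"
  proof
    fix n
    have "s (n - p + p) + s (n - p + q) = s (n - p + p + r')" using z unfolding \<tau> by (simp only: zech.simps)
    then show "s n + s (n + (q - p)) = s (n + r')" by (simp add: algebra_simps)
  qed
  then have *: "\<forall>n. s n + s (n + 2 * (q - p)) = s (n + 2 * r')" by (rule double)
  have "\<forall>n. s (n + 2 * p) + s (n + 2 * q) = s (n + 2 * p + 2 * r')"
  proof (intro allI)
    fix n
    have "n + 2 * p + 2 * (q - p) = n + 2 * q" by simp
    then show "s (n + 2 * p) + s (n + 2 * q) = s (n + 2 * p + 2 * r')"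
      using spec[OF *, of "n + 2 * p"] by simp
  qed
  then show ?thesis using z double unfolding \<tau> by simp
qed

lemma scale_scale: "scale c (scale d \<tau>) = scale (c * d) \<tau>" and scale_1: "scale 1 \<tau> = \<tau>"
  by (cases \<tau>; simp add: mult.assoc)+

lemma zech_scale: "zech s \<tau> \<Longrightarrow> zech s (scale (2 ^ k) \<tau>)"
proof (induction k)
  case 0
  then show ?case by (simp add: scale_1)
next
  case (Suc k)
  then show ?case using zech_double[of s "scale (2 ^ k) \<tau>"] by (simp add: scale_scale)
qed

section \<open>Planes over the field with 64 elements\<close>

definition span2 :: "vec \<Rightarrow> vec \<Rightarrow> vec set" where
  "span2 x y = (\<lambda>(a, b). a + b) ` (K_line x \<times> K_line y)"

lemma span2_memI: "a \<in> K_line x \<Longrightarrow> b \<in> K_line y \<Longrightarrow> a + b \<in> span2 x y"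
  unfolding span2_def by force

lemma span2_memE:
  assumes "z \<in> span2 x y" obtains a b where "a \<in> K_line x" "b \<in> K_line y" "z = a + b"
  using assms unfolding span2_def by auto

lemma span2_add:
  assumes "z \<in> span2 x y" "w \<in> span2 x y"
  shows "z + w \<in> span2 x y"
proof -
  obtain a b c d where "a \<in> K_line x" "b \<in> K_line y" "z = a + b" "c \<in> K_line x" "d \<in> K_line y" "w = c + d"
    using assms by (elim span2_memE) blast
  then have "z + w = (a + c) + (b + d)" "a + c \<in> K_line x" "b + d \<in> K_line y"
    using K_line_add by (auto simp: add_ac)
  then show ?thesis using span2_memI by simp
qed

lemma span2_0: "0 \<in> span2 x y"
  using span2_memI[OF K_line_0 K_line_0] by simp

lemma span2_left: "K_line x \<subseteq> span2 x y" and span2_right: "K_line y \<subseteq> span2 x y"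
  using span2_memI[OF _ K_line_0] span2_memI[OF K_line_0] by fastforce+

lemma span2_K_line:
  assumes "z \<in> span2 x y"
  shows "K_line z \<subseteq> span2 x y"
proof -
  obtain a b where ab: "a \<in> K_line x" "b \<in> K_line y" "z = a + b" using assms by (rule span2_memE)
  have "(gamma ^^ i) z \<in> span2 x y" for i
    unfolding ab(3) funpow_gamma_add by (intro span2_memI K_line_funpow ab)
  then show ?thesis unfolding K_line_eq using span2_0 by auto
qed

lemma finite_span2: "finite (span2 x y)"
  unfolding span2_def by (simp add: finite_K_line)

lemma card_span2:
  assumes x: "x \<noteq> 0" and y: "y \<notin> K_line x"
  shows "card (span2 x y) = 4096"
proof -
  have y0: "y \<noteq> 0" using y K_line_0 by metis
  have int: "c = 0" if "c \<in> K_line x" "c \<in> K_line y" for c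
  proof (rule ccontr)
    assume "c \<noteq> 0"
    then have "K_line y = K_line x" using K_line_cong that by metis
    then show False using y K_line_self by blast
  qed
  have "inj_on (\<lambda>(a, b). a + b) (K_line x \<times> K_line y)"
  proof (rule inj_onI, clarify)
    fix a b c d assume *: "a \<in> K_line x" "b \<in> K_line y" "c \<in> K_line x" "d \<in> K_line y" "a + b = c + d"
    have "a + c = b + d"
    proof -
      have "a + c = (a + b) + (b + c)" by (simp add: add_ac)
      also have "\<dots> = b + d" unfolding *(5) by (simp add: add_ac)
      finally show ?thesis .
    qed
    then have "a + c = 0" using int K_line_add *(1-4) by metis
    then show "a = c \<and> b = d" using *(5) by simp
  qed
  then have "card (span2 x y) = card (K_line x \<times> K_line y)" unfolding span2_def by (rule card_image)
  then show ?thesis using card_K_line[OF x] card_K_line[OF y0] by (simp add: card_cartesian_product)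
qed

text \<open>Both sides have 4096 elements, so inclusion suffices. This makes the K-plane through a
  K-independent pair unique.\<close>

lemma span2_cong:
  assumes x: "x \<noteq> 0" and y: "y \<notin> K_line x" and uv: "u \<in> span2 x y" "v \<in> span2 x y" "u \<noteq> 0" "v \<notin> K_line u"
  shows "span2 u v = span2 x y"
proof (rule card_subset_eq[OF finite_span2])
  show "span2 u v \<subseteq> span2 x y"
  proof
    fix z assume "z \<in> span2 u v"
    then obtain a b where "a \<in> K_line u" "b \<in> K_line v" "z = a + b" by (rule span2_memE)
    then show "z \<in> span2 x y" using span2_K_line[OF uv(1)] span2_K_line[OF uv(2)] span2_add by blast
  qed
  show "card (span2 u v) = card (span2 x y)" by (simp add: card_span2 x y uv)
qed

definition independent_pairs :: "vec set \<Rightarrow> (vec \<times> vec) set" where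
  "independent_pairs S = {(u, v). u \<in> S \<and> v \<in> S \<and> u \<noteq> 0 \<and> v \<notin> K_line u}"

text \<open>Any K-independent pair can play the roles of 1 and \<open>h\<close>; the sequence then
  enumerates the nonzero vectors of the plane they span.\<close>

fun vseq :: "vec \<Rightarrow> vec \<Rightarrow> nat \<Rightarrow> vec" where
  "vseq x y 0 = x"
| "vseq x y (Suc 0) = y"
| "vseq x y (Suc (Suc n)) = vseq x y (Suc n) + gamma (vseq x y n)"

interpretation vseq: singer_sequence "vseq x y"
  by unfold_locales simp

text \<open>Prepares the extension of a periodic sequence to integer indices, on which positions can
  be subtracted.\<close>

lemma int_periodic_add:
  fixes v :: "nat \<Rightarrow> 'a" and N :: nat
  assumes N: "N > 0" and per: "\<And>n. v (n + N) = v n"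
  defines "s \<equiv> \<lambda>i. v (nat (i mod int N))"
  shows "s (i + int k) = v (nat (i mod int N) + k)"
proof -
  have mult: "v (n + N * q) = v n" for n q
    by (induction q) (simp_all add: per add.assoc[symmetric] add.left_commute, metis add.assoc add.commute per)
  have mod: "v (n mod N) = v n" for n
    using mult[of "n mod N" "n div N"] by (simp add: add.commute)
  have "nat ((i + int k) mod int N) = (nat (i mod int N) + k) mod N"
  proof -
    have "int ((nat (i mod int N) + k) mod N) = (i mod int N + int k) mod int N"
      using N by (simp add: zmod_int)
    also have "\<dots> = (i + int k) mod int N" by (simp add: mod_add_left_eq)
    finally show ?thesis by linarith
  qed
  then show ?thesis unfolding s_def using mod by simp
qed

lemma vseq_65: "vseq x y (n + 65 * j) = (gamma ^^ j) (vseq x y n)"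
proof (induction j)
  case (Suc j)
  have "n + 65 * Suc j = n + 65 * j + 65" by simp
  then show ?case using vseq.v_65[of x y "n + 65 * j"] Suc by (simp only: funpow.simps comp_apply)
qed simp

lemma vseq_period: "vseq x y (n + 4095) = vseq x y n"
  using vseq_65[of x y n 63] gamma_63 by simp

text \<open>Since \<open>h\<close> to the power 65 acts as \<open>gamma\<close>, two terms are
  K-dependent exactly when their index difference is a multiple of 65. The pairs decomposed by the
  difference family are therefore the K-independent ones.\<close>

lemma decomposes_span2:
  assumes x: "x \<noteq> 0" and y: "y \<notin> K_line x"
  shows "\<exists>Tr. decomposes Tr (independent_pairs (span2 x y))"
proof -
  define s where "s = (\<lambda>i. vseq x y (nat (i mod int 4095)))"
  have s_add: "s (i + int k) = vseq x y (nat (i mod int 4095) + k)" for i k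
    unfolding s_def by (rule int_periodic_add) (simp_all add: vseq_period)
  have s_vseq: "s i = vseq x y (nat (i mod int 4095))" for i by (simp add: s_def)
  have per: "s i = s (i mod 4095)" for i unfolding s_def by simp
  have s_65: "s (i + 65 * int j) = (gamma ^^ j) (s i)" for i j
    using s_add[of i "65 * j"] vseq_65 s_vseq by simp
  have zech1: "zech s \<tau>" if "in_range \<tau>" "seed_zech \<tau>" for \<tau>
  proof -
    obtain p q p' q' r' where \<tau>: "\<tau> = (p, q, p', q', r')" by (cases \<tau>)
    have rng: "0 \<le> p" "p < 4095" "0 \<le> q" "q < 4095" "0 \<le> p'" "p' < 4095" "0 \<le> q'" "q' < 4095"
      "0 \<le> r'" "r' < 4095" using that(1) unfolding \<tau> by auto
    have z: "s n + s (n + d) = s (n + d')"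
      if "zech_pair d d'" "0 \<le> d" "d < 4095" "0 \<le> d'" "d' < 4095" for n d d'
    proof -
      have "s (n + d) = vseq x y (nat (n mod int 4095) + nat d)" "s (n + d') = vseq x y (nat (n mod int 4095) + nat d')"
        using s_add[of n "nat d"] s_add[of n "nat d'"] that by simp_all
      then show ?thesis using vseq.v_zech[OF that, of x y "nat (n mod int 4095)"] s_vseq[of n] by simp
    qed
    define r where "r = (if q < p then q - p + 4095 else q - p)"
    have r: "0 \<le> r" "r < 4095" using rng by (auto simp: r_def)
    have "s (n + p) + s (n + q) = s (n + p + r')" for n
    proof -
      have "s (n + p) + s (n + p + r) = s (n + p + r')"
        using that(2) z[OF _ r rng(9,10)] unfolding \<tau> by (simp add: r_def)
      moreover have "s (n + p + r) = s (n + q)"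
      proof (cases "q < p")
        case True
        then have *: "n + p + r = n + q + 4095" unfolding r_def by simp
        show ?thesis unfolding * using per[of "n + q + 4095"] per[of "n + q"] by simp
      qed (simp add: r_def)
      ultimately show ?thesis by simp
    qed
    then show ?thesis using that(2) z rng unfolding \<tau> by simp
  qed
  have zech: "zech s \<tau>" if "\<tau> \<in> set blocks" for \<tau>
  proof -
    obtain u where "u \<in> set seeds" "\<tau> \<in> set (copies u)"
      using \<open>\<tau> \<in> set blocks\<close> unfolding blocks_def set_concat set_map by blast
    then obtain k where u: "u \<in> set seeds" "\<tau> = scale (8 ^ k) (snd u)"
      unfolding copies_def set_map by blast
    have "zech s (snd u)"
      using zech1 range_seeds zech_seeds u(1) unfolding list_all_iff by blast
    then have "zech s (scale (2 ^ (3 * k)) (snd u))" by (rule zech_scale)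
    then show ?thesis unfolding u(2) by (simp add: power_mult)
  qed
  have mult65: "s j \<in> K_line (s i)" if "65 dvd (j - i) mod 4095" for i j
  proof -
    obtain l where l: "(j - i) mod 4095 = 65 * l" using \<open>65 dvd (j - i) mod 4095\<close> by (rule dvdE)
    have "0 \<le> (j - i) mod 4095" by simp
    then have "l \<ge> 0" unfolding l by simp
    then have "s (i + (j - i) mod 4095) = (gamma ^^ nat l) (s i)"
      unfolding l using s_65[of i "nat l"] by simp
    moreover have "s (i + (j - i) mod 4095) = s j"
      using per[of "i + (j - i) mod 4095"] per[of j] by (simp add: mod_add_right_eq)
    ultimately show ?thesis using K_line_funpow[OF K_line_self, of "nat l" "s i"] by (simp only:)
  qed
  have kset_range: "K_line (s i) \<subseteq> insert 0 (range s)" for i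
    using s_65[of i] unfolding K_line_eq by (auto simp: s_65[symmetric])
  \<comment> \<open>Differences divisible by 65 stay within one K-line; all others occur in a base
    triangle.\<close>
  have closed: "s i + s j \<in> insert 0 (range s)" for i j
  proof (cases "65 dvd (j - i) mod 4095")
    case True
    then have "s i + s j \<in> K_line (s i)" using mult65 K_line_add K_line_self by blast
    then show ?thesis using kset_range by blast
  next
    case False
    then have "(j - i) mod 4095 \<in> set (differences 4095 blocks)" unfolding blocks_differences by simp
    then have "s i + s j \<in> range s" using range_closed_add[of 4095 s blocks] per zech by auto
    then show ?thesis by simp
  qed
  have s0: "s 0 = x" "s 1 = y" unfolding s_def by simp_all
  have sub: "span2 x y \<subseteq> insert 0 (range s)"
  proof
    fix z assume "z \<in> span2 x y"
    then obtain a b where ab: "a \<in> K_line x" "b \<in> K_line y" "z = a + b" by (rule span2_memE)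
    then have "a \<in> insert 0 (range s)" "b \<in> insert 0 (range s)" using kset_range[of 0] kset_range[of 1] s0 by auto
    then show "z \<in> insert 0 (range s)" using closed unfolding ab(3) by auto
  qed
  have N0: "(0 :: int) < 4095" by simp
  \<comment> \<open>Exactly one element more than the period, as the pigeonhole argument of
    \<open>singer_cover\<close> requires.\<close>
  have c: "int (card (span2 x y)) = 4095 + 1" using card_span2[OF x y] by simp
  note cover = singer_cover[OF N0 per finite_span2 c span2_0 sub]
  have "0 \<notin> set (differences 4095 blocks)" unfolding blocks_differences by simp
  then have g: "decomposes {shifted s n \<tau> | n \<tau>. \<tau> \<in> set blocks}
      {(s i, s j) | i j. (j - i) mod 4095 \<in> set (differences 4095 blocks)}"
    by (intro decomposes_singer) (use cover zech blocks_differences(1) in auto)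
  have kset_iff: "s j \<in> K_line (s i) \<longleftrightarrow> 65 dvd (j - i) mod 4095" for i j
  proof
    assume "s j \<in> K_line (s i)"
    then obtain l where "s j = (gamma ^^ l) (s i)" using cover(2)[of j] unfolding K_line_eq by auto
    then have "s j = s (i + 65 * int l)" using s_65 by simp
    then have "j mod 4095 = (i + 65 * int l) mod 4095" by (simp add: cover(1))
    then have "(j - i) mod 4095 = (i + 65 * int l - i) mod 4095" by (metis mod_diff_left_eq)
    then show "65 dvd (j - i) mod 4095" by (simp add: dvd_mod_iff)
  qed (rule mult65)
  have "{(s i, s j) | i j. (j - i) mod 4095 \<in> set (differences 4095 blocks)} = independent_pairs (span2 x y)"
  proof (intro set_eqI iffI)
    fix p assume "p \<in> {(s i, s j) | i j. (j - i) mod 4095 \<in> set (differences 4095 blocks)}"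
    then obtain i j where ij: "p = (s i, s j)" "\<not> 65 dvd (j - i) mod 4095"
      unfolding blocks_differences by blast
    have "s i \<in> span2 x y" "s j \<in> span2 x y" using cover(3) by blast+
    then show "p \<in> independent_pairs (span2 x y)"
      using ij kset_iff cover(2) unfolding independent_pairs_def by simp
  next
    fix p assume "p \<in> independent_pairs (span2 x y)"
    then obtain u v where p: "p = (u, v)" "u \<in> span2 x y" "v \<in> span2 x y" "u \<noteq> 0" "v \<notin> K_line u"
      unfolding independent_pairs_def by blast
    then have "v \<noteq> 0" using K_line_0 by metis
    then obtain i j where ij: "u = s i" "v = s j" using p cover(3) by (metis DiffI empty_iff insertE rangeE)
    then have "(j - i) mod 4095 \<in> set (differences 4095 blocks)"
      using p(5) kset_iff unfolding blocks_differences by simp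
    then show "p \<in> {(s i, s j) | i j. (j - i) mod 4095 \<in> set (differences 4095 blocks)}"
      unfolding p(1) ij by blast
  qed
  then show ?thesis using g by auto
qed

section \<open>Seven-dimensional spaces\<close>

text \<open>Coefficients of polynomials in an element \<open>t\<close> with \<open>t\<^sup>7 = t + 1\<close>.\<close>

type_synonym seven = "bool \<times> bool \<times> bool \<times> bool \<times> bool \<times> bool \<times> bool"

fun step7 :: "seven \<Rightarrow> seven" where
  "step7 (a0, a1, a2, a3, a4, a5, a6) = (a6, xor a0 a6, a1, a2, a3, a4, a5)"

definition one7 :: seven where "one7 = (True, False, False, False, False, False, False)"

fun plus_one7 :: "seven \<Rightarrow> seven" where
  "plus_one7 (a0, as) = (\<not> a0, as)"

text \<open>Zech logarithms for the base triangle with vertices at 0, 1 and 10: those of 10 and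
  \<open>9 = 10 - 1\<close> are computed, and that of 1 is 7 by the relation
  \<open>t\<^sup>7 = t + 1\<close>.\<close>

lemma step7_powers:
  "plus_one7 ((step7 ^^ 10) one7) = (step7 ^^ 108) one7"
  "plus_one7 ((step7 ^^ 9) one7) = (step7 ^^ 90) one7"
  "(step7 ^^ 127) one7 = one7"
proof -
  have "plus_one7 (foldl (\<lambda>s _. step7 s) one7 [1..10]) = foldl (\<lambda>s _. step7 s) one7 [1..108]"
    "plus_one7 (foldl (\<lambda>s _. step7 s) one7 [1..9]) = foldl (\<lambda>s _. step7 s) one7 [1..90]"
    "foldl (\<lambda>s _. step7 s) one7 [1..127] = one7"
    by code_simp+
  then show "plus_one7 ((step7 ^^ 10) one7) = (step7 ^^ 108) one7"
    "plus_one7 ((step7 ^^ 9) one7) = (step7 ^^ 90) one7"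
    "(step7 ^^ 127) one7 = one7"
    unfolding foldl_funpow by simp_all
qed

text \<open>The Frobenius images of a single base triangle. The order of 2 modulo 127 is 7, and
  \<open>7 * 18\<close> is the number of nonzero residues.\<close>

definition blocks7 :: "base list" where
  "blocks7 = map (\<lambda>k. scale (2 ^ k) (1, 10, 7, 108, 90)) [0..<7]"

lemma blocks7_differences:
  shows "distinct (differences 127 blocks7)" and "set (differences 127 blocks7) = {1..126}"
proof -
  have b: "blocks7 = [(1, 10, 7, 108, 90), (2, 20, 14, 216, 180), (4, 40, 28, 432, 360), (8, 80, 56, 864, 720),
      (16, 160, 112, 1728, 1440), (32, 320, 224, 3456, 2880), (64, 640, 448, 6912, 5760)]"
    unfolding blocks7_def by (simp add: eval_nat_numeral)
  show "distinct (differences 127 blocks7)"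
    unfolding b by (simp add: differences_def line_flags_def)
  moreover have "length (differences 127 blocks7) = 126"
    unfolding length_differences by (simp add: b)
  ultimately have "card (set (differences 127 blocks7)) = 126" by (simp only: distinct_card)
  moreover have "set (differences 127 blocks7) \<subseteq> {1..126}"
    unfolding b by (simp add: differences_def line_flags_def)
  ultimately show "set (differences 127 blocks7) = {1..126}"
    by (intro card_subset_eq) simp_all
qed

text \<open>Any basis of the seven-dimensional space may start the recurrence for
  \<open>t\<^sup>7 = t + 1\<close>; a basis of the K-line followed by \<open>e\<close> is chosen.
  From there on \<open>gamma\<close> plays no part, and the cycle of length 127 is independent of
  \<open>K\<close>.\<close>

fun wseq :: "vec \<Rightarrow> vec \<Rightarrow> nat \<Rightarrow> vec" where
  "wseq x e n = (if n < 6 then (gamma ^^ n) x else if n = 6 then e else wseq x e (n - 7) + wseq x e (n - 6))"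

declare wseq.simps [simp del]

lemma wseq_rec: "wseq x e (n + 7) = wseq x e n + wseq x e (n + 1)"
  by (subst wseq.simps) simp

fun eval7 :: "vec \<Rightarrow> vec \<Rightarrow> seven \<Rightarrow> nat \<Rightarrow> vec" where
  "eval7 x e (a0, a1, a2, a3, a4, a5, a6) n = select a0 (wseq x e n) + select a1 (wseq x e (n + 1)) +
     select a2 (wseq x e (n + 2)) + select a3 (wseq x e (n + 3)) + select a4 (wseq x e (n + 4)) +
     select a5 (wseq x e (n + 5)) + select a6 (wseq x e (n + 6))"

lemma eval7_step: "eval7 x e (step7 st) n = eval7 x e st (n + 1)"
proof -
  obtain a0 a1 a2 a3 a4 a5 a6 where st: "st = (a0, a1, a2, a3, a4, a5, a6)" by (cases st) auto
  have "n + 1 + 1 = n + 2" "n + 1 + 2 = n + 3" "n + 1 + 3 = n + 4" "n + 1 + 4 = n + 5" "n + 1 + 5 = n + 6"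
    "n + 1 + 6 = n + 7" by simp_all
  then show ?thesis unfolding st eval7.simps step7.simps
    by (simp only: select_xor select_add wseq_rec add.assoc add.commute add.left_commute)
qed

lemma eval7_power: "eval7 x e ((step7 ^^ i) one7) n = wseq x e (n + i)"
proof (induction i arbitrary: n)
  case 0
  show ?case by (simp add: one7_def)
next
  case (Suc i)
  show ?case using Suc[of "n + 1"] by (simp add: eval7_step)
qed

lemma eval7_plus_one: "eval7 x e (plus_one7 st) n = wseq x e n + eval7 x e st n"
proof -
  obtain a0 a1 a2 a3 a4 a5 a6 where "st = (a0, a1, a2, a3, a4, a5, a6)" by (cases st) auto
  then show ?thesis by (cases a0) (simp_all add: add.assoc)
qed

lemma wseq_zech:
  "wseq x e n + wseq x e (n + 10) = wseq x e (n + 108)"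
  "wseq x e n + wseq x e (n + 9) = wseq x e (n + 90)"
  "wseq x e (n + 127) = wseq x e n"
proof -
  have "wseq x e n + eval7 x e ((step7 ^^ 10) one7) n = eval7 x e ((step7 ^^ 108) one7) n"
    "wseq x e n + eval7 x e ((step7 ^^ 9) one7) n = eval7 x e ((step7 ^^ 90) one7) n"
    by (simp_all only: step7_powers(1,2)[symmetric] eval7_plus_one)
  then show "wseq x e n + wseq x e (n + 10) = wseq x e (n + 108)"
    "wseq x e n + wseq x e (n + 9) = wseq x e (n + 90)"
    by (simp_all only: eval7_power)
  show "wseq x e (n + 127) = wseq x e n"
    using eval7_power[of x e 127 n] eval7_power[of x e 0 n] unfolding step7_powers by simp
qed

definition cone :: "vec \<Rightarrow> vec set \<Rightarrow> vec set" where
  "cone e S = {lift_point e \<epsilon> z | \<epsilon> z. z \<in> S}"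

lemma cone_eq: "cone e S = S \<union> (\<lambda>z. z + e) ` S"
  unfolding cone_def lift_point_def by (auto split: if_splits)

text \<open>All nonzero residues modulo 127 occur as differences, so the family decomposes every
  pair of distinct nonzero vectors once the cycle is known to enumerate the space.\<close>

lemma decomposes_cone:
  assumes x: "x \<noteq> 0" and e: "e \<notin> K_line x"
  shows "\<exists>Tr. decomposes Tr (distinct_pairs (cone e (K_line x)))"
proof -
  define s where "s = (\<lambda>i. wseq x e (nat (i mod int 127)))"
  have s_add: "s (i + int k) = wseq x e (nat (i mod int 127) + k)" for i k
    unfolding s_def by (rule int_periodic_add) (simp_all add: wseq_zech)
  have s_wseq: "s i = wseq x e (nat (i mod int 127))" for i by (simp add: s_def)
  have per: "s i = s (i mod 127)" for i unfolding s_def by simp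
  have "zech s (1, 10, 7, 108, 90)"
  proof -
    have "s n + s (n + 1) = s (n + 7)" for n
      using s_add[of n 1] s_add[of n 7] wseq_rec s_wseq[of n] by simp
    moreover have "s n + s (n + 10) = s (n + 108)" for n
      using s_add[of n 10] s_add[of n 108] wseq_zech(1) s_wseq[of n] by simp
    moreover have "s (n + 1) + s (n + 10) = s (n + 1 + 90)" for n
    proof -
      have "s m + s (m + 9) = s (m + 90)" for m
        using s_add[of m 9] s_add[of m 90] wseq_zech(2) s_wseq[of m] by simp
      moreover have "n + 1 + 9 = n + 10" by simp
      ultimately show ?thesis by metis
    qed
    ultimately show ?thesis by simp
  qed
  then have zech: "zech s \<tau>" if "\<tau> \<in> set blocks7" for \<tau>
    using that zech_scale unfolding blocks7_def by (auto simp del: zech.simps scale.simps)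
  have closed: "a + b \<in> insert 0 (range s)" if ab: "a \<in> insert 0 (range s)" "b \<in> insert 0 (range s)" for a b
  proof (cases "a = 0 \<or> b = 0 \<or> a = b")
    case False
    then obtain i j where ij: "a = s i" "b = s j" using ab by auto
    have "(j - i) mod 127 \<noteq> 0"
    proof
      assume "(j - i) mod 127 = 0"
      then have "j mod 127 = i mod 127" by (simp add: mod_eq_dvd_iff mod_eq_0_iff_dvd)
      then show False using per[of i] per[of j] ij False by simp
    qed
    moreover have "0 \<le> (j - i) mod 127" "(j - i) mod 127 < 127" by simp_all
    ultimately have "(j - i) mod 127 \<in> set (differences 127 blocks7)"
      unfolding blocks7_differences atLeastAtMost_iff by linarith
    then have "s i + s j \<in> range s" using range_closed_add[of 127 s blocks7] per zech by auto
    then show ?thesis using ij by simp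
  qed (use ab in auto)
  \<comment> \<open>The first seven terms span the space, so closure under addition makes the
    sequence reach all of it.\<close>
  have gen: "(gamma ^^ i) x \<in> range s" if "i < 6" for i
  proof -
    have "s (int i) = wseq x e i" using that unfolding s_def by simp
    then have "s (int i) = (gamma ^^ i) x" using that by (simp add: wseq.simps)
    then show ?thesis by (metis rangeI)
  qed
  have e_mem: "e \<in> range s"
  proof -
    have "s 6 = e" unfolding s_def by (simp add: wseq.simps)
    then show ?thesis by blast
  qed
  have sc_mem: "select a z \<in> insert 0 (range s)" if "z \<in> range s" for a z
    using that by (cases a) auto
  have ksub: "K_line x \<subseteq> insert 0 (range s)"
  proof
    fix z assume "z \<in> K_line x"
    then obtain a0 a1 a2 a3 a4 a5 where z: "z = eval6 x (a0, a1, a2, a3, a4, a5)" unfolding K_line_def by auto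
    have "x \<in> range s" "gamma x \<in> range s" "gamma (gamma x) \<in> range s" "gamma (gamma (gamma x)) \<in> range s"
      "gamma (gamma (gamma (gamma x))) \<in> range s" "gamma (gamma (gamma (gamma (gamma x)))) \<in> range s"
      using gen[of 0] gen[of 1] gen[of 2] gen[of 3] gen[of 4] gen[of 5]
      by (simp_all add: eval_nat_numeral)
    then show "z \<in> insert 0 (range s)" unfolding z eval6.simps by (intro closed sc_mem)
  qed
  have sub: "cone e (K_line x) \<subseteq> insert 0 (range s)"
    unfolding cone_eq using ksub closed[OF _ insertI2[OF e_mem]] by blast
  have card: "card (cone e (K_line x)) = 128"
  proof -
    have "K_line x \<inter> (\<lambda>z. z + e) ` K_line x = {}"
    proof (rule ccontr)
      assume "K_line x \<inter> (\<lambda>z. z + e) ` K_line x \<noteq> {}"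
      then obtain z where "z \<in> K_line x" "z + e \<in> K_line x" by blast
      then have "z + (z + e) \<in> K_line x" by (rule K_line_add)
      then show False using e by simp
    qed
    then have "card (cone e (K_line x)) = card (K_line x) + card ((\<lambda>z. z + e) ` K_line x)"
      unfolding cone_eq using finite_K_line by (intro card_Un_disjoint) auto
    then show ?thesis using card_K_line[OF x] by (simp add: card_image)
  qed
  have N0: "(0 :: int) < 127" by simp
  have fin: "finite (cone e (K_line x))" unfolding cone_eq using finite_K_line by simp
  have c: "int (card (cone e (K_line x))) = 127 + 1" using card by simp
  have "0 \<in> cone e (K_line x)" unfolding cone_eq using K_line_0 by simp
  note cover = singer_cover[OF N0 per fin c this sub]
  have "0 \<notin> set (differences 127 blocks7)" unfolding blocks7_differences by simp
  then have g: "decomposes {shifted s n \<tau> | n \<tau>. \<tau> \<in> set blocks7}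
      {(s i, s j) | i j. (j - i) mod 127 \<in> set (differences 127 blocks7)}"
    by (intro decomposes_singer) (use cover zech blocks7_differences(1) in auto)
  have diff: "(j - i) mod 127 \<in> set (differences 127 blocks7) \<longleftrightarrow> s i \<noteq> s j" for i j
  proof -
    have "0 \<le> (j - i) mod 127" "(j - i) mod 127 < 127" by simp_all
    then have "(j - i) mod 127 \<in> set (differences 127 blocks7) \<longleftrightarrow> (j - i) mod 127 \<noteq> 0"
      unfolding blocks7_differences atLeastAtMost_iff by linarith
    also have "\<dots> \<longleftrightarrow> j mod 127 \<noteq> i mod 127" by (simp add: mod_eq_dvd_iff mod_eq_0_iff_dvd)
    finally show ?thesis using cover(1)[of i j] by auto
  qed
  have "{(s i, s j) | i j. (j - i) mod 127 \<in> set (differences 127 blocks7)} = distinct_pairs (cone e (K_line x))"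
  proof (intro set_eqI iffI)
    fix p assume "p \<in> {(s i, s j) | i j. (j - i) mod 127 \<in> set (differences 127 blocks7)}"
    then obtain i j where ij: "p = (s i, s j)" "s i \<noteq> s j" unfolding diff by blast
    have "s i \<in> cone e (K_line x)" "s j \<in> cone e (K_line x)" using cover(3) by blast+
    then show "p \<in> distinct_pairs (cone e (K_line x))"
      using ij cover(2) unfolding distinct_pairs_def by simp
  next
    fix p assume "p \<in> distinct_pairs (cone e (K_line x))"
    then obtain u v where p: "p = (u, v)" "u \<in> cone e (K_line x) - {0}" "v \<in> cone e (K_line x) - {0}" "u \<noteq> v"
      unfolding distinct_pairs_def by blast
    then obtain i j where "u = s i" "v = s j" unfolding cover(3)[symmetric] by blast
    then show "p \<in> {(s i, s j) | i j. (j - i) mod 127 \<in> set (differences 127 blocks7)}"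
      unfolding p(1) diff using p(4) by blast
  qed
  then show ?thesis using g by auto
qed

section \<open>Existence of balanced designs and the condition on the dimension\<close>

lemma tuples_Suc: "tuples (Suc n) = tuples n \<union> (\<lambda>x. x + unit_seq n) ` (tuples n :: vec set)"
proof (intro set_eqI iffI)
  fix x :: vec assume "x \<in> tuples (Suc n)"
  then have "\<exists>k. x - seq_scale k (unit_seq n) \<in> tuples n" unfolding tuples_Suc_decomp .
  then have "x \<in> tuples n \<or> x - unit_seq n \<in> tuples n" unfolding ex_bit by simp
  then show "x \<in> tuples n \<union> (\<lambda>x. x + unit_seq n) ` tuples n"
    by (metis UnCI diff_add_cancel imageI)
next
  fix x :: vec assume "x \<in> tuples n \<union> (\<lambda>x. x + unit_seq n) ` tuples n"
  then show "x \<in> tuples (Suc n)"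
    by (auto simp: tuples_def unit_seq_def)
qed

lemma unit_seq_notin: "(unit_seq n :: vec) \<notin> tuples n"
  by (auto simp: tuples_def unit_seq_def)

lemma tuples_add: "x \<in> tuples n \<Longrightarrow> y \<in> tuples n \<Longrightarrow> x + y \<in> (tuples n :: vec set)"
  by (auto simp: tuples_def)

lemma card_tuples: "finite (tuples n :: vec set) \<and> card (tuples n :: vec set) = 2 ^ n"
proof (induction n)
  case 0
  have "tuples 0 = {0 :: vec}" by (auto simp: tuples_def)
  then show ?case by simp
next
  case (Suc n)
  have "tuples n \<inter> (\<lambda>x. x + unit_seq n) ` (tuples n :: vec set) = {}"
  proof (rule ccontr)
    assume "tuples n \<inter> (\<lambda>x. x + unit_seq n) ` (tuples n :: vec set) \<noteq> {}"
    then obtain x :: vec where "x \<in> tuples n" "x + unit_seq n \<in> tuples n" by blast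
    then have "x + (x + unit_seq n) \<in> tuples n" by (rule tuples_add)
    then show False using unit_seq_notin by simp
  qed
  then have "card (tuples (Suc n) :: vec set) = card (tuples n :: vec set) + card ((\<lambda>x. x + unit_seq n) ` (tuples n :: vec set))"
    unfolding tuples_Suc using Suc by (intro card_Un_disjoint) auto
  also have "card ((\<lambda>x. x + unit_seq n) ` (tuples n :: vec set)) = card (tuples n :: vec set)"
    by (intro card_image) (simp add: inj_on_def)
  finally show ?case using Suc unfolding tuples_Suc by simp
qed

lemma K_line_tuples: "x \<in> tuples (6 * k) \<Longrightarrow> K_line x \<subseteq> tuples (6 * k)"
proof -
  assume x: "x \<in> tuples (6 * k)"
  have "(gamma ^^ i) x \<in> tuples (6 * k)" for i by (induction i) (simp_all add: x gamma_tuples)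
  moreover have "0 \<in> (tuples (6 * k) :: vec set)" by (simp add: tuples_def)
  ultimately show ?thesis unfolding K_line_eq by auto
qed

lemma decomposes_Un:
  assumes "decomposes T1 R1" "decomposes T2 R2" "R1 \<inter> R2 = {}"
  shows "decomposes (T1 \<union> T2) (R1 \<union> R2)"
proof -
  have "decomposes (\<Union>b\<in>UNIV. if b then T1 else T2) (\<Union>b\<in>UNIV. if b then R1 else R2)"
    by (rule decomposes_Union) (use assms in \<open>auto split: if_splits\<close>)
  moreover have "(\<Union>b\<in>UNIV. if b then T1 else T2) = T1 \<union> T2" "(\<Union>b\<in>UNIV. if b then R1 else R2) = R1 \<union> R2"
    by (auto simp: UNIV_bool)
  ultimately show ?thesis by (simp only:)
qed

lemma balanced_design_exists: "\<exists>\<T>. seq.balanced_triangle_design (tuples (6 * k + 1) :: vec set) \<T>"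
proof -
  define X where "X = (tuples (6 * k) :: vec set)"
  define e where "e = (unit_seq (6 * k) :: vec)"
  have X_add: "x + y \<in> X" if "x \<in> X" "y \<in> X" for x y using tuples_add that unfolding X_def by blast
  have e: "e \<notin> X" unfolding X_def e_def by (rule unit_seq_notin)
  have finX: "finite X" unfolding X_def using card_tuples by blast
  have X0: "0 \<in> X" unfolding X_def by (simp add: tuples_def)
  have kX: "K_line x \<subseteq> X" if "x \<in> X" for x using K_line_tuples that unfolding X_def by blast
  have V: "tuples (6 * k + 1) = cone e X"
    using tuples_Suc[of "6 * k"] unfolding cone_eq X_def e_def by simp

  \<comment> \<open>A set of planes, not of spanning pairs, so that a plane receives one
    decomposition however it is spanned.\<close>
  define \<S> where "\<S> = {span2 x y | x y. x \<in> X \<and> y \<in> X \<and> x \<noteq> 0 \<and> y \<notin> K_line x}"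
  have SX: "S \<subseteq> X" if S: "S \<in> \<S>" for S
  proof
    fix z assume z: "z \<in> S"
    obtain x y where xy: "S = span2 x y" "x \<in> X" "y \<in> X" using S unfolding \<S>_def by blast
    obtain a b where "a \<in> K_line x" "b \<in> K_line y" "z = a + b" using z unfolding xy(1) by (rule span2_memE)
    then show "z \<in> X" using kX xy X_add by blast
  qed
  have "finite \<S>" using SX finX by (meson PowI finite_Pow_iff rev_finite_subset subsetI)
  have "\<forall>S\<in>\<S>. \<exists>Tr. decomposes Tr (independent_pairs S)" using decomposes_span2 unfolding \<S>_def by blast
  then obtain Tr where Tr: "\<And>S. S \<in> \<S> \<Longrightarrow> decomposes (Tr S) (independent_pairs S)" by metis
  have span_of: "S = span2 u v" if "S \<in> \<S>" "(u, v) \<in> independent_pairs S" for S u v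
    using that span2_cong unfolding \<S>_def independent_pairs_def by blast
  have gX: "decomposes (\<Union>S\<in>\<S>. Tr S) (\<Union>S\<in>\<S>. independent_pairs S)"
  proof (rule decomposes_Union[OF \<open>finite \<S>\<close> Tr])
    fix S S' assume S: "S \<in> \<S>" "S' \<in> \<S>" "S \<noteq> S'"
    show "independent_pairs S \<inter> independent_pairs S' = {}"
    proof (rule ccontr)
      assume "independent_pairs S \<inter> independent_pairs S' \<noteq> {}"
      then obtain u v where "(u, v) \<in> independent_pairs S" "(u, v) \<in> independent_pairs S'" by auto
      then show False using span_of S by metis
    qed
  qed
  have "(\<Union>S\<in>\<S>. independent_pairs S) = independent_pairs X"
  proof (intro set_eqI iffI)
    fix p assume "p \<in> (\<Union>S\<in>\<S>. independent_pairs S)"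
    then show "p \<in> independent_pairs X" using SX unfolding independent_pairs_def by blast
  next
    fix p assume "p \<in> independent_pairs X"
    then obtain u v where p: "p = (u, v)" "u \<in> X" "v \<in> X" "u \<noteq> 0" "v \<notin> K_line u"
      unfolding independent_pairs_def by blast
    then have "span2 u v \<in> \<S>" unfolding \<S>_def by blast
    moreover have "u \<in> span2 u v" "v \<in> span2 u v"
      using span2_left span2_right K_line_self by blast+
    ultimately show "p \<in> (\<Union>S\<in>\<S>. independent_pairs S)"
      using p unfolding independent_pairs_def by blast
  qed
  then have gX: "decomposes (\<Union>S\<in>\<S>. Tr S) (independent_pairs X)" using gX by simp
  have "independent_pairs X \<subseteq> X \<times> X" unfolding independent_pairs_def by blast
  then have g1: "decomposes (\<Union>t\<in>\<Union>S\<in>\<S>. Tr S. lift_tris e t) (lift_rel e (independent_pairs X))"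
    using decomposes_lift[of X e, OF _ e gX] X_add by blast

  define \<G> where "\<G> = {K_line x | x. x \<in> X \<and> x \<noteq> 0}"
  have GX: "G \<subseteq> X" if "G \<in> \<G>" for G using that kX unfolding \<G>_def by blast
  have "finite \<G>" using GX finX by (meson PowI finite_Pow_iff rev_finite_subset subsetI)
  have "\<forall>G\<in>\<G>. \<exists>Tr. decomposes Tr (distinct_pairs (cone e G))"
  proof
    fix G assume "G \<in> \<G>"
    then obtain x where x: "G = K_line x" "x \<in> X" "x \<noteq> 0" unfolding \<G>_def by blast
    then have "e \<notin> K_line x" using kX e by blast
    then show "\<exists>Tr. decomposes Tr (distinct_pairs (cone e G))" unfolding x(1) by (rule decomposes_cone[OF x(3)])
  qed
  then obtain Tr' where Tr': "\<And>G. G \<in> \<G> \<Longrightarrow> decomposes (Tr' G) (distinct_pairs (cone e G))" by metis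
  have emb_eq: "lift_point e \<epsilon> u = lift_point e \<delta> v \<longleftrightarrow> u = v \<and> \<epsilon> = \<delta>" if "u \<in> X" "v \<in> X" for u v \<epsilon> \<delta>
    by (rule lift_point_eq_iff[of X]) (use X_add e that in blast)+
  have emb0: "lift_point e \<epsilon> u = 0 \<longleftrightarrow> u = 0 \<and> \<not> \<epsilon>" if "u \<in> X" for u \<epsilon>
    using emb_eq[OF that X0, of \<epsilon> False] by (auto simp: lift_point_def)
  have cone_mem: "lift_point e \<epsilon> u \<in> cone e S \<longleftrightarrow> u \<in> S" if "u \<in> X" "S \<subseteq> X" for u \<epsilon> S
    using that emb_eq unfolding cone_def by blast
  have cone_memE: "\<exists>u\<in>X. \<exists>\<epsilon>. z = lift_point e \<epsilon> u" if "z \<in> cone e X" for z using that unfolding cone_def by blast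
  have cone_mono: "cone e S \<subseteq> cone e X" if "S \<subseteq> X" for S using that unfolding cone_def by blast
  \<comment> \<open>A pair in a cone determines the K-line below it. If \<open>u\<close> is zero,
    the first point is \<open>e\<close>, and \<open>v\<close> takes over.\<close>
  have G_of: "G = (if u = 0 then K_line v else K_line u)"
    if G: "G \<in> \<G>" and uv: "u \<in> G" "v \<in> G" "u \<noteq> 0 \<or> v \<noteq> 0" for G u v
  proof -
    obtain x where x: "G = K_line x" using G unfolding \<G>_def by blast
    then show ?thesis using K_line_cong uv by (metis (full_types))
  qed
  \<comment> \<open>Two nonzero points over zero would both be \<open>e\<close>.\<close>
  have not_both: "u \<noteq> 0 \<or> v \<noteq> 0" if "(lift_point e \<epsilon> u, lift_point e \<delta> v) \<in> distinct_pairs S" for u v \<epsilon> \<delta> S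
    using that unfolding distinct_pairs_def lift_point_def by (auto split: if_splits)
  have g2: "decomposes (\<Union>G\<in>\<G>. Tr' G) (\<Union>G\<in>\<G>. distinct_pairs (cone e G))"
  proof (rule decomposes_Union[OF \<open>finite \<G>\<close> Tr'])
    fix G G' assume G: "G \<in> \<G>" "G' \<in> \<G>" "G \<noteq> G'"
    show "distinct_pairs (cone e G) \<inter> distinct_pairs (cone e G') = {}"
    proof (rule ccontr)
      assume "distinct_pairs (cone e G) \<inter> distinct_pairs (cone e G') \<noteq> {}"
      then obtain y z where yz: "(y, z) \<in> distinct_pairs (cone e G)" "(y, z) \<in> distinct_pairs (cone e G')" by auto
      then obtain u v \<epsilon> \<delta> where uv: "y = lift_point e \<epsilon> u" "z = lift_point e \<delta> v" "u \<in> G" "v \<in> G"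
        unfolding distinct_pairs_def cone_def by blast
      have "u \<in> X" "v \<in> X" using uv GX G by blast+
      then have "u \<in> G'" "v \<in> G'"
        using yz(2) cone_mem[OF _ GX[OF G(2)]] unfolding uv distinct_pairs_def by blast+
      then show False using G_of[OF G(1) uv(3,4)] G_of[OF G(2)] not_both yz(1) G(3) unfolding uv by metis
    qed
  qed
  \<comment> \<open>Together with \<open>lift\<close> this sorts the pairs of distinct nonzero
    points: K-dependence of the components in \<open>X\<close> decides which of the two
    decompositions applies.\<close>
  have dep: "(lift_point e \<epsilon> u, lift_point e \<delta> v) \<in> (\<Union>G\<in>\<G>. distinct_pairs (cone e G)) \<longleftrightarrow>
      lift_point e \<epsilon> u \<noteq> 0 \<and> lift_point e \<delta> v \<noteq> 0 \<and> lift_point e \<epsilon> u \<noteq> lift_point e \<delta> v \<and> \<not> (u \<noteq> 0 \<and> v \<notin> K_line u)"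
    if X: "u \<in> X" "v \<in> X" for u v \<epsilon> \<delta>
  proof
    assume "(lift_point e \<epsilon> u, lift_point e \<delta> v) \<in> (\<Union>G\<in>\<G>. distinct_pairs (cone e G))"
    then obtain G where G: "G \<in> \<G>" "(lift_point e \<epsilon> u, lift_point e \<delta> v) \<in> distinct_pairs (cone e G)" by blast
    then have "u \<in> G" "v \<in> G" using cone_mem[OF _ GX[OF G(1)]] X unfolding distinct_pairs_def by blast+
    then have "\<not> (u \<noteq> 0 \<and> v \<notin> K_line u)" using G_of[OF G(1), of u v] not_both[OF G(2)] by auto
    then show "lift_point e \<epsilon> u \<noteq> 0 \<and> lift_point e \<delta> v \<noteq> 0 \<and> lift_point e \<epsilon> u \<noteq> lift_point e \<delta> v \<and> \<not> (u \<noteq> 0 \<and> v \<notin> K_line u)"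
      using G(2) unfolding distinct_pairs_def by blast
  next
    assume *: "lift_point e \<epsilon> u \<noteq> 0 \<and> lift_point e \<delta> v \<noteq> 0 \<and> lift_point e \<epsilon> u \<noteq> lift_point e \<delta> v \<and> \<not> (u \<noteq> 0 \<and> v \<notin> K_line u)"
    then have ne: "u \<noteq> 0 \<or> v \<noteq> 0" unfolding lift_point_def by (auto split: if_splits)
    define G where "G = (if u = 0 then K_line v else K_line u)"
    have "G \<in> \<G>" using ne X unfolding G_def \<G>_def by auto
    moreover have "u \<in> G" "v \<in> G" using * ne K_line_self K_line_0 unfolding G_def by auto
    then have "(lift_point e \<epsilon> u, lift_point e \<delta> v) \<in> distinct_pairs (cone e G)"
      using * unfolding distinct_pairs_def cone_def by blast
    ultimately show "(lift_point e \<epsilon> u, lift_point e \<delta> v) \<in> (\<Union>G\<in>\<G>. distinct_pairs (cone e G))" by blast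
  qed
  have lift: "(lift_point e \<epsilon> u, lift_point e \<delta> v) \<in> lift_rel e (independent_pairs X) \<longleftrightarrow> u \<noteq> 0 \<and> v \<notin> K_line u"
    if X: "u \<in> X" "v \<in> X" for u v \<epsilon> \<delta>
  proof
    assume "(lift_point e \<epsilon> u, lift_point e \<delta> v) \<in> lift_rel e (independent_pairs X)"
    then obtain \<epsilon>' \<delta>' u' v' where *: "lift_point e \<epsilon> u = lift_point e \<epsilon>' u'" "lift_point e \<delta> v = lift_point e \<delta>' v'" "(u', v') \<in> independent_pairs X"
      unfolding lift_rel_def by blast
    then have "u' = u" "v' = v" using emb_eq X unfolding independent_pairs_def by blast+
    then show "u \<noteq> 0 \<and> v \<notin> K_line u" using *(3) unfolding independent_pairs_def by blast
  next
    assume "u \<noteq> 0 \<and> v \<notin> K_line u"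
    then show "(lift_point e \<epsilon> u, lift_point e \<delta> v) \<in> lift_rel e (independent_pairs X)"
      using X unfolding lift_rel_def independent_pairs_def by blast
  qed
  have lift_ne: "lift_point e \<epsilon> u \<noteq> 0 \<and> lift_point e \<delta> v \<noteq> 0 \<and> lift_point e \<epsilon> u \<noteq> lift_point e \<delta> v"
    if X: "u \<in> X" "v \<in> X" and uv: "u \<noteq> 0 \<and> v \<notin> K_line u" for u v \<epsilon> \<delta>
  proof -
    have "v \<noteq> 0" "u \<noteq> v" using uv K_line_0 K_line_self by metis+
    then show ?thesis using X uv emb0 emb_eq by blast
  qed
  have lift_X: "p \<in> cone e X \<times> cone e X" if "p \<in> lift_rel e (independent_pairs X)" for p
    using that unfolding lift_rel_def independent_pairs_def cone_def by blast
  have dep_X: "p \<in> cone e X \<times> cone e X" if "p \<in> (\<Union>G\<in>\<G>. distinct_pairs (cone e G))" for p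
    using that cone_mono GX unfolding distinct_pairs_def by blast
  have disj: "lift_rel e (independent_pairs X) \<inter> (\<Union>G\<in>\<G>. distinct_pairs (cone e G)) = {}"
  proof (rule ccontr)
    assume "lift_rel e (independent_pairs X) \<inter> (\<Union>G\<in>\<G>. distinct_pairs (cone e G)) \<noteq> {}"
    then obtain p where p: "p \<in> lift_rel e (independent_pairs X)" "p \<in> (\<Union>G\<in>\<G>. distinct_pairs (cone e G))" by blast
    then obtain u v \<epsilon> \<delta> where uv: "p = (lift_point e \<epsilon> u, lift_point e \<delta> v)" "u \<in> X" "v \<in> X"
      using lift_X[OF p(1)] cone_memE by blast
    then show False using p lift[OF uv(2,3)] dep[OF uv(2,3)] by blast
  qed
  have "lift_rel e (independent_pairs X) \<union> (\<Union>G\<in>\<G>. distinct_pairs (cone e G)) = distinct_pairs (cone e X)"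
  proof (intro set_eqI)
    fix p
    show "p \<in> lift_rel e (independent_pairs X) \<union> (\<Union>G\<in>\<G>. distinct_pairs (cone e G)) \<longleftrightarrow> p \<in> distinct_pairs (cone e X)"
    proof (cases "p \<in> cone e X \<times> cone e X")
      case False
      then show ?thesis using lift_X dep_X unfolding distinct_pairs_def by blast
    next
      case True
      then obtain u v \<epsilon> \<delta> where uv: "p = (lift_point e \<epsilon> u, lift_point e \<delta> v)" "u \<in> X" "v \<in> X"
        using cone_memE by blast
      have "p \<in> distinct_pairs (cone e X) \<longleftrightarrow> lift_point e \<epsilon> u \<noteq> 0 \<and> lift_point e \<delta> v \<noteq> 0 \<and> lift_point e \<epsilon> u \<noteq> lift_point e \<delta> v"
        using True unfolding uv(1) distinct_pairs_def by blast
      then show ?thesis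
        unfolding Un_iff uv(1) lift[OF uv(2,3)] dep[OF uv(2,3)] using lift_ne[OF uv(2,3)] by blast
    qed
  qed
  then have "decomposes ((\<Union>t\<in>\<Union>S\<in>\<S>. Tr S. lift_tris e t) \<union> (\<Union>G\<in>\<G>. Tr' G)) (distinct_pairs (cone e X))"
    using decomposes_Un[OF g1 g2 disj] by simp
  then show ?thesis
    using balanced_of_decomposes[OF subspace_tuples[of "6 * k + 1"]] unfolding V by blast
qed

section \<open>Double counting: the condition on the dimension\<close>

lemma card_pairs_of:
  assumes "nondeg t"
  shows "card (pairs_of t) = 18" and "card {x. x \<noteq> 0 \<and> covers (triangle_of t) x} = 6"
proof -
  obtain a b c where t: "t = (a, b, c)" by (cases t)
  have ne: "a \<noteq> 0" "b \<noteq> 0" "c \<noteq> 0" "a \<noteq> b" "b \<noteq> c" "c \<noteq> a" "a + b \<noteq> c" "b + c \<noteq> a" "c + a \<noteq> b"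
    "a + b \<noteq> b + c" "a + b \<noteq> c + a" "b + c \<noteq> c + a"
    using assms unfolding t by (auto simp: vec_add_eq_iff add.commute add.left_commute)
  note ne' = ne ne[symmetric]
  have pairs: "pairs_of t = {(a, b), (a, a + b), (b, a), (b, a + b), (a + b, a), (a + b, b),
      (b, c), (b, b + c), (c, b), (c, b + c), (b + c, b), (b + c, c),
      (c, a), (c, c + a), (a, c), (a, c + a), (c + a, c), (c + a, a)}"
    unfolding t by (simp add: flags_def insert_commute)
  show "card (pairs_of t) = 18" unfolding pairs by (simp add: ne')
  have "{x. x \<noteq> 0 \<and> covers (triangle_of t) x} = {a, b, c, a + b, b + c, c + a}"
    using ne unfolding t by (auto simp: covers_def line_def)
  then show "card {x. x \<noteq> 0 \<and> covers (triangle_of t) x} = 6" by (simp add: ne')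
qed

text \<open>With \<open>M = 2 ^ m\<close>, counting pairs gives
  \<open>(M - 1) * (M - 2) = 18 * card \<T>\<close> and counting incidences gives
  \<open>(M - 1) * r = 6 * card \<T>\<close>. So \<open>M\<close> is 2 modulo 3, then
  \<open>M - 1\<close> is prime to 3, and 9 divides \<open>M - 2\<close>. As 2 has order 6 modulo 9,
  this fixes \<open>m\<close> modulo 6.\<close>

lemma balanced_design_mod_6:
  assumes m: "m \<ge> 1" and D: "seq.balanced_triangle_design (tuples m :: vec set) \<T>"
  shows "m mod 6 = 1"
proof -
  define V where "V = (tuples m :: vec set)"
  have V: "finite V" "card V = 2 ^ m" using card_tuples unfolding V_def by auto
  have V0: "0 \<in> V" unfolding V_def by (simp add: tuples_def)
  have V_add: "x + y \<in> V" if "x \<in> V" "y \<in> V" for x y using that tuples_add unfolding V_def by blast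
  have des: "seq.triangle_design V \<T>" and "\<exists>r. \<forall>x\<in>V. x \<noteq> 0 \<longrightarrow> card {T \<in> \<T>. covers T x} = r"
    using D unfolding seq.balanced_triangle_design_def V_def by simp_all
  then obtain r where r: "\<And>x. x \<in> V \<Longrightarrow> x \<noteq> 0 \<Longrightarrow> card {T \<in> \<T>. covers T x} = r" by metis
  have T: "seq.triangle V T" if "T \<in> \<T>" for T
    using des that unfolding seq.triangle_design_def by simp
  have ex1: "\<exists>!T. T \<in> \<T> \<and> W \<in> T" if "seq.subspace W" "W \<subseteq> V" "seq.dim W = 2" for W
    using des that unfolding seq.triangle_design_def by simp
  have "\<forall>T\<in>\<T>. \<exists>t. nondeg t \<and> pairs_of t \<subseteq> distinct_pairs V \<and> T = triangle_of t"
  proof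
    fix T assume "T \<in> \<T>"
    then obtain t where t: "nondeg t" "fst t \<in> V" "fst (snd t) \<in> V" "snd (snd t) \<in> V" "T = triangle_of t"
      using T[unfolded triangle_iff] by metis
    obtain a b c where abc: "t = (a, b, c)" by (cases t)
    have "flags a b \<subseteq> V \<times> V" "flags b c \<subseteq> V \<times> V" "flags c a \<subseteq> V \<times> V"
      using t(2-4) V_add unfolding abc flags_def by simp_all
    then have "pairs_of t \<subseteq> V \<times> V" unfolding abc by simp
    then have "pairs_of t \<subseteq> distinct_pairs V"
      using pairs_of_nondeg[OF t(1)] unfolding distinct_pairs_def by blast
    then show "\<exists>t. nondeg t \<and> pairs_of t \<subseteq> distinct_pairs V \<and> T = triangle_of t" using t by blast
  qed
  then obtain f where f: "\<And>T. T \<in> \<T> \<Longrightarrow> nondeg (f T)" "\<And>T. T \<in> \<T> \<Longrightarrow> pairs_of (f T) \<subseteq> distinct_pairs V"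
    "\<And>T. T \<in> \<T> \<Longrightarrow> T = triangle_of (f T)" by metis
  have W: "\<exists>!T. T \<in> \<T> \<and> line x y \<in> T" if xy: "(x, y) \<in> distinct_pairs V" for x y
  proof (rule ex1)
    have "x \<noteq> 0" "y \<noteq> 0" "x \<noteq> y" "x \<in> V" "y \<in> V" using xy unfolding distinct_pairs_def by auto
    then have "seq.subspace (line x y) \<and> seq.dim (line x y) = 2" unfolding dim_2_iff by blast
    then show "seq.subspace (line x y)" "seq.dim (line x y) = 2" by auto
    show "line x y \<subseteq> V" using \<open>x \<in> V\<close> \<open>y \<in> V\<close> V0 V_add unfolding line_def by auto
  qed
  have in_pairs: "(x, y) \<in> pairs_of (f T) \<longleftrightarrow> line x y \<in> T" if "(x, y) \<in> distinct_pairs V" "T \<in> \<T>" for x y T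
    using line_in_triangle_of[of x y "f T"] f(1)[OF that(2)] f(3)[OF that(2)] that(1) unfolding distinct_pairs_def by auto
  have finP: "finite (distinct_pairs V)"
    by (rule finite_subset[of _ "V \<times> V"]) (auto simp: distinct_pairs_def V(1))
  have disj: "pairs_of (f T) \<inter> pairs_of (f T') = {}" if "T \<in> \<T>" "T' \<in> \<T>" "T \<noteq> T'" for T T'
  proof (rule ccontr)
    assume "pairs_of (f T) \<inter> pairs_of (f T') \<noteq> {}"
    then obtain x y where xy: "(x, y) \<in> pairs_of (f T)" "(x, y) \<in> pairs_of (f T')" by auto
    then have d: "(x, y) \<in> distinct_pairs V" using f(2)[OF that(1)] by blast
    show False using W[OF d] in_pairs[OF d that(1)] in_pairs[OF d that(2)] xy that by blast
  qed
  have cover: "distinct_pairs V = (\<Union>T\<in>\<T>. pairs_of (f T))"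
  proof (intro set_eqI iffI)
    fix p assume p: "p \<in> distinct_pairs V"
    obtain x y where xy: "p = (x, y)" by (cases p)
    obtain T where "T \<in> \<T>" "line x y \<in> T" using W p unfolding xy by blast
    then show "p \<in> (\<Union>T\<in>\<T>. pairs_of (f T))" using in_pairs p unfolding xy by blast
  qed (use f(2) in blast)
  have finT: "finite \<T>"
  proof -
    have "pairs_of (f T) \<noteq> {}" if "T \<in> \<T>" for T using card_pairs_of(1)[OF f(1)[OF that]] by auto
    then have "inj_on (\<lambda>T. pairs_of (f T)) \<T>" using disj by (intro inj_onI) (metis inf.idem)
    moreover have "finite ((\<lambda>T. pairs_of (f T)) ` \<T>)"
      using finite_UnionD[of "(\<lambda>T. pairs_of (f T)) ` \<T>"] finP cover by simp
    ultimately show ?thesis using finite_imageD by blast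
  qed
  have "card (distinct_pairs V) = (\<Sum>T\<in>\<T>. card (pairs_of (f T)))"
    unfolding cover
  proof (rule card_UN_disjoint[OF finT])
    show "\<forall>T\<in>\<T>. finite (pairs_of (f T))" using f(2) finP finite_subset by blast
    show "\<forall>T\<in>\<T>. \<forall>T'\<in>\<T>. T \<noteq> T' \<longrightarrow> pairs_of (f T) \<inter> pairs_of (f T') = {}" using disj by blast
  qed
  also have "\<dots> = 18 * card \<T>" using card_pairs_of(1)[OF f(1)] by simp
  finally have count1: "card (distinct_pairs V) = 18 * card \<T>" .
  have "distinct_pairs V = (SIGMA x:V - {0}. V - {0, x})" unfolding distinct_pairs_def by auto
  then have "card (distinct_pairs V) = (\<Sum>x\<in>V - {0}. card (V - {0, x}))"
    using V(1) by (simp add: card_SigmaI)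
  also have "\<dots> = (\<Sum>x\<in>V - {0}. 2 ^ m - 2)"
    by (rule sum.cong[OF refl]) (use V V0 in \<open>auto simp: card_Diff_subset\<close>)
  finally have count2: "card (distinct_pairs V) = (2 ^ m - 1) * (2 ^ m - 2)" using V V0 by simp
  \<comment> \<open>Incidences of points and triangles; every triangle covers its three vertices and
    three middles.\<close>
  have "(\<Sum>x\<in>V - {0}. card {T \<in> \<T>. covers T x}) = (\<Sum>T\<in>\<T>. card {x \<in> V - {0}. covers T x})"
    using sum.swap_restrict[of "V - {0}" \<T> "\<lambda>_ _. 1 :: nat" "\<lambda>x T. covers T x"] V(1) finT by simp
  also have "\<dots> = (\<Sum>T\<in>\<T>. 6)"
  proof (rule sum.cong[OF refl])
    fix T assume T: "T \<in> \<T>"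
    have "x \<in> V" if cov: "covers T x" "x \<noteq> 0" for x
    proof -
      obtain y where "(x, y) \<in> pairs_of (f T)"
        using covers_iff_pairs[OF f(1)[OF T] cov(2)] cov(1) f(3)[OF T] by auto
      then show ?thesis using f(2)[OF T] unfolding distinct_pairs_def by blast
    qed
    then have "{x \<in> V - {0}. covers T x} = {x. x \<noteq> 0 \<and> covers (triangle_of (f T)) x}" using f(3)[OF T] by auto
    then show "card {x \<in> V - {0}. covers T x} = 6" using card_pairs_of(2)[OF f(1)[OF T]] by simp
  qed
  also have "(\<Sum>x\<in>V - {0}. card {T \<in> \<T>. covers T x}) = (2 ^ m - 1) * r"
    using r V V0 by simp
  finally have count3: "(2 ^ m - 1) * r = 6 * card \<T>" by simp
  define M :: nat where "M = 2 ^ m"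
  have M: "M \<ge> 2" using m self_le_power[of 2 m] unfolding M_def by simp
  have "(M - 1) * (M - 2) = (M - 1) * (3 * r)"
  proof -
    have "(M - 1) * (M - 2) = 3 * (6 * card \<T>)" using count1 count2 unfolding M_def by simp
    also have "\<dots> = (M - 1) * (3 * r)" unfolding count3[symmetric] M_def by simp
    finally show ?thesis .
  qed
  then have M2: "M - 2 = 3 * r" using M by simp
  have M9: "18 * card \<T> = (M - 1) * (M - 2)" using count1 count2 unfolding M_def by simp
  have "M mod 9 = 2 ^ (m mod 6) mod 9"
  proof -
    have "M = 2 ^ (6 * (m div 6) + m mod 6)" unfolding M_def by simp
    also have "\<dots> = (2 ^ 6) ^ (m div 6) * 2 ^ (m mod 6)" by (simp only: power_add power_mult)
    finally have "M mod 9 = ((2 ^ 6) ^ (m div 6) mod 9) * 2 ^ (m mod 6) mod 9" by (simp only: mod_mult_left_eq)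
    moreover have "(2 ^ 6) ^ (m div 6) mod 9 = (2 ^ 6 mod 9) ^ (m div 6) mod (9 :: nat)"
      by (simp only: power_mod)
    moreover have "(2 ^ 6 mod 9 :: nat) = 1" by simp
    ultimately show ?thesis by simp
  qed
  then have mod: "m mod 6 = k \<Longrightarrow> M mod 9 = 2 ^ k mod 9" for k by simp
  \<comment> \<open>For these residues \<open>(M - 1) * (M - 2)\<close> would be 12 or 42 modulo 9,
    but it is a multiple of 18.\<close>
  have not_5_8: "M mod 9 \<noteq> 5 \<and> M mod 9 \<noteq> 8"
  proof -
    have "(M - 1) * (M - 2) mod 9 = ((M - 1) mod 9) * ((M - 2) mod 9) mod 9" by (simp only: mod_mult_eq)
    moreover have "(M - 1) * (M - 2) mod 9 = 0" unfolding M9[symmetric] by simp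
    ultimately have "((M - 1) mod 9) * ((M - 2) mod 9) mod 9 = 0" by simp
    moreover have "(M - d) mod 9 = c - d" if "M mod 9 = c" "d \<le> c" for c d
    proof -
      have "M = 9 * (M div 9) + c" using that(1) mult_div_mod_eq[of 9 M] by simp
      then have "M - d = c - d + 9 * (M div 9)" using that(2) by linarith
      then have "(M - d) mod 9 = (c - d) mod 9" by (simp only: mod_mult_self2)
      moreover have "c < 9" using that(1) by auto
      ultimately show ?thesis by simp
    qed
    ultimately have "(c - 1) * (c - 2) mod 9 = 0" if "M mod 9 = c" "2 \<le> c" for c
      using that by (metis le_trans one_le_numeral)
    from this[of 5] this[of 8] show ?thesis by auto
  qed
  \<comment> \<open>These residues are 1 modulo 3 and contradict \<open>M - 2 = 3 * r\<close>; they
    stem from even \<open>m\<close>.\<close>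
  have not_0_1: "M mod 9 \<noteq> 1 \<and> M mod 9 \<noteq> 4 \<and> M mod 9 \<noteq> 7"
  proof -
    have "M = 2 + 3 * r" using M2 M by linarith
    then have "M mod 3 = 2 mod 3" by (simp only: mod_mult_self2)
    moreover have "M mod 9 mod 3 = M mod 3" by (rule mod_mod_cancel) simp
    ultimately show ?thesis by auto
  qed
  have "m mod 6 < 6" by simp
  then have "m mod 6 = 0 \<or> m mod 6 = 1 \<or> m mod 6 = 2 \<or> m mod 6 = 3 \<or> m mod 6 = 4 \<or> m mod 6 = 5"
    by linarith
  then show ?thesis
    using mod[of 0] mod[of 2] mod[of 3] mod[of 4] mod[of 5] not_5_8 not_0_1 by auto
qed

theorem theorem7:
  fixes m :: nat
  assumes "m \<ge> 7"
    and "\<exists>\<T>. seq.balanced_triangle_design (tuples m :: (nat \<Rightarrow> bit) set) \<T>"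
  shows "\<exists>\<T>. seq.balanced_triangle_design (tuples (m + 6) :: (nat \<Rightarrow> bit) set) \<T>"
proof -
  have "m mod 6 = 1" using assms balanced_design_mod_6 by auto
  then have m: "m + 6 = 6 * (m div 6 + 1) + 1" by presburger
  show ?thesis unfolding m by (rule balanced_design_exists)
qed

end
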